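(* Let $N\trianglelefteq G$ be finite groups, $(\theta,V)$ an irreducible $N$-representation of dimension $d_\theta$, and suppose that $(G,N,\theta)$ is a multiplicity-free triple. Fix $\xi\in\widehat I(\theta)$ and $v\in V$ with $\|v\|=1$, and set $\Psi(h)=\langle v,\xi(h)v\rangle$ for all $h\in I_G(\theta)$. Then the following hold. (1) The map $$L(I_G(\theta)/N)\to\mathcal H(G,N,\psi),\qquad f\mapsto\frac{d_\theta}{|I_G(\theta)|}\,\widetilde f\,\Psi$$ is an isomorphism of commutative algebras. (2) $$\mathrm{Ind}_N^G\theta\sim\bigoplus_{\chi\in\widehat{I_G(\theta)/N}}\mathrm{Ind}_{I_G(\theta)}^G(\xi\otimes\widetilde\chi)$$ is the decomposition of $\mathrm{Ind}_N^G\theta$ into irreducibles (that is, into the spherical representations of the multiplicity-free triple $(G,N,\theta)$). (3) The spherical function associated with $\mathrm{Ind}_{I_G(\theta)}^G(\xi\otimes\widetilde\chi)$ is given by $\phi^\chi=\widetilde{\overline\chi}\,\Psi$.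
   Context: Representations are unitary on finite-dimensional complex inner product spaces; inner products are conjugate-linear in the second argument; $\sim$ denotes equivalence of representations. $(G,N,\theta)$ is a multiplicity-free triple if $\mathrm{Ind}_N^G\theta$ contains every irreducible $G$-representation at most once. $I_G(\theta)=\{h\in G:{}^h\theta\sim\theta\}$ is the inertia group, where ${}^h\theta(n)=\theta(h^{-1}nh)$ for $n\in N$. $\widehat I(\theta)$ is the set of irreducible representations of $I_G(\theta)$ (up to equivalence) contained in $\mathrm{Ind}_N^{I_G(\theta)}\theta$. In the multiplicity-free case $I_G(\theta)/N$ is Abelian and each $\xi\in\widehat I(\theta)$ satisfies $\mathrm{Res}_N\xi\sim\theta$; $\xi$ is realized on $V$ so that $\mathrm{Res}_N\xi=\theta$. $\widehat{I_G(\theta)/N}$ is the group of characters $\chi:I_G(\theta)/N\to\{z\in\mathbb C:|z|=1\}$. For a function $f$ on $I_G(\theta)/N$, $\widetilde f(h)=f(hN)$ for $h\in I_G(\theta)$ (inflation); $\overline\chi$ is the complex conjugate of $\chi$. Functions on $I_G(\theta)$ such as $\widetilde f\,\Psi$ (pointwise product) are regarded as functions on $G$ vanishing outside $I_G(\theta)$. $L(H)$ denotes the group algebra of a finite group $H$ (functions $H\to\mathbb C$) with the ordinary convolution $[f_1*f_2](g)=\sum_{h\in H}f_1(gh)f_2(h^{-1})$. $\psi\in L(G)$ is given by $\psi(n)=\frac{d_\theta}{|N|}\langle v,\theta(n)v\rangle$ for $n\in N$ and $0$ off $N$; $\mathcal H(G,N,\psi)=\{f\in L(G):f=\psi*f*\psi\}$,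 an algebra under convolution. For an irreducible $G$-representation $(\sigma,W)$ contained in $\mathrm{Ind}_N^G\theta$ (a spherical representation), the associated spherical function is $\phi^\sigma(g)=\langle w^\sigma,\sigma(g)w^\sigma\rangle_W$, where $w^\sigma=L_\sigma v$ and $L_\sigma:V\to W$ is an isometric $N$-intertwiner (unique up to a unimodular scalar).
   Formalization: In (1) the printed constant d_θ/|I_G(θ)| is not multiplicative for ordinary convolution unless I_G(θ)=N; proved instead with d_θ/|N|, and with d_θ/|I_G(θ)| when the convolution on L(I_G(θ)/N) is divided by |I_G(θ)/N|. *)

theory Defs
  imports Complex_Main "HOL-Library.Function_Algebras" "HOL-Library.FuncSet" "HOL-Algebra.Module" "HOL-Algebra.QuotRing"
begin

section \<open>Finite-dimensional complex inner product spaces\<close>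

text \<open>The vectors form a subset of a type of class \<open>ab_group_add\<close>, which supplies the addition, so
  that subspaces, spaces of functions and direct sums are objects of the same kind.\<close>

record 'v cips =
  vecs :: "'v set"
  cscale :: "complex \<Rightarrow> 'v \<Rightarrow> 'v"
  cinner :: "'v \<Rightarrow> 'v \<Rightarrow> complex"

text \<open>The third and fourth inner product laws make \<open>cinner\<close> linear in the first and conjugate-linear
  in the second argument.\<close>

definition fd_inner_space :: "'v::ab_group_add cips \<Rightarrow> bool" where
  "fd_inner_space V \<longleftrightarrow>
     vector_space (cscale V) \<and>
     (\<exists>B. finite B \<and> vecs V = module.span (cscale V) B) \<and>
     (\<forall>x\<in>vecs V. \<forall>y\<in>vecs V. \<forall>z\<in>vecs V. cinner V (x + y) z = cinner V x z + cinner V y z) \<and>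
     (\<forall>c. \<forall>x\<in>vecs V. \<forall>y\<in>vecs V. cinner V (cscale V c x) y = c * cinner V x y) \<and>
     (\<forall>x\<in>vecs V. \<forall>y\<in>vecs V. cinner V y x = cnj (cinner V x y)) \<and>
     (\<forall>x\<in>vecs V. x \<noteq> 0 \<longrightarrow> 0 < Re (cinner V x x))"

definition cdim :: "'v::ab_group_add cips \<Rightarrow> nat" where
  "cdim V = vector_space.dim (cscale V) (vecs V)"

definition linear_map :: "'v::ab_group_add cips \<Rightarrow> 'w::ab_group_add cips \<Rightarrow> ('v \<Rightarrow> 'w) \<Rightarrow> bool" where
  "linear_map V W T \<longleftrightarrow>
     T \<in> vecs V \<rightarrow> vecs W \<and>
     (\<forall>x\<in>vecs V. \<forall>y\<in>vecs V. T (x + y) = T x + T y) \<and>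
     (\<forall>c. \<forall>x\<in>vecs V. T (cscale V c x) = cscale W c (T x))"

definition isometric_on :: "'v::ab_group_add cips \<Rightarrow> 'w::ab_group_add cips \<Rightarrow> ('v \<Rightarrow> 'w) \<Rightarrow> bool" where
  "isometric_on V W T \<longleftrightarrow> (\<forall>x\<in>vecs V. \<forall>y\<in>vecs V. cinner W (T x) (T y) = cinner V x y)"


section \<open>Unitary representations\<close>

definition unitary_rep ::
    "('g, 'm) monoid_scheme \<Rightarrow> 'v::ab_group_add cips \<Rightarrow> ('g \<Rightarrow> 'v \<Rightarrow> 'v) \<Rightarrow> bool" where
  "unitary_rep G V \<rho> \<longleftrightarrow>
     fd_inner_space V \<and>
     (\<forall>g\<in>carrier G. linear_map V V (\<rho> g) \<and> isometric_on V V (\<rho> g)) \<and>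
     (\<forall>x\<in>vecs V. \<rho> \<one>\<^bsub>G\<^esub> x = x) \<and>
     (\<forall>g\<in>carrier G. \<forall>h\<in>carrier G. \<forall>x\<in>vecs V. \<rho> (g \<otimes>\<^bsub>G\<^esub> h) x = \<rho> g (\<rho> h x))"

definition intertwiner ::
    "('g, 'm) monoid_scheme \<Rightarrow> 'v::ab_group_add cips \<Rightarrow> ('g \<Rightarrow> 'v \<Rightarrow> 'v) \<Rightarrow>
     'w::ab_group_add cips \<Rightarrow> ('g \<Rightarrow> 'w \<Rightarrow> 'w) \<Rightarrow> ('v \<Rightarrow> 'w) \<Rightarrow> bool" where
  "intertwiner G V \<rho> W \<sigma> T \<longleftrightarrow>
     linear_map V W T \<and> (\<forall>g\<in>carrier G. \<forall>x\<in>vecs V. T (\<rho> g x) = \<sigma> g (T x))"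

definition equiv_rep ::
    "('g, 'm) monoid_scheme \<Rightarrow> 'v::ab_group_add cips \<Rightarrow> ('g \<Rightarrow> 'v \<Rightarrow> 'v) \<Rightarrow>
     'w::ab_group_add cips \<Rightarrow> ('g \<Rightarrow> 'w \<Rightarrow> 'w) \<Rightarrow> bool" where
  "equiv_rep G V \<rho> W \<sigma> \<longleftrightarrow> (\<exists>T. intertwiner G V \<rho> W \<sigma> T \<and> bij_betw T (vecs V) (vecs W))"

definition invariant_subspace ::
    "('g, 'm) monoid_scheme \<Rightarrow> 'v::ab_group_add cips \<Rightarrow> ('g \<Rightarrow> 'v \<Rightarrow> 'v) \<Rightarrow> 'v set \<Rightarrow> bool" where
  "invariant_subspace G V \<rho> U \<longleftrightarrow>
     module.subspace (cscale V) U \<and> U \<subseteq> vecs V \<and> (\<forall>g\<in>carrier G. \<forall>x\<in>U. \<rho> g x \<in> U)"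

definition irreducible_rep ::
    "('g, 'm) monoid_scheme \<Rightarrow> 'v::ab_group_add cips \<Rightarrow> ('g \<Rightarrow> 'v \<Rightarrow> 'v) \<Rightarrow> bool" where
  "irreducible_rep G V \<rho> \<longleftrightarrow>
     unitary_rep G V \<rho> \<and> vecs V \<noteq> {0} \<and>
     (\<forall>U. invariant_subspace G V \<rho> U \<longrightarrow> U = {0} \<or> U = vecs V)"

text \<open>\<open>V\<lparr>vecs := U\<rparr>\<close> is the subspace \<open>U\<close> of \<open>V\<close> with the restricted inner product.\<close>

definition contained_rep ::
    "('g, 'm) monoid_scheme \<Rightarrow> 'w::ab_group_add cips \<Rightarrow> ('g \<Rightarrow> 'w \<Rightarrow> 'w) \<Rightarrow>
     'v::ab_group_add cips \<Rightarrow> ('g \<Rightarrow> 'v \<Rightarrow> 'v) \<Rightarrow> bool" where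
  "contained_rep G W \<sigma> V \<rho> \<longleftrightarrow>
     (\<exists>U. invariant_subspace G V \<rho> U \<and> equiv_rep G W \<sigma> (V\<lparr>vecs := U\<rparr>) \<rho>)"

text \<open>No irreducible representation is contained twice: orthogonal irreducible subrepresentations are
  never equivalent.\<close>

definition multiplicity_free ::
    "('g, 'm) monoid_scheme \<Rightarrow> 'v::ab_group_add cips \<Rightarrow> ('g \<Rightarrow> 'v \<Rightarrow> 'v) \<Rightarrow> bool" where
  "multiplicity_free G V \<rho> \<longleftrightarrow>
     (\<forall>U\<^sub>1 U\<^sub>2. invariant_subspace G V \<rho> U\<^sub>1 \<and> irreducible_rep G (V\<lparr>vecs := U\<^sub>1\<rparr>) \<rho> \<and>
              invariant_subspace G V \<rho> U\<^sub>2 \<and> irreducible_rep G (V\<lparr>vecs := U\<^sub>2\<rparr>) \<rho> \<and>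
              (\<forall>x\<in>U\<^sub>1. \<forall>y\<in>U\<^sub>2. cinner V x y = 0) \<longrightarrow>
        \<not> equiv_rep G (V\<lparr>vecs := U\<^sub>1\<rparr>) \<rho> (V\<lparr>vecs := U\<^sub>2\<rparr>) \<rho>)"

text \<open>Orthogonal direct sum of a family indexed by a finite set \<open>X\<close>; its vectors are the families
  vanishing outside \<open>X\<close>.\<close>

definition dsum_space :: "'i set \<Rightarrow> ('i \<Rightarrow> 'v::ab_group_add cips) \<Rightarrow> ('i \<Rightarrow> 'v) cips" where
  "dsum_space X V =
     \<lparr>vecs = {x. (\<forall>i\<in>X. x i \<in> vecs (V i)) \<and> (\<forall>i. i \<notin> X \<longrightarrow> x i = 0)},
      cscale = (\<lambda>c x i. cscale (V i) c (x i)),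
      cinner = (\<lambda>x y. \<Sum>i\<in>X. cinner (V i) (x i) (y i))\<rparr>"

definition dsum_act :: "'i set \<Rightarrow> ('i \<Rightarrow> 'g \<Rightarrow> 'v::ab_group_add \<Rightarrow> 'v) \<Rightarrow> 'g \<Rightarrow> ('i \<Rightarrow> 'v) \<Rightarrow> 'i \<Rightarrow> 'v" where
  "dsum_act X \<rho> g x i = (if i \<in> X then \<rho> i g (x i) else 0)"


section \<open>Induced representations\<close>

text \<open>The induced representation from \<open>K\<close> to \<open>G\<close> is realised by left translation on the functions
  \<open>f\<close> from \<open>G\<close> to \<open>V\<close> with \<open>f(gk) = \<theta>(k\<^sup>-\<^sup>1)f(g)\<close>, set to zero outside the carrier of \<open>G\<close>.\<close>

definition ind_space ::
    "('g, 'm) monoid_scheme \<Rightarrow> 'g set \<Rightarrow> 'v::ab_group_add cips \<Rightarrow> ('g \<Rightarrow> 'v \<Rightarrow> 'v) \<Rightarrow> ('g \<Rightarrow> 'v) cips" where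
  "ind_space G K V \<theta> =
     \<lparr>vecs = {f. (\<forall>g\<in>carrier G. f g \<in> vecs V) \<and> (\<forall>g. g \<notin> carrier G \<longrightarrow> f g = 0) \<and>
                 (\<forall>g\<in>carrier G. \<forall>k\<in>K. f (g \<otimes>\<^bsub>G\<^esub> k) = \<theta> (inv\<^bsub>G\<^esub> k) (f g))},
      cscale = (\<lambda>c f g. cscale V c (f g)),
      cinner = (\<lambda>f\<^sub>1 f\<^sub>2. (\<Sum>g\<in>carrier G. cinner V (f\<^sub>1 g) (f\<^sub>2 g)) / of_nat (card K))\<rparr>"

definition ind_act :: "('g, 'm) monoid_scheme \<Rightarrow> 'g \<Rightarrow> ('g \<Rightarrow> 'v::ab_group_add) \<Rightarrow> 'g \<Rightarrow> 'v" where
  "ind_act G g f x = (if x \<in> carrier G then f (inv\<^bsub>G\<^esub> g \<otimes>\<^bsub>G\<^esub> x) else 0)"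

definition conj_rep ::
    "('g, 'm) monoid_scheme \<Rightarrow> 'g \<Rightarrow> ('g \<Rightarrow> 'v \<Rightarrow> 'v) \<Rightarrow> 'g \<Rightarrow> 'v \<Rightarrow> 'v" where
  "conj_rep G h \<theta> n = \<theta> (inv\<^bsub>G\<^esub> h \<otimes>\<^bsub>G\<^esub> n \<otimes>\<^bsub>G\<^esub> h)"

definition inertia ::
    "('g, 'm) monoid_scheme \<Rightarrow> 'g set \<Rightarrow> 'v::ab_group_add cips \<Rightarrow> ('g \<Rightarrow> 'v \<Rightarrow> 'v) \<Rightarrow> 'g set" where
  "inertia G N V \<theta> =
     {h \<in> carrier G. equiv_rep (G\<lparr>carrier := N\<rparr>) V (conj_rep G h \<theta>) V \<theta>}"

definition inertia_group ::
    "('g, 'm) monoid_scheme \<Rightarrow> 'g set \<Rightarrow> 'v::ab_group_add cips \<Rightarrow> ('g \<Rightarrow> 'v \<Rightarrow> 'v) \<Rightarrow> ('g, 'm) monoid_scheme" where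
  "inertia_group G N V \<theta> = G\<lparr>carrier := inertia G N V \<theta>\<rparr>"

definition inertia_quotient ::
    "('g, 'm) monoid_scheme \<Rightarrow> 'g set \<Rightarrow> 'v::ab_group_add cips \<Rightarrow> ('g \<Rightarrow> 'v \<Rightarrow> 'v) \<Rightarrow> 'g set monoid" where
  "inertia_quotient G N V \<theta> = inertia_group G N V \<theta> Mod N"

definition spherical_rep ::
    "('g, 'm) monoid_scheme \<Rightarrow> 'g set \<Rightarrow> 'v::ab_group_add cips \<Rightarrow> ('g \<Rightarrow> 'v \<Rightarrow> 'v) \<Rightarrow>
     'w::ab_group_add cips \<Rightarrow> ('g \<Rightarrow> 'w \<Rightarrow> 'w) \<Rightarrow> bool" where
  "spherical_rep G N V \<theta> W \<sigma> \<longleftrightarrow>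
     irreducible_rep G W \<sigma> \<and> contained_rep G W \<sigma> (ind_space G N V \<theta>) (ind_act G)"


section \<open>Characters, inflation, matrix coefficients\<close>

definition unitary_chars :: "('h, 'm) monoid_scheme \<Rightarrow> ('h \<Rightarrow> complex) set" where
  "unitary_chars H =
     {\<chi> \<in> carrier H \<rightarrow>\<^sub>E {z. cmod z = 1}.
        \<forall>x\<in>carrier H. \<forall>y\<in>carrier H. \<chi> (x \<otimes>\<^bsub>H\<^esub> y) = \<chi> x * \<chi> y}"

definition infl :: "('g, 'm) monoid_scheme \<Rightarrow> 'g set \<Rightarrow> ('g set \<Rightarrow> complex) \<Rightarrow> 'g \<Rightarrow> complex" where
  "infl G N f h = f (h <#\<^bsub>G\<^esub> N)"

text \<open>The tensor product of \<open>\<xi>\<close> with a one-dimensional character, with \<open>V \<otimes> \<complex>\<close> identified with \<open>V\<close>.\<close>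

definition twist :: "'v cips \<Rightarrow> ('g \<Rightarrow> 'v \<Rightarrow> 'v) \<Rightarrow> ('g \<Rightarrow> complex) \<Rightarrow> 'g \<Rightarrow> 'v \<Rightarrow> 'v" where
  "twist V \<xi> \<chi> h x = cscale V (\<chi> h) (\<xi> h x)"

text \<open>\<open>g \<mapsto> \<langle>w, \<sigma>(g)w\<rangle>\<close> on the set \<open>H\<close>, extended by zero.\<close>

definition coefficient ::
    "'g set \<Rightarrow> 'w cips \<Rightarrow> ('g \<Rightarrow> 'w \<Rightarrow> 'w) \<Rightarrow> 'w \<Rightarrow> 'g \<Rightarrow> complex" where
  "coefficient H W \<sigma> w g = (if g \<in> H then cinner W w (\<sigma> g w) else 0)"

text \<open>\<open>L\<close> is the isometric intertwiner from \<open>V\<close> to the restriction of \<open>W\<close> to \<open>N\<close> for which the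
  spherical function of \<open>(\<sigma>, W)\<close> is \<open>coefficient (carrier G) W \<sigma> (L v)\<close>.\<close>

definition isometric_intertwiner ::
    "('g, 'm) monoid_scheme \<Rightarrow> 'v::ab_group_add cips \<Rightarrow> ('g \<Rightarrow> 'v \<Rightarrow> 'v) \<Rightarrow>
     'w::ab_group_add cips \<Rightarrow> ('g \<Rightarrow> 'w \<Rightarrow> 'w) \<Rightarrow> ('v \<Rightarrow> 'w) \<Rightarrow> bool" where
  "isometric_intertwiner N V \<theta> W \<sigma> L \<longleftrightarrow> intertwiner N V \<theta> W \<sigma> L \<and> isometric_on V W L"


section \<open>Group algebra and Hecke algebra\<close>

definition complex_ring :: "complex ring" where
  "complex_ring = \<lparr>carrier = UNIV, mult = (*), one = 1, zero = 0, add = (+)\<rparr>"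

definition convolution ::
    "('h, 'm) monoid_scheme \<Rightarrow> ('h \<Rightarrow> complex) \<Rightarrow> ('h \<Rightarrow> complex) \<Rightarrow> 'h \<Rightarrow> complex" where
  "convolution H f\<^sub>1 f\<^sub>2 g =
     (if g \<in> carrier H then \<Sum>h\<in>carrier H. f\<^sub>1 (g \<otimes>\<^bsub>H\<^esub> h) * f\<^sub>2 (inv\<^bsub>H\<^esub> h) else 0)"

definition group_algebra :: "('h, 'm) monoid_scheme \<Rightarrow> (complex, 'h \<Rightarrow> complex) module" where
  "group_algebra H =
     \<lparr>carrier = {f. \<forall>x. x \<notin> carrier H \<longrightarrow> f x = 0},
      mult = convolution H,
      one = (\<lambda>x. if x = \<one>\<^bsub>H\<^esub> then 1 else 0),
      zero = (\<lambda>x. 0),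
      add = (\<lambda>f\<^sub>1 f\<^sub>2 x. f\<^sub>1 x + f\<^sub>2 x),
      smult = (\<lambda>c f x. c * f x)\<rparr>"

definition hecke_idem ::
    "'g set \<Rightarrow> 'v::ab_group_add cips \<Rightarrow> ('g \<Rightarrow> 'v \<Rightarrow> 'v) \<Rightarrow> 'v \<Rightarrow> 'g \<Rightarrow> complex" where
  "hecke_idem N V \<theta> v n = of_nat (cdim V) / of_nat (card N) * coefficient N V \<theta> v n"

text \<open>The unit is \<open>\<psi> = hecke_idem N V \<theta> v\<close>; all other operations are those of \<open>group_algebra G\<close>.\<close>

definition hecke_algebra ::
    "('g, 'm) monoid_scheme \<Rightarrow> 'g set \<Rightarrow> ('g \<Rightarrow> complex) \<Rightarrow> (complex, 'g \<Rightarrow> complex) module" where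
  "hecke_algebra G N \<psi> =
     (group_algebra G)
       \<lparr>carrier := {f \<in> carrier (group_algebra G). f = convolution G (convolution G \<psi> f) \<psi>},
        one := \<psi>\<rparr>"

definition algebra_iso ::
    "(complex, 'a) module \<Rightarrow> (complex, 'b) module \<Rightarrow> ('a \<Rightarrow> 'b) set" where
  "algebra_iso A B =
     {T \<in> ring_iso A B. \<forall>c. \<forall>x\<in>carrier A. T (c \<odot>\<^bsub>A\<^esub> x) = c \<odot>\<^bsub>B\<^esub> T x}"

text \<open>The map sending \<open>f\<close> to \<open>c\<close> times the pointwise product of the inflation of \<open>f\<close> with \<open>\<Psi>\<close>; here
  \<open>\<Psi>\<close> vanishes outside the inertia group.
  The convolution square of \<open>\<Psi>\<close> picks up a factor \<open>|N|/d\<^sub>\<theta>\<close> from each coset of \<open>N\<close>. Hence this map is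
  multiplicative and unital for the convolution \<open>\<Sum>h. f\<^sub>1(gh)f\<^sub>2(h\<^sup>-\<^sup>1)\<close> on the quotient exactly if
  \<open>c = d\<^sub>\<theta>/|N|\<close>, and for that convolution divided by \<open>|I/N|\<close> exactly if \<open>c = d\<^sub>\<theta>/|I|\<close>.\<close>

definition infl_map ::
    "('g, 'm) monoid_scheme \<Rightarrow> 'g set \<Rightarrow> ('g \<Rightarrow> complex) \<Rightarrow> complex \<Rightarrow> ('g set \<Rightarrow> complex) \<Rightarrow> 'g \<Rightarrow> complex" where
  "infl_map G N \<Psi> c f g = c * (infl G N f g * \<Psi> g)"

text \<open>The group algebra with convolution \<open>1/|H| \<Sum>h. f\<^sub>1(gh)f\<^sub>2(h\<^sup>-\<^sup>1)\<close>, whose unit is \<open>|H|\<close> times the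
  point mass at the identity.\<close>

definition normalized_group_algebra :: "('h, 'm) monoid_scheme \<Rightarrow> (complex, 'h \<Rightarrow> complex) module" where
  "normalized_group_algebra H =
     (group_algebra H)
       \<lparr>mult := (\<lambda>f\<^sub>1 f\<^sub>2 x. convolution H f\<^sub>1 f\<^sub>2 x / of_nat (order H)),
        one := (\<lambda>x. if x = \<one>\<^bsub>H\<^esub> then of_nat (order H) else 0)\<rparr>"

end

theory Submission
  imports Defs "HOL-Computational_Algebra.Fundamental_Theorem_Algebra" "HOL-Algebra.Multiplicative_Group"
begin

text \<open>For \<open>h\<close> in the inertia group the operator \<open>(R\<^sub>h f)(g) = \<xi>(h) f(gh)\<close> on \<open>Ind\<^sub>N\<^sup>G \<theta>\<close> commutes with
  \<open>G\<close> and depends only on \<open>hN\<close>. By multiplicity-freeness it maps every irreducible subrepresentation to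
  itself and is scalar there, so the scalars form a character of the quotient and the subrepresentation
  lies in some \<open>Ind(\<xi> \<otimes> \<chi>)\<close>, which is the joint eigenspace for that character. Hence these eigenspaces
  span \<open>Ind\<^sub>N\<^sup>G \<theta>\<close>, and the quotient, acting faithfully by simultaneously diagonal operators, is Abelian;
  no separate theorem on the existence of characters is needed. Everything else is Schur orthogonality
  over \<open>N\<close>: averaging against matrix coefficients of \<open>\<theta>\<close> annihilates whatever is supported on a coset
  \<open>gN\<close> with \<open>g\<close> outside the inertia group, and on the remaining cosets it is computed through \<open>\<xi>\<close>. This
  gives irreducibility of \<open>Ind(\<xi> \<otimes> \<chi>)\<close>, the spherical functions, and the shape of the Hecke algebra.\<close>

section \<open>Linear algebra in finite-dimensional inner product spaces\<close>

text \<open>The constants have a single origin: \<open>dN\<close>, the order of N divided by the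
  dimension of V, which is the factor in Schur orthogonality over N. A map with factor c is
  multiplicative when c * c * \<open>dN\<close> = c, and 1 / \<open>dN\<close> is exactly the factor
  built into \<open>hecke_idem\<close>. Two features of the setting shape the argument. First,
  \<open>multiplicity_free\<close> only forbids orthogonal equivalent copies, whereas the image of a
  subrepresentation under \<open>R h\<close> might a priori be neither equal nor orthogonal to it.
  So the hypothesis is first strengthened: equivalent irreducible subrepresentations coincide as
  subspaces. Second, all induced spaces consist of functions on G with pointwise scaling, so the
  space induced from the inertia group is literally a subset of the one induced from N. The inner
  products differ, one being divided by the order of I and the other by that of N. Equivalence of
  representations does not see this, but the isometry that normalizes a spherical function is
  measured in the inner product of the space induced from I.\<close>

locale fd_space =
  fixes V :: "'v::ab_group_add cips"
  assumes fd: "fd_inner_space V"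
begin

sublocale vs: vector_space "cscale V"
  using fd by (simp add: fd_inner_space_def)

lemma ex_finite_spanning: "\<exists>B. finite B \<and> vecs V = vs.span B"
  using fd by (simp add: fd_inner_space_def)

lemma subspace_vecs: "vs.subspace (vecs V)"
  using ex_finite_spanning vs.subspace_span by metis

lemmas vecs_zero [simp] = vs.subspace_0 [OF subspace_vecs]
lemmas vecs_add = vs.subspace_add [OF subspace_vecs]
lemmas vecs_diff = vs.subspace_diff [OF subspace_vecs]
lemmas vecs_scale = vs.subspace_scale [OF subspace_vecs]
lemmas vecs_sum = vs.subspace_sum [OF subspace_vecs]

lemma inner_add_left:
  "\<lbrakk>x \<in> vecs V; y \<in> vecs V; z \<in> vecs V\<rbrakk> \<Longrightarrow> cinner V (x + y) z = cinner V x z + cinner V y z"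
  using fd unfolding fd_inner_space_def by blast

lemma inner_scale_left:
  "\<lbrakk>x \<in> vecs V; y \<in> vecs V\<rbrakk> \<Longrightarrow> cinner V (cscale V c x) y = c * cinner V x y"
  using fd unfolding fd_inner_space_def by blast

lemma inner_commute: "\<lbrakk>x \<in> vecs V; y \<in> vecs V\<rbrakk> \<Longrightarrow> cinner V y x = cnj (cinner V x y)"
  using fd unfolding fd_inner_space_def by blast

lemma inner_pos: "\<lbrakk>x \<in> vecs V; x \<noteq> 0\<rbrakk> \<Longrightarrow> 0 < Re (cinner V x x)"
  using fd unfolding fd_inner_space_def by blast

lemma inner_add_right:
  "\<lbrakk>x \<in> vecs V; y \<in> vecs V; z \<in> vecs V\<rbrakk> \<Longrightarrow> cinner V z (x + y) = cinner V z x + cinner V z y"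
  using inner_commute[of "x + y" z] inner_commute[of x z] inner_commute[of y z]
  by (simp add: inner_add_left vecs_add)

lemma inner_scale_right:
  "\<lbrakk>x \<in> vecs V; y \<in> vecs V\<rbrakk> \<Longrightarrow> cinner V y (cscale V c x) = cnj c * cinner V y x"
  using inner_commute[of "cscale V c x" y] inner_commute[of x y]
  by (simp add: inner_scale_left vecs_scale)

lemma inner_zero_left [simp]: "y \<in> vecs V \<Longrightarrow> cinner V 0 y = 0"
  using inner_add_left[of 0 0 y] by simp

lemma inner_zero_right [simp]: "y \<in> vecs V \<Longrightarrow> cinner V y 0 = 0"
  using inner_add_right[of 0 0 y] by simp

lemma inner_diff_left:
  "\<lbrakk>x \<in> vecs V; y \<in> vecs V; z \<in> vecs V\<rbrakk> \<Longrightarrow> cinner V (x - y) z = cinner V x z - cinner V y z"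
  using inner_add_left[of "x - y" y z] by (simp add: vecs_diff)

lemma inner_sum_left:
  "\<lbrakk>\<And>i. i \<in> A \<Longrightarrow> f i \<in> vecs V; z \<in> vecs V\<rbrakk> \<Longrightarrow> cinner V (\<Sum>i\<in>A. f i) z = (\<Sum>i\<in>A. cinner V (f i) z)"
  by (induction A rule: infinite_finite_induct) (simp_all add: inner_add_left vecs_sum)

lemma inner_eq_0_iff: "x \<in> vecs V \<Longrightarrow> cinner V x x = 0 \<longleftrightarrow> x = 0"
  using inner_pos[of x] by (cases "x = 0") auto

lemma inner_self_real: "x \<in> vecs V \<Longrightarrow> cinner V x x = of_real (Re (cinner V x x))"
  using inner_commute[of x x] by (metis complex_cnj_cancel_iff Reals_cnj_iff of_real_Re)

lemma finite_subspace_basis: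
  assumes "vs.subspace U" "U \<subseteq> vecs V"
  shows "\<exists>B. finite B \<and> B \<subseteq> U \<and> vs.independent B \<and> U = vs.span B"
proof -
  obtain C where C: "finite C" "vecs V = vs.span C" using ex_finite_spanning by blast
  obtain B where B: "B \<subseteq> U" "vs.independent B" "U \<subseteq> vs.span B"
    using vs.maximal_independent_subset by blast
  have "finite B"
    using vs.independent_span_bound[OF C(1) B(2)] B(1) assms(2) C(2) by blast
  moreover have "vs.span B \<subseteq> U" using vs.span_minimal[OF B(1) assms(1)] .
  ultimately show ?thesis using B by blast
qed

lemma fd_inner_space_subspace:
  assumes "vs.subspace U" "U \<subseteq> vecs V"
  shows "fd_inner_space (V\<lparr>vecs := U\<rparr>)"
proof -
  have "vector_space (cscale V)" by (rule vs.vector_space_axioms)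
  moreover have "\<exists>B. finite B \<and> U = module.span (cscale V) B"
    using finite_subspace_basis[OF assms] by blast
  moreover have "\<And>x. x \<in> U \<Longrightarrow> x \<in> vecs V" using assms by blast
  ultimately show ?thesis
    unfolding fd_inner_space_def
    by (intro conjI ballI allI impI)
      (auto intro: inner_add_left inner_scale_left inner_commute inner_pos simp del: One_nat_def)
qed

section \<open>Orthonormal systems and orthogonal projection\<close>

definition orthonormal :: "'v set \<Rightarrow> bool" where
  "orthonormal E \<longleftrightarrow> (\<forall>x\<in>E. \<forall>y\<in>E. cinner V x y = (if x = y then 1 else 0))"

text \<open>For orthonormal \<open>E\<close> this is the orthogonal projection onto the span of
  \<open>E\<close>.\<close>

definition expand :: "'v set \<Rightarrow> 'v \<Rightarrow> 'v" where
  "expand E x = (\<Sum>e\<in>E. cscale V (cinner V x e) e)"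

lemma expand_in_span: "expand E x \<in> vs.span E"
  unfolding expand_def by (intro vs.span_sum vs.span_scale vs.span_base)

lemma expand_in_vecs: "E \<subseteq> vecs V \<Longrightarrow> expand E x \<in> vecs V"
  unfolding expand_def by (intro vecs_sum vecs_scale) auto

lemma inner_expand:
  assumes "finite E" "E \<subseteq> vecs V" "orthonormal E" "x \<in> vecs V" "y \<in> E"
  shows "cinner V (expand E x) y = cinner V x y"
proof -
  have "cinner V (expand E x) y = (\<Sum>e\<in>E. cinner V x e * cinner V e y)"
    unfolding expand_def using assms
    by (subst inner_sum_left) (auto simp: inner_scale_left vecs_scale subset_iff)
  also have "\<dots> = (\<Sum>e\<in>E. if e = y then cinner V x y else 0)"
    using assms(3,5) by (intro sum.cong) (auto simp: orthonormal_def)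
  finally show ?thesis using assms(1,5) by simp
qed

lemma orthogonal_span:
  assumes "E \<subseteq> vecs V" "z \<in> vecs V" "\<And>e. e \<in> E \<Longrightarrow> cinner V z e = 0" "y \<in> vs.span E"
  shows "cinner V z y = 0"
proof -
  have "y \<in> vecs V \<and> cinner V z y = 0"
    using assms(4)
  proof (induction rule: vs.span_induct_alt)
    case base show ?case using assms(2) by simp
  next
    case (step c x y)
    then show ?case using assms(1,2,3) 
      by (auto simp: inner_add_right inner_scale_right vecs_add vecs_scale subset_iff)
  qed
  then show ?thesis ..
qed

lemma inner_diff_expand:
  assumes "finite E" "E \<subseteq> vecs V" "orthonormal E" "x \<in> vecs V" "y \<in> vs.span E"
  shows "cinner V (x - expand E x) y = 0"
proof (rule orthogonal_span[OF assms(2) _ _ assms(5)])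
  show "x - expand E x \<in> vecs V" using assms by (simp add: vecs_diff expand_in_vecs)
next
  fix e assume "e \<in> E"
  then show "cinner V (x - expand E x) e = 0"
    using assms inner_expand[OF assms(1-4)]
    by (subst inner_diff_left) (auto simp: expand_in_vecs)
qed

lemma gram_schmidt:
  assumes "finite B" "B \<subseteq> vecs V"
  shows "\<exists>E. finite E \<and> E \<subseteq> vecs V \<and> orthonormal E \<and> vs.span E = vs.span B"
  using assms
proof (induction B rule: finite_induct)
  case empty
  show ?case by (rule exI[of _ "{}"]) (auto simp: orthonormal_def)
next
  case (insert b B)
  then obtain E where E: "finite E" "E \<subseteq> vecs V" "orthonormal E" "vs.span E = vs.span B"
    by auto
  have b: "b \<in> vecs V" using insert by simp
  define r where "r = b - expand E b"
  have rV: "r \<in> vecs V" unfolding r_def using b E by (simp add: vecs_diff expand_in_vecs)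
  have span_ins: "vs.span (insert r E) = vs.span (insert b B)"
  proof
    have "r \<in> vs.span (insert b B)"
      unfolding r_def
      using E(4) expand_in_span[of E b] vs.span_mono[of B "insert b B"]
      by (intro vs.span_diff[OF vs.span_base]) auto
    moreover have "E \<subseteq> vs.span (insert b B)"
      using E(4) vs.span_superset[of E] vs.span_mono[of B "insert b B"] by auto
    ultimately show "vs.span (insert r E) \<subseteq> vs.span (insert b B)"
      by (intro vs.span_minimal) auto
    have "r + expand E b \<in> vs.span (insert r E)"
      using expand_in_span[of E b] vs.span_mono[of E "insert r E"]
      by (intro vs.span_add[OF vs.span_base]) auto
    then have "b \<in> vs.span (insert r E)" by (simp add: r_def)
    moreover have "B \<subseteq> vs.span (insert r E)"
      using E(4) vs.span_superset[of B] vs.span_mono[of E "insert r E"] by auto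
    ultimately show "vs.span (insert b B) \<subseteq> vs.span (insert r E)"
      by (intro vs.span_minimal) auto
  qed
  show ?case
  \<comment> \<open>\<open>B\<close> need not be independent: if \<open>b\<close> already lies in
    the span of \<open>E\<close>, the remainder vanishes and \<open>E\<close> is kept.\<close>
  proof (cases "r = 0")
    case True
    then show ?thesis using E span_ins by (intro exI[of _ E]) simp
  next
    case False
    define n where "n = sqrt (Re (cinner V r r))"
    define u where "u = cscale V (1 / of_real n) r"
    have n: "n > 0" "n * n = Re (cinner V r r)"
      using inner_pos[OF rV False] by (auto simp: n_def)
    have uV: "u \<in> vecs V" unfolding u_def by (rule vecs_scale[OF rV])
    have uu: "cinner V u u = 1"
    proof -
      have "cinner V u u = 1 / of_real n * (1 / of_real n * cinner V r r)"
        by (simp add: u_def inner_scale_left inner_scale_right rV vecs_scale)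
      also have "cinner V r r = of_real (n * n)" using inner_self_real[OF rV] n(2) by metis
      finally show ?thesis using n(1) by simp
    qed
    have ue: "cinner V u e = 0" if "e \<in> E" for e
    proof -
      have "cinner V r e = 0"
        unfolding r_def by (rule inner_diff_expand[OF E(1-3) b vs.span_base[OF that]])
      then show ?thesis using that E rV by (auto simp: u_def inner_scale_left)
    qed
    have eu: "cinner V e u = 0" if "e \<in> E" for e
      using inner_commute[of u e] ue[OF that] that E(2) uV by auto
    have "orthonormal (insert u E)"
      using E(3) uu ue eu unfolding orthonormal_def by force
    moreover have "vs.span (insert u E) = vs.span (insert r E)"
    proof
      have "u \<in> vs.span (insert r E)"
        unfolding u_def by (intro vs.span_scale vs.span_base) simp
      then show "vs.span (insert u E) \<subseteq> vs.span (insert r E)"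
        using vs.span_superset[of "insert r E"] by (intro vs.span_minimal) auto
      have "cscale V (of_real n) u \<in> vs.span (insert u E)"
        by (intro vs.span_scale vs.span_base) simp
      moreover have "cscale V (of_real n) u = r" using n by (simp add: u_def)
      ultimately show "vs.span (insert r E) \<subseteq> vs.span (insert u E)"
        using vs.span_superset[of "insert u E"] by (intro vs.span_minimal) auto
    qed
    ultimately show ?thesis using E uV span_ins
      by (intro exI[of _ "insert u E"]) auto
  qed
qed

lemma orthonormal_independent:
  assumes "finite E" "E \<subseteq> vecs V" "orthonormal E"
  shows "vs.independent E"
proof (rule vs.independent_if_scalars_zero[OF assms(1)])
  fix f x assume s: "(\<Sum>y\<in>E. cscale V (f y) y) = 0" and x: "x \<in> E"
  have "0 = cinner V (\<Sum>y\<in>E. cscale V (f y) y) x" using s x assms by auto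
  also have "\<dots> = (\<Sum>y\<in>E. f y * cinner V y x)" using x assms
    by (subst inner_sum_left) (auto simp: inner_scale_left vecs_scale subset_iff)
  also have "\<dots> = (\<Sum>y\<in>E. if y = x then f x else 0)"
    using assms(3) x by (intro sum.cong) (auto simp: orthonormal_def)
  finally show "f x = 0" using x assms(1) by simp
qed

lemma ex_orthonormal_basis:
  "\<exists>E. finite E \<and> E \<subseteq> vecs V \<and> orthonormal E \<and> vs.span E = vecs V \<and> card E = cdim V"
proof -
  obtain B where B: "finite B" "vecs V = vs.span B" using ex_finite_spanning by blast
  then have "B \<subseteq> vecs V" using vs.span_superset by auto
  then obtain E where E: "finite E" "E \<subseteq> vecs V" "orthonormal E" "vs.span E = vecs V"
    using gram_schmidt[OF B(1)] B(2) by auto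
  have "vs.dim (vecs V) = card E"
    using vs.dim_eq_card[of E "vecs V"] orthonormal_independent[OF E(1-3)] E(4)
      vs.span_eq_iff[of "vecs V"] subspace_vecs by metis
  then show ?thesis using E unfolding cdim_def by auto
qed

lemma orthogonal_projection:
  assumes "vs.subspace U" "U \<subseteq> vecs V" "x \<in> vecs V"
  shows "\<exists>u\<in>U. \<forall>y\<in>U. cinner V (x - u) y = 0"
proof -
  obtain B where B: "finite B" "B \<subseteq> U" "U = vs.span B"
    using finite_subspace_basis[OF assms(1,2)] by blast
  then obtain E where E: "finite E" "E \<subseteq> vecs V" "orthonormal E" "vs.span E = U"
    using gram_schmidt[of B] assms(2) by auto
  then show ?thesis
    using expand_in_span[of E x] inner_diff_expand[OF E(1-3) assms(3)] by auto
qed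

lemma expand_orthonormal_basis:
  assumes "finite E" "E \<subseteq> vecs V" "orthonormal E" "vs.span E = vecs V" "x \<in> vecs V"
  shows "expand E x = x"
proof -
  have "x - expand E x \<in> vecs V" using assms by (simp add: vecs_diff expand_in_vecs)
  then have "cinner V (x - expand E x) (x - expand E x) = 0"
    using inner_diff_expand[OF assms(1-3,5)] assms(4) by auto
  then show ?thesis using inner_eq_0_iff[OF \<open>x - expand E x \<in> vecs V\<close>] by simp
qed

lemma parseval:
  assumes "finite E" "E \<subseteq> vecs V" "orthonormal E" "vs.span E = vecs V" "x \<in> vecs V" "y \<in> vecs V"
  shows "cinner V x y = (\<Sum>e\<in>E. cinner V x e * cinner V e y)"
proof -
  have "cinner V x y = cinner V (expand E x) y"
    using expand_orthonormal_basis[OF assms(1-5)] by simp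
  also have "\<dots> = (\<Sum>e\<in>E. cinner V x e * cinner V e y)"
    unfolding expand_def using assms
    by (subst inner_sum_left) (auto simp: inner_scale_left vecs_scale subset_iff)
  finally show ?thesis .
qed

end

section \<open>Linear maps and eigenvectors\<close>

lemma linear_map_zero:
  assumes "fd_inner_space V" "fd_inner_space W" "linear_map V W T"
  shows "T 0 = 0"
proof -
  interpret V: fd_space V using assms by unfold_locales
  have "T (0 + 0) = T 0 + T 0" using assms(3) V.vecs_zero unfolding linear_map_def by blast
  then show ?thesis by simp
qed

lemma linear_map_sum:
  assumes "fd_inner_space V" "fd_inner_space W" "linear_map V W T" "\<And>i. i \<in> A \<Longrightarrow> f i \<in> vecs V"
  shows "T (\<Sum>i\<in>A. f i) = (\<Sum>i\<in>A. T (f i))"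
proof -
  interpret V: fd_space V using assms by unfold_locales
  show ?thesis using assms(4)
  proof (induction A rule: infinite_finite_induct)
    case (insert x F)
    then have "f x \<in> vecs V" "(\<Sum>i\<in>F. f i) \<in> vecs V" by (auto intro: V.vecs_sum)
    then have "T (f x + (\<Sum>i\<in>F. f i)) = T (f x) + T (\<Sum>i\<in>F. f i)"
      using assms(3) unfolding linear_map_def by blast
    then show ?case using insert by simp
  qed (simp_all add: linear_map_zero[OF assms(1-3)])
qed

lemma linear_map_diff:
  assumes "fd_inner_space V" "linear_map V W T" "x \<in> vecs V" "y \<in> vecs V"
  shows "T (x - y) = T x - T y"
proof -
  interpret V: fd_space V using assms by unfold_locales
  have "T ((x - y) + y) = T (x - y) + T y"
    using assms(2-) V.vecs_diff unfolding linear_map_def by blast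
  then show ?thesis by simp
qed

lemma linear_map_compose:
  "linear_map U V S \<Longrightarrow> linear_map V W T \<Longrightarrow> linear_map U W (\<lambda>x. T (S x))"
  unfolding linear_map_def by (auto simp: Pi_iff)

text \<open>The iterates of T at a nonzero vector cannot all be independent, so some nonzero
  polynomial in T annihilates that vector. Take one of least degree and split off a linear factor by
  the fundamental theorem of algebra: the cofactor applied to the vector is nonzero by minimality,
  and it is an eigenvector for the root.\<close>

lemma (in fd_space) eigenvector_exists:
  assumes T: "linear_map V V T" and ne: "vecs V \<noteq> {0}"
  shows "\<exists>c x. x \<in> vecs V \<and> x \<noteq> 0 \<and> T x = cscale V c x"
proof -
  have "0 \<in> vecs V" by simp
  then obtain x0 where x0: "x0 \<in> vecs V" "x0 \<noteq> 0" using ne by blast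
  have T0: "T 0 = 0" by (rule linear_map_zero[OF fd fd T])
  have TV: "\<And>x. x \<in> vecs V \<Longrightarrow> T x \<in> vecs V"
    and Tadd: "\<And>x y. x \<in> vecs V \<Longrightarrow> y \<in> vecs V \<Longrightarrow> T (x + y) = T x + T y"
    and Tsc: "\<And>c x. x \<in> vecs V \<Longrightarrow> T (cscale V c x) = cscale V c (T x)"
    using T unfolding linear_map_def by auto
  \<comment> \<open>\<open>act p\<close> is \<open>p(T) x0\<close>\<close>
  define act where "act p = fold_coeffs (\<lambda>a y. cscale V a x0 + T y) p 0" for p :: "complex poly"
  have act_0: "act 0 = 0" by (simp add: act_def)
  have act_pCons: "act (pCons a p) = cscale V a x0 + T (act p)" for a p
    by (cases "a = 0 \<and> p = 0") (auto simp: act_def T0)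
  have act_V: "act p \<in> vecs V" for p
    by (induction p) (auto simp: act_0 act_pCons x0 intro!: vecs_add vecs_scale TV)
  have act_add: "act (p + q) = act p + act q" for p q
    by (induction p q rule: poly_induct2)
      (auto simp: act_0 act_pCons vs.scale_left_distrib Tadd act_V algebra_simps)
  have act_smult: "act (smult c p) = cscale V c (act p)" for c p
    by (induction p) (auto simp: act_0 act_pCons vs.scale_right_distrib Tsc act_V)
  have act_sum: "act (\<Sum>i\<in>A. p i) = (\<Sum>i\<in>A. act (p i))" for p and A :: "'z set"
    by (induction A rule: infinite_finite_induct) (auto simp: act_0 act_add)
  have itV: "(T ^^ i) x0 \<in> vecs V" for i by (induction i) (auto simp: x0 TV)
  have act_monom: "act (Polynomial.monom c i) = cscale V c ((T ^^ i) x0)" for c i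
  proof (induction i)
    case 0 then show ?case by (simp add: monom_0 act_pCons act_0 T0)
  next
    case (Suc i)
    show ?case using Suc itV[of i] by (simp add: monom_Suc act_pCons Tsc)
  qed
  have ex: "\<exists>p. p \<noteq> 0 \<and> act p = 0"
  proof -
    obtain B where B: "finite B" "vecs V = vs.span B" using ex_finite_spanning by blast
    define h where "h i = (T ^^ i) x0" for i
    show ?thesis
    \<comment> \<open>Dependence is a property of sets, so repeated iterates must be treated apart.
      If the \<open>card B + 1\<close> iterates are distinct, they outnumber a spanning set; if two
      coincide, the difference of the two monomials annihilates \<open>x0\<close>.\<close>
    proof (cases "inj_on h {..card B}")
      case True
      define S where "S = h ` {..card B}"
      have cS: "card S = Suc (card B)" unfolding S_def using True by (simp add: card_image)
      have "vs.dependent S"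
        using vs.independent_span_bound[OF B(1), of S] cS itV B(2) by (auto simp: S_def h_def)
      then obtain u y where u: "y \<in> S" "u y \<noteq> 0" "(\<Sum>x\<in>S. cscale V (u x) x) = 0"
        using vs.dependent_finite[of S] by (auto simp: S_def)
      define p where "p = (\<Sum>i\<in>{..card B}. Polynomial.monom (u (h i)) i)"
      obtain j where j: "j \<le> card B" "y = h j" using u(1) by (auto simp: S_def)
      have "Polynomial.coeff p j = u y" using j by (simp add: p_def Polynomial.coeff_sum)
      then have "p \<noteq> 0" using u(2) by auto
      moreover have "act p = (\<Sum>i\<in>{..card B}. cscale V (u (h i)) (h i))"
        by (simp add: p_def act_sum act_monom h_def)
      then have "act p = 0" using u(3) sum.reindex[OF True, of "\<lambda>x. cscale V (u x) x"] by (simp add: S_def)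
      ultimately show ?thesis by blast
    next
      case False
      then obtain i j where ij: "h i = h j" "i \<noteq> j" unfolding inj_on_def by blast
      define p :: "complex poly" where "p = Polynomial.monom 1 i + Polynomial.monom (-1) j"
      have "Polynomial.coeff p i = 1" using ij by (simp add: p_def)
      then have "p \<noteq> 0" by auto
      moreover have "act p = 0" using ij by (simp add: p_def act_add act_monom h_def)
      ultimately show ?thesis by blast
    qed
  qed
  define P where "P k \<longleftrightarrow> (\<exists>p. p \<noteq> 0 \<and> act p = 0 \<and> degree p = k)" for k
  have "\<exists>k. P k" using ex by (auto simp: P_def)
  then have "P (LEAST k. P k)" by (meson LeastI)
  then obtain p where p: "p \<noteq> 0" "act p = 0" "degree p = (LEAST k. P k)" by (auto simp: P_def)
  have "degree p \<noteq> 0"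
  proof
    assume "degree p = 0"
    then obtain c where "p = [:c:]" by (rule degree_eq_zeroE)
    then show False using p x0 by (simp add: act_pCons act_0 T0)
  qed
  then have "\<not> constant (poly p)" by (simp add: constant_degree)
  then obtain z where "poly p z = 0" using fundamental_theorem_of_algebra by blast
  then obtain q where q: "p = [:-z, 1:] * q" by (auto simp: poly_eq_0_iff_dvd dvd_def)
  then have q0: "q \<noteq> 0" using p by auto
  have "degree p = Suc (degree q)" unfolding q using q0 by (subst degree_mult_eq) auto
  then have "act q \<noteq> 0" using not_less_Least[of "degree q" P] q0 p by (auto simp: P_def)
  moreover have "p = smult (-z) q + pCons 0 q" by (simp add: q)
  then have "act p = cscale V (-z) (act q) + T (act q)"
    by (simp only: act_add act_smult act_pCons) simp
  then have "T (act q) = cscale V z (act q)" using p by (simp add: add_eq_0_iff2)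
  ultimately show ?thesis using act_V by blast
qed

section \<open>Unitary representations and Schur's lemma\<close>

lemma unitary_repD:
  assumes "unitary_rep G V \<rho>"
  shows "fd_inner_space V"
    and "g \<in> carrier G \<Longrightarrow> linear_map V V (\<rho> g)"
    and "\<lbrakk>g \<in> carrier G; x \<in> vecs V\<rbrakk> \<Longrightarrow> \<rho> g x \<in> vecs V"
    and "\<lbrakk>g \<in> carrier G; x \<in> vecs V; y \<in> vecs V\<rbrakk> \<Longrightarrow> \<rho> g (x + y) = \<rho> g x + \<rho> g y"
    and "\<lbrakk>g \<in> carrier G; x \<in> vecs V\<rbrakk> \<Longrightarrow> \<rho> g (cscale V c x) = cscale V c (\<rho> g x)"
    and "\<lbrakk>g \<in> carrier G; x \<in> vecs V; y \<in> vecs V\<rbrakk> \<Longrightarrow> cinner V (\<rho> g x) (\<rho> g y) = cinner V x y"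
    and "x \<in> vecs V \<Longrightarrow> \<rho> \<one>\<^bsub>G\<^esub> x = x"
    and "\<lbrakk>g \<in> carrier G; h \<in> carrier G; x \<in> vecs V\<rbrakk> \<Longrightarrow> \<rho> (g \<otimes>\<^bsub>G\<^esub> h) x = \<rho> g (\<rho> h x)"
  using assms unfolding unitary_rep_def linear_map_def isometric_on_def by auto

lemma unitary_rep_inv_cancel:
  assumes "group G" "unitary_rep G V \<rho>" "g \<in> carrier G" "x \<in> vecs V"
  shows "\<rho> g (\<rho> (inv\<^bsub>G\<^esub> g) x) = x" and "\<rho> (inv\<^bsub>G\<^esub> g) (\<rho> g x) = x"
proof -
  interpret group G by fact
  show "\<rho> g (\<rho> (inv\<^bsub>G\<^esub> g) x) = x" "\<rho> (inv\<^bsub>G\<^esub> g) (\<rho> g x) = x"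
    using unitary_repD(7)[OF assms(2,4)] unitary_repD(8)[OF assms(2) _ _ assms(4)] assms(3)
    by (metis inv_closed r_inv, metis inv_closed l_inv)
qed

lemma unitary_rep_adjoint:
  assumes "group G" "unitary_rep G V \<rho>" "g \<in> carrier G" "x \<in> vecs V" "y \<in> vecs V"
  shows "cinner V (\<rho> g x) y = cinner V x (\<rho> (inv\<^bsub>G\<^esub> g) y)"
    and "cinner V x (\<rho> g y) = cinner V (\<rho> (inv\<^bsub>G\<^esub> g) x) y"
proof -
  interpret group G by fact
  note u = unitary_repD[OF assms(2)]
  have "cinner V (\<rho> g x) (\<rho> g (\<rho> (inv\<^bsub>G\<^esub> g) y)) = cinner V x (\<rho> (inv\<^bsub>G\<^esub> g) y)"
    using assms by (intro u(6)) (auto intro: u(3))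
  then show "cinner V (\<rho> g x) y = cinner V x (\<rho> (inv\<^bsub>G\<^esub> g) y)"
    using unitary_rep_inv_cancel[OF assms(1-3)] assms(5) by simp
  have "cinner V (\<rho> g (\<rho> (inv\<^bsub>G\<^esub> g) x)) (\<rho> g y) = cinner V (\<rho> (inv\<^bsub>G\<^esub> g) x) y"
    using assms by (intro u(6)) (auto intro: u(3))
  then show "cinner V x (\<rho> g y) = cinner V (\<rho> (inv\<^bsub>G\<^esub> g) x) y"
    using unitary_rep_inv_cancel[OF assms(1-3)] assms(4) by simp
qed

lemma invariant_subspaceD:
  assumes "invariant_subspace G V \<rho> U"
  shows "module.subspace (cscale V) U" "U \<subseteq> vecs V" "\<lbrakk>g \<in> carrier G; x \<in> U\<rbrakk> \<Longrightarrow> \<rho> g x \<in> U"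
  using assms unfolding invariant_subspace_def by auto

lemma unitary_rep_subspace:
  assumes "unitary_rep G V \<rho>" "invariant_subspace G V \<rho> U"
  shows "unitary_rep G (V\<lparr>vecs := U\<rparr>) \<rho>"
proof -
  interpret fd_space V using unitary_repD(1)[OF assms(1)] by unfold_locales
  note U = invariant_subspaceD[OF assms(2)]
  show ?thesis
    using fd_inner_space_subspace[OF U(1,2)] assms U
    unfolding unitary_rep_def linear_map_def isometric_on_def
    by (auto simp: subset_iff Pi_iff)
qed

lemma invariant_subspace_restrict:
  "U \<subseteq> U' \<Longrightarrow> U' \<subseteq> vecs V \<Longrightarrow>
    invariant_subspace G (V\<lparr>vecs := U'\<rparr>) \<rho> U \<longleftrightarrow> invariant_subspace G V \<rho> U"
  unfolding invariant_subspace_def by auto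

lemma intertwinerD:
  assumes "intertwiner G V \<rho> W \<sigma> T"
  shows "linear_map V W T"
    and "x \<in> vecs V \<Longrightarrow> T x \<in> vecs W"
    and "\<lbrakk>x \<in> vecs V; y \<in> vecs V\<rbrakk> \<Longrightarrow> T (x + y) = T x + T y"
    and "x \<in> vecs V \<Longrightarrow> T (cscale V c x) = cscale W c (T x)"
    and "\<lbrakk>g \<in> carrier G; x \<in> vecs V\<rbrakk> \<Longrightarrow> T (\<rho> g x) = \<sigma> g (T x)"
  using assms unfolding intertwiner_def linear_map_def by auto

lemma intertwiner_compose:
  assumes "intertwiner G U \<pi> V \<rho> S" "intertwiner G V \<rho> W \<sigma> T"
  shows "intertwiner G U \<pi> W \<sigma> (\<lambda>x. T (S x))"
  unfolding intertwiner_def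
  using linear_map_compose[OF intertwinerD(1)[OF assms(1)] intertwinerD(1)[OF assms(2)]]
    intertwinerD(5)[OF assms(1)] intertwinerD(5)[OF assms(2)] intertwinerD(2)[OF assms(1)]
  by simp

lemma intertwiner_restrict:
  assumes "intertwiner G V \<rho> W \<sigma> T" "U \<subseteq> vecs V" "T ` U \<subseteq> U'"
  shows "intertwiner G (V\<lparr>vecs := U\<rparr>) \<rho> (W\<lparr>vecs := U'\<rparr>) \<sigma> T"
  using assms unfolding intertwiner_def linear_map_def by (auto simp: subset_iff Pi_iff)

lemma intertwiner_restrict_domain:
  assumes "intertwiner G V \<rho> W \<sigma> T" "U \<subseteq> vecs V"
  shows "intertwiner G (V\<lparr>vecs := U\<rparr>) \<rho> W \<sigma> T"
  using assms unfolding intertwiner_def linear_map_def by (auto simp: subset_iff Pi_iff)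

lemma equiv_rep_trans:
  assumes "equiv_rep G U \<pi> V \<rho>" "equiv_rep G V \<rho> W \<sigma>"
  shows "equiv_rep G U \<pi> W \<sigma>"
proof -
  obtain S T where "intertwiner G U \<pi> V \<rho> S" "bij_betw S (vecs U) (vecs V)"
    "intertwiner G V \<rho> W \<sigma> T" "bij_betw T (vecs V) (vecs W)"
    using assms unfolding equiv_rep_def by blast
  then show ?thesis
    using intertwiner_compose bij_betw_trans unfolding equiv_rep_def comp_def by blast
qed

lemma equiv_rep_sym:
  assumes "unitary_rep G V \<rho>" "equiv_rep G V \<rho> W \<sigma>"
  shows "equiv_rep G W \<sigma> V \<rho>"
proof -
  obtain T where T: "intertwiner G V \<rho> W \<sigma> T" "bij_betw T (vecs V) (vecs W)"
    using assms unfolding equiv_rep_def by blast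
  interpret fd_space V using unitary_repD(1)[OF assms(1)] by unfold_locales
  define S where "S = inv_into (vecs V) T"
  have SV: "S y \<in> vecs V" and TS: "T (S y) = y" if "y \<in> vecs W" for y
    using T(2) that unfolding S_def
    by (auto simp: bij_betw_def inv_into_into f_inv_into_f)
  have ST: "S (T x) = x" if "x \<in> vecs V" for x
    using T(2) that unfolding S_def by (simp add: bij_betw_inv_into_left)
  have "S (x + y) = S x + S y" if "x \<in> vecs W" "y \<in> vecs W" for x y
    using ST[of "S x + S y"] intertwinerD(3)[OF T(1), of "S x" "S y"] that
    by (simp add: SV TS vecs_add)
  moreover have "S (cscale W c x) = cscale V c (S x)" if "x \<in> vecs W" for c x
    using ST[of "cscale V c (S x)"] intertwinerD(4)[OF T(1), of "S x"] that
    by (simp add: SV TS vecs_scale)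
  moreover have "S (\<sigma> g x) = \<rho> g (S x)" if "g \<in> carrier G" "x \<in> vecs W" for g x
    using ST[of "\<rho> g (S x)"] intertwinerD(5)[OF T(1), of g "S x"] that
    by (simp add: SV TS unitary_repD(3)[OF assms(1)])
  ultimately have "intertwiner G W \<sigma> V \<rho> S"
    unfolding intertwiner_def linear_map_def using SV by auto
  moreover have "bij_betw S (vecs W) (vecs V)"
    unfolding S_def using T(2) by (rule bij_betw_inv_into)
  ultimately show ?thesis unfolding equiv_rep_def by blast
qed

lemma kernel_invariant:
  assumes "unitary_rep G V \<rho>" "unitary_rep G W \<sigma>" "intertwiner G V \<rho> W \<sigma> T"
  shows "invariant_subspace G V \<rho> {x \<in> vecs V. T x = 0}"
proof -
  interpret V: fd_space V using unitary_repD(1)[OF assms(1)] by unfold_locales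
  interpret W: fd_space W using unitary_repD(1)[OF assms(2)] by unfold_locales
  have 0: "\<sigma> g 0 = 0" if "g \<in> carrier G" for g
    using linear_map_zero[OF W.fd W.fd unitary_repD(2)[OF assms(2) that]] .
  have T0: "T 0 = 0" using linear_map_zero[OF V.fd W.fd intertwinerD(1)[OF assms(3)]] .
  show ?thesis
    unfolding invariant_subspace_def
    by (auto intro!: V.vs.subspaceI simp: T0 0 V.vecs_add V.vecs_scale intertwinerD[OF assms(3)] unitary_repD(3)[OF assms(1)])
qed

lemma image_invariant:
  assumes "unitary_rep G V \<rho>" "unitary_rep G W \<sigma>" "intertwiner G V \<rho> W \<sigma> T"
  shows "invariant_subspace G W \<sigma> (T ` vecs V)"
proof -
  interpret V: fd_space V using unitary_repD(1)[OF assms(1)] by unfold_locales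
  interpret W: fd_space W using unitary_repD(1)[OF assms(2)] by unfold_locales
  have T0: "T 0 = 0" using linear_map_zero[OF V.fd W.fd intertwinerD(1)[OF assms(3)]] .
  note T = intertwinerD[OF assms(3)]
  have "W.vs.subspace (T ` vecs V)"
  proof (rule W.vs.subspaceI)
    show "0 \<in> T ` vecs V" using T0 V.vecs_zero by force
    show "x + y \<in> T ` vecs V" if "x \<in> T ` vecs V" "y \<in> T ` vecs V" for x y
      using that V.vecs_add T(3) by (auto simp: image_iff) metis
    show "cscale W c x \<in> T ` vecs V" if "x \<in> T ` vecs V" for c x
      using that V.vecs_scale T(4) by (auto simp: image_iff) metis
  qed
  moreover have "\<sigma> g x \<in> T ` vecs V" if "g \<in> carrier G" "x \<in> T ` vecs V" for g x
    using that unitary_repD(3)[OF assms(1)] T(5) by (auto simp: image_iff) metis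
  ultimately show ?thesis unfolding invariant_subspace_def using T(2) by auto
qed

lemma irreducible_repD:
  assumes "irreducible_rep G V \<rho>"
  shows "unitary_rep G V \<rho>" "vecs V \<noteq> {0}"
    "invariant_subspace G V \<rho> U \<Longrightarrow> U = {0} \<or> U = vecs V"
  using assms unfolding irreducible_rep_def by auto

text \<open>The kernel is a proper invariant subspace, hence zero. The target may be reducible, so
  this half of Schur's lemma applies to maps from a subrepresentation into the whole ambient
  space.\<close>

lemma irreducible_inj_on:
  assumes "irreducible_rep G V \<rho>" "unitary_rep G W \<sigma>" "intertwiner G V \<rho> W \<sigma> T"
    and "x \<in> vecs V" "T x \<noteq> 0"
  shows "inj_on T (vecs V)"
proof -
  interpret V: fd_space V using unitary_repD(1)[OF irreducible_repD(1)[OF assms(1)]] by unfold_locales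
  have "{x \<in> vecs V. T x = 0} \<noteq> vecs V" using assms by blast
  then have ker: "{x \<in> vecs V. T x = 0} = {0}"
    using irreducible_repD(3)[OF assms(1) kernel_invariant[OF irreducible_repD(1)[OF assms(1)] assms(2,3)]]
    by blast
  show ?thesis
  proof (rule inj_onI)
    fix y z assume yz: "y \<in> vecs V" "z \<in> vecs V" "T y = T z"
    then have "T (y - z) = 0"
      using linear_map_diff[OF V.fd intertwinerD(1)[OF assms(3)]] by simp
    then have "y - z = 0" using ker V.vecs_diff yz by blast
    then show "y = z" by simp
  qed
qed

lemma schur_bij:
  assumes "irreducible_rep G V \<rho>" "irreducible_rep G W \<sigma>" "intertwiner G V \<rho> W \<sigma> T"
    and "x \<in> vecs V" "T x \<noteq> 0"
  shows "bij_betw T (vecs V) (vecs W)"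
proof -
  have "T ` vecs V \<noteq> {0}" using assms by blast
  then have "T ` vecs V = vecs W"
    using irreducible_repD(3)[OF assms(2) image_invariant[OF irreducible_repD(1)[OF assms(1)]
          irreducible_repD(1)[OF assms(2)] assms(3)]] by blast
  then show ?thesis
    using irreducible_inj_on[OF assms(1) irreducible_repD(1)[OF assms(2)] assms(3-)]
    by (simp add: bij_betw_def)
qed

lemma schur_equiv:
  assumes "irreducible_rep G V \<rho>" "irreducible_rep G W \<sigma>" "intertwiner G V \<rho> W \<sigma> T"
    and "x \<in> vecs V" "T x \<noteq> 0"
  shows "equiv_rep G V \<rho> W \<sigma>"
  using schur_bij[OF assms] assms(3) unfolding equiv_rep_def by blast

text \<open>An eigenspace of \<open>T\<close> is invariant and nonzero, hence the whole
  space.\<close>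

lemma schur_scalar:
  assumes "irreducible_rep G V \<rho>" "intertwiner G V \<rho> V \<rho> T"
  shows "\<exists>c. \<forall>x\<in>vecs V. T x = cscale V c x"
proof -
  have u: "unitary_rep G V \<rho>" using assms(1) by (rule irreducible_repD)
  interpret fd_space V using unitary_repD(1)[OF u] by unfold_locales
  obtain c x where cx: "x \<in> vecs V" "x \<noteq> 0" "T x = cscale V c x"
    using eigenvector_exists[OF intertwinerD(1)[OF assms(2)] irreducible_repD(2)[OF assms(1)]]
    by blast
  have T0: "T 0 = 0" using linear_map_zero[OF fd fd intertwinerD(1)[OF assms(2)]] .
  have "invariant_subspace G V \<rho> {x \<in> vecs V. T x = cscale V c x}"
    unfolding invariant_subspace_def
    by (auto intro!: vs.subspaceI simp: T0 vecs_add vecs_scale intertwinerD[OF assms(2)]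
        unitary_repD[OF u] vs.scale_right_distrib mult.commute)
  then have "{x \<in> vecs V. T x = cscale V c x} = vecs V"
    using irreducible_repD(3)[OF assms(1)] cx by blast
  then show ?thesis by blast
qed

lemma irreducible_rep_equiv:
  assumes "irreducible_rep G V \<rho>" "unitary_rep G W \<sigma>" "equiv_rep G V \<rho> W \<sigma>"
  shows "irreducible_rep G W \<sigma>"
proof -
  have u: "unitary_rep G V \<rho>" using assms(1) by (rule irreducible_repD)
  obtain S where S: "intertwiner G W \<sigma> V \<rho> S" "bij_betw S (vecs W) (vecs V)"
    using equiv_rep_sym[OF u assms(3)] unfolding equiv_rep_def by blast
  interpret V: fd_space V using unitary_repD(1)[OF u] by unfold_locales
  interpret W: fd_space W using unitary_repD(1)[OF assms(2)] by unfold_locales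
  have S0: "S 0 = 0" using linear_map_zero[OF W.fd V.fd intertwinerD(1)[OF S(1)]] .
  have "vecs W \<noteq> {0}"
  proof
    assume "vecs W = {0}"
    then have "vecs V = {0}" using S(2) S0 by (simp add: bij_betw_def)
    then show False using irreducible_repD(2)[OF assms(1)] by blast
  qed
  moreover have "U = {0} \<or> U = vecs W" if U: "invariant_subspace G W \<sigma> U" for U
  proof -
    note UU = invariant_subspaceD[OF U]
    have "intertwiner G (W\<lparr>vecs := U\<rparr>) \<sigma> V \<rho> S"
      by (rule intertwiner_restrict_domain[OF S(1) UU(2)])
    then have "invariant_subspace G V \<rho> (S ` U)"
      using image_invariant[OF unitary_rep_subspace[OF assms(2) U] u] by fastforce
    then have "S ` U = {0} \<or> S ` U = vecs V" using irreducible_repD(3)[OF assms(1)] by blast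
    then show ?thesis
    proof
      assume *: "S ` U = {0}"
      have "x = 0" if "x \<in> U" for x
      proof -
        have "S x = S 0" using * that S0 by auto
        then show ?thesis
          using S(2) that UU(2) W.vecs_zero by (auto simp: bij_betw_def inj_on_def)
      qed
      then show ?thesis using W.vs.subspace_0[OF UU(1)] by auto
    next
      assume "S ` U = vecs V"
      then have "S ` U = S ` vecs W" using S(2) by (simp add: bij_betw_def)
      then show ?thesis using S(2) UU(2) by (metis bij_betw_def inj_on_image_eq_iff subset_refl)
    qed
  qed
  ultimately show ?thesis using assms(2) unfolding irreducible_rep_def by blast
qed

section \<open>Orthogonal complements, irreducible subrepresentations and equivariant
  projections\<close>

lemma orthogonal_complement_invariant:
  assumes "group G" "unitary_rep G V \<rho>" "invariant_subspace G V \<rho> U"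
  shows "invariant_subspace G V \<rho> {x \<in> vecs V. \<forall>y\<in>U. cinner V x y = 0}"
proof -
  interpret group G by fact
  interpret fd_space V using unitary_repD(1)[OF assms(2)] by unfold_locales
  note U = invariant_subspaceD[OF assms(3)]
  have "cinner V (\<rho> g x) y = 0"
    if "g \<in> carrier G" "x \<in> vecs V" "\<forall>y\<in>U. cinner V x y = 0" "y \<in> U" for g x y
  proof -
    have "cinner V (\<rho> g x) y = cinner V x (\<rho> (inv\<^bsub>G\<^esub> g) y)"
      using that U by (intro unitary_rep_adjoint[OF assms(1,2)]) auto
    then show ?thesis using that U(3) by simp
  qed
  then show ?thesis
    unfolding invariant_subspace_def using U(2)
    by (auto intro!: vs.subspaceI simp: subset_iff inner_add_left inner_scale_left vecs_add vecs_scale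
        unitary_repD(3)[OF assms(2)])
qed

lemma orthogonal_complement_nontrivial:
  assumes "fd_inner_space V" "module.subspace (cscale V) U" "U \<subseteq> vecs V" "U \<noteq> vecs V"
  shows "{x \<in> vecs V. \<forall>y\<in>U. cinner V x y = 0} \<noteq> {0}"
proof -
  interpret fd_space V using assms by unfold_locales
  obtain x where x: "x \<in> vecs V" "x \<notin> U" using assms by blast
  obtain u where u: "u \<in> U" "\<forall>y\<in>U. cinner V (x - u) y = 0"
    using orthogonal_projection[OF assms(2,3) x(1)] by blast
  have "x - u \<in> vecs V" using x u assms(3) vecs_diff by blast
  moreover have "x - u \<noteq> 0" using x u by auto
  ultimately show ?thesis using u by blast
qed

lemma irreducible_subrep_exists:
  assumes "unitary_rep G V \<rho>" "invariant_subspace G V \<rho> U" "U \<noteq> {0}"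
  shows "\<exists>U'\<subseteq>U. invariant_subspace G V \<rho> U' \<and> irreducible_rep G (V\<lparr>vecs := U'\<rparr>) \<rho>"
  using assms(2,3)
proof (induction "vector_space.dim (cscale V) U" arbitrary: U rule: less_induct)
  case less
  interpret fd_space V using unitary_repD(1)[OF assms(1)] by unfold_locales
  note U = invariant_subspaceD[OF less.prems(1)]
  show ?case
  proof (cases "irreducible_rep G (V\<lparr>vecs := U\<rparr>) \<rho>")
    case True
    then show ?thesis using less.prems by blast
  next
    case False
    then obtain U' where U': "invariant_subspace G (V\<lparr>vecs := U\<rparr>) \<rho> U'" "U' \<noteq> {0}" "U' \<noteq> U"
      using less.prems unitary_rep_subspace[OF assms(1) less.prems(1)]
      unfolding irreducible_rep_def by auto
    then have sub: "U' \<subseteq> U" using invariant_subspaceD(2)[OF U'(1)] by simp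
    then have inv: "invariant_subspace G V \<rho> U'"
      using U'(1) invariant_subspace_restrict U(2) by blast
    obtain B where B: "finite B" "B \<subseteq> U'" "vs.independent B" "U' = vs.span B"
      using finite_subspace_basis[of U'] invariant_subspaceD[OF inv] by blast
    obtain C where C: "finite C" "C \<subseteq> U" "vs.independent C" "U = vs.span C"
      using finite_subspace_basis[of U] U by blast
    \<comment> \<open>Adding a vector of \<open>U\<close> outside \<open>U'\<close> to a basis of
      \<open>U'\<close> keeps it independent, so the dimension drops strictly.\<close>
    obtain x where x: "x \<in> U" "x \<notin> vs.span B" using sub U'(3) B(4) by blast
    have "vs.independent (insert x B)" using x B by (simp add: vs.independent_insert)
    then have "card (insert x B) \<le> card C"
      using vs.independent_span_bound[OF C(1), of "insert x B"] x sub B C(4) by auto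
    moreover have "x \<notin> B" using x vs.span_base by blast
    ultimately have "card B < card C" using B by simp
    moreover have "vs.dim U' = card B" "vs.dim U = card C"
      using B C vs.dim_span_eq_card_independent by auto
    ultimately have "vs.dim U' < vs.dim U" by simp
    then show ?thesis using less.hyps[OF _ inv U'(2)] sub by blast
  qed
qed

lemma (in fd_space) projection_unique:
  assumes "vs.subspace U" "U \<subseteq> vecs V" "x \<in> vecs V"
    and "u \<in> U" "\<And>y. y \<in> U \<Longrightarrow> cinner V (x - u) y = 0"
    and "w \<in> U" "\<And>y. y \<in> U \<Longrightarrow> cinner V (x - w) y = 0"
  shows "u = w"
proof -
  have d: "w - u \<in> U" using assms vs.subspace_diff by blast
  have "cinner V ((x - u) - (x - w)) (w - u) = 0"
    using assms d by (subst inner_diff_left) (auto intro: vecs_diff)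
  then have "w - u = 0" using inner_eq_0_iff d assms(2) by auto
  then show ?thesis by simp
qed

text \<open>Linearity and equivariance follow from uniqueness of the projection: in each case the
  proposed value lies in \<open>U\<close> and differs from the vector by something orthogonal to
  \<open>U\<close>. For the group action the latter uses that the adjoint of \<open>\<rho> g\<close>
  is the action of the inverse, which preserves \<open>U\<close>.\<close>

lemma projection_intertwiner:
  assumes "group G" "unitary_rep G V \<rho>" "invariant_subspace G V \<rho> U"
  shows "\<exists>P. intertwiner G V \<rho> V \<rho> P \<and> P ` vecs V \<subseteq> U \<and>
           (\<forall>x\<in>vecs V. \<forall>y\<in>U. cinner V (x - P x) y = 0)"
proof -
  interpret group G by fact
  interpret fd_space V using unitary_repD(1)[OF assms(2)] by unfold_locales
  note U = invariant_subspaceD[OF assms(3)] and u = unitary_repD[OF assms(2)]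
  define P where "P x = (SOME u. u \<in> U \<and> (\<forall>y\<in>U. cinner V (x - u) y = 0))" for x
  have P: "P x \<in> U \<and> (\<forall>y\<in>U. cinner V (x - P x) y = 0)" if "x \<in> vecs V" for x
    unfolding P_def by (rule someI_ex) (use orthogonal_projection[OF U(1,2) that] in blast)
  have PV: "P x \<in> vecs V" if "x \<in> vecs V" for x using P[OF that] U(2) by blast
  have yV: "y \<in> vecs V" if "y \<in> U" for y using that U(2) by blast
  have eq: "P x = w" if "x \<in> vecs V" "w \<in> U" "\<And>y. y \<in> U \<Longrightarrow> cinner V (x - w) y = 0" for x w
    by (rule projection_unique[OF U(1,2) that(1)]) (use P[OF that(1)] that in auto)
  have "P (x + y) = P x + P y" if "x \<in> vecs V" "y \<in> vecs V" for x y
  proof (rule eq)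
    fix z assume z: "z \<in> U"
    have "cinner V ((x - P x) + (y - P y)) z = 0"
      using that z P by (subst inner_add_left) (auto intro: vecs_diff PV yV)
    then show "cinner V (x + y - (P x + P y)) z = 0" by (simp add: algebra_simps)
  qed (use that P vecs_add vs.subspace_add[OF U(1)] in auto)
  moreover have "P (cscale V c x) = cscale V c (P x)" if "x \<in> vecs V" for c x
  proof (rule eq)
    fix z assume z: "z \<in> U"
    have "cinner V (cscale V c (x - P x)) z = 0"
      using that z P by (subst inner_scale_left) (auto intro: vecs_diff PV yV)
    then show "cinner V (cscale V c x - cscale V c (P x)) z = 0" by (simp add: vs.scale_right_diff_distrib)
  qed (use that P vecs_scale vs.subspace_scale[OF U(1)] in auto)
  moreover have "P (\<rho> g x) = \<rho> g (P x)" if g: "g \<in> carrier G" and x: "x \<in> vecs V" for g x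
  proof (rule eq)
    fix z assume z: "z \<in> U"
    have "\<rho> g x - \<rho> g (P x) = \<rho> g (x - P x)"
      using linear_map_diff[OF fd u(2)[OF g] x PV[OF x]] by simp
    moreover have "cinner V (\<rho> g (x - P x)) z = cinner V (x - P x) (\<rho> (inv\<^bsub>G\<^esub> g) z)"
      using g x z by (intro unitary_rep_adjoint(1)[OF assms(1,2)]) (auto intro: vecs_diff PV yV)
    ultimately show "cinner V (\<rho> g x - \<rho> g (P x)) z = 0"
      using P[OF x] U(3)[OF inv_closed[OF g] z] by simp
  qed (use g x P u(3) U(3) in auto)
  ultimately show ?thesis
    unfolding intertwiner_def linear_map_def using P PV by (intro exI[of _ P]) auto
qed

text \<open>If two equivalent irreducible subrepresentations were distinct, projecting one to the orthogonal
  complement of the other would produce a second, orthogonal copy.\<close>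

lemma multiplicity_free_unique:
  assumes G: "group G" and u: "unitary_rep G V \<rho>" and mf: "multiplicity_free G V \<rho>"
    and U1: "invariant_subspace G V \<rho> U\<^sub>1" "irreducible_rep G (V\<lparr>vecs := U\<^sub>1\<rparr>) \<rho>"
    and U2: "invariant_subspace G V \<rho> U\<^sub>2" "irreducible_rep G (V\<lparr>vecs := U\<^sub>2\<rparr>) \<rho>"
    and eqv: "equiv_rep G (V\<lparr>vecs := U\<^sub>1\<rparr>) \<rho> (V\<lparr>vecs := U\<^sub>2\<rparr>) \<rho>"
  shows "U\<^sub>1 = U\<^sub>2"
proof (rule ccontr)
  assume ne: "U\<^sub>1 \<noteq> U\<^sub>2"
  interpret fd_space V using unitary_repD(1)[OF u] by unfold_locales
  note s1 = invariant_subspaceD[OF U1(1)] and s2 = invariant_subspaceD[OF U2(1)]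
  have "\<not> U\<^sub>2 \<subseteq> U\<^sub>1"
  proof
    assume "U\<^sub>2 \<subseteq> U\<^sub>1"
    then have "invariant_subspace G (V\<lparr>vecs := U\<^sub>1\<rparr>) \<rho> U\<^sub>2"
      using U2(1) invariant_subspace_restrict s1(2) by blast
    then have "U\<^sub>2 = {0} \<or> U\<^sub>2 = U\<^sub>1" using irreducible_repD(3)[OF U1(2)] by simp
    then show False using ne irreducible_repD(2)[OF U2(2)] by simp
  qed
  then obtain x where x: "x \<in> U\<^sub>2" "x \<notin> U\<^sub>1" by blast
  obtain P where P: "intertwiner G V \<rho> V \<rho> P" "P ` vecs V \<subseteq> U\<^sub>1"
    "\<forall>x\<in>vecs V. \<forall>y\<in>U\<^sub>1. cinner V (x - P x) y = 0"
    using projection_intertwiner[OF G u U1(1)] by blast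
  note PD = intertwinerD[OF P(1)]
  define T where "T x = x - P x" for x
  have TI: "intertwiner G V \<rho> V \<rho> T"
    unfolding intertwiner_def linear_map_def T_def
    using PD vecs_diff linear_map_diff[OF fd unitary_repD(2)[OF u]]
    by (auto simp: algebra_simps vs.scale_right_diff_distrib)
  have T2: "intertwiner G (V\<lparr>vecs := U\<^sub>2\<rparr>) \<rho> V \<rho> T"
    by (rule intertwiner_restrict_domain[OF TI s2(2)])
  \<comment> \<open>\<open>P x\<close> lies in the first subspace and \<open>x\<close> does not, so
    the remainder is nonzero; by irreducibility \<open>T\<close> is then injective on the second
    subspace.\<close>
  have Tx: "T x \<noteq> 0" using x P(2) s2(2) by (auto simp: T_def)
  define U3 where "U3 = T ` U\<^sub>2"
  have inv3: "invariant_subspace G V \<rho> U3"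
    unfolding U3_def using image_invariant[OF irreducible_repD(1)[OF U2(2)] u T2] by simp
  have "inj_on T U\<^sub>2" using irreducible_inj_on[OF U2(2) u T2 _ Tx] x by simp
  moreover have "intertwiner G (V\<lparr>vecs := U\<^sub>2\<rparr>) \<rho> (V\<lparr>vecs := U3\<rparr>) \<rho> T"
    by (rule intertwiner_restrict[OF TI s2(2)]) (simp add: U3_def)
  ultimately have e23: "equiv_rep G (V\<lparr>vecs := U\<^sub>2\<rparr>) \<rho> (V\<lparr>vecs := U3\<rparr>) \<rho>"
    unfolding equiv_rep_def U3_def by (auto simp: bij_betw_def)
  have irr3: "irreducible_rep G (V\<lparr>vecs := U3\<rparr>) \<rho>"
    by (rule irreducible_rep_equiv[OF U2(2) unitary_rep_subspace[OF u inv3] e23])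
  have "cinner V x y = 0" if "x \<in> U\<^sub>1" "y \<in> U3" for x y
  proof -
    obtain z where z: "z \<in> vecs V" "y = z - P z" using \<open>y \<in> U3\<close> s2(2) by (auto simp: U3_def T_def)
    then have "cinner V y x = 0" using P(3) that by blast
    then show ?thesis
      using inner_commute[of y x] that s1(2) invariant_subspaceD(2)[OF inv3] by auto
  qed
  then show False
    using mf U1 inv3 irr3 equiv_rep_trans[OF eqv e23] unfolding multiplicity_free_def by blast
qed

subsection \<open>Schur orthogonality\<close>

lemma (in group) sum_translate:
  assumes "g \<in> carrier G"
  shows "(\<Sum>x\<in>carrier G. f (g \<otimes> x)) = (\<Sum>x\<in>carrier G. f x)"
    and "(\<Sum>x\<in>carrier G. f (x \<otimes> g)) = (\<Sum>x\<in>carrier G. f x)"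
proof -
  show "(\<Sum>x\<in>carrier G. f (g \<otimes> x)) = (\<Sum>x\<in>carrier G. f x)"
    using assms by (intro sum.reindex_bij_witness[of _ "\<lambda>x. inv g \<otimes> x" "\<lambda>x. g \<otimes> x"])
      (auto simp: m_assoc[symmetric])
  show "(\<Sum>x\<in>carrier G. f (x \<otimes> g)) = (\<Sum>x\<in>carrier G. f x)"
    using assms by (intro sum.reindex_bij_witness[of _ "\<lambda>x. x \<otimes> inv g" "\<lambda>x. x \<otimes> g"])
      (auto simp: m_assoc)
qed

text \<open>The map is the group average of \<open>\<sigma> n\<close> composed with the rank-one map
  x -> <x, b> c and the inverse of \<open>\<theta> n\<close>. Equivariance is the substitution of
  \<open>g\<close> times \<open>n\<close> for \<open>n\<close>.\<close>

lemma schur_average_intertwiner: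
  assumes "group G" "unitary_rep G V \<theta>" "unitary_rep G W \<sigma>" "b \<in> vecs V" "c \<in> vecs W"
  shows "intertwiner G V \<theta> W \<sigma> (\<lambda>a. \<Sum>n\<in>carrier G. cscale W (cinner V a (\<theta> n b)) (\<sigma> n c))"
proof -
  interpret group G by fact
  interpret V: fd_space V using unitary_repD(1)[OF assms(2)] by unfold_locales
  interpret W: fd_space W using unitary_repD(1)[OF assms(3)] by unfold_locales
  note u = unitary_repD[OF assms(2)] and w = unitary_repD[OF assms(3)]
  let ?T = "\<lambda>a. \<Sum>n\<in>carrier G. cscale W (cinner V a (\<theta> n b)) (\<sigma> n c)"
  have "?T (\<theta> g a) = \<sigma> g (?T a)" if g: "g \<in> carrier G" and a: "a \<in> vecs V" for g a
  proof -
    have "?T (\<theta> g a) = (\<Sum>n\<in>carrier G. cscale W (cinner V (\<theta> g a) (\<theta> (g \<otimes>\<^bsub>G\<^esub> n) b)) (\<sigma> (g \<otimes>\<^bsub>G\<^esub> n) c))"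
      by (rule sum_translate(1)[OF g, symmetric])
    also have "\<dots> = (\<Sum>n\<in>carrier G. \<sigma> g (cscale W (cinner V a (\<theta> n b)) (\<sigma> n c)))"
      using g a assms(4,5) by (intro sum.cong) (auto simp: u w)
    also have "\<dots> = \<sigma> g (?T a)"
      using g assms(5) by (intro linear_map_sum[OF W.fd W.fd w(2)[OF g], symmetric])
        (auto simp: w W.vecs_scale)
    finally show ?thesis .
  qed
  then show ?thesis
    unfolding intertwiner_def linear_map_def using assms(4,5)
    by (auto simp: V.inner_add_left V.inner_scale_left u w W.vs.scale_left_distrib sum.distrib
        W.vs.scale_sum_right intro!: W.vecs_sum W.vecs_scale)
qed

lemma schur_orthogonality_inequivalent:
  assumes "group G" "irreducible_rep G V \<theta>" "irreducible_rep G W \<sigma>" "\<not> equiv_rep G V \<theta> W \<sigma>"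
    and "a \<in> vecs V" "b \<in> vecs V" "c \<in> vecs W"
  shows "(\<Sum>n\<in>carrier G. cscale W (cinner V a (\<theta> n b)) (\<sigma> n c)) = 0"
  using schur_equiv[OF assms(2,3) schur_average_intertwiner[OF assms(1) irreducible_repD(1)[OF assms(2)]
        irreducible_repD(1)[OF assms(3)] assms(6,7)] assms(5)] assms(4) by blast

lemma cdim_pos:
  assumes "fd_inner_space V" "vecs V \<noteq> {0}"
  shows "cdim V > 0"
proof -
  interpret fd_space V using assms by unfold_locales
  obtain E where E: "finite E" "vs.span E = vecs V" "card E = cdim V"
    using ex_orthonormal_basis by blast
  have "E \<noteq> {}" using E(2) assms(2) vs.span_empty by metis
  then show ?thesis using E(1,3) card_gt_0_iff by metis
qed

text \<open>Schur's lemma makes the average a scalar \<open>z\<close>, and the trace determines it.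
  Parseval turns the trace into the sum over n of <\<theta>(n) c, \<theta>(n) b>, each term of which
  is <c, b> by unitarity; comparison with \<open>z\<close> times the dimension gives the
  constant.\<close>

lemma schur_orthogonality:
  assumes "group G" "finite (carrier G)" "irreducible_rep G V \<theta>"
    and abc: "a \<in> vecs V" "b \<in> vecs V" "c \<in> vecs V"
  shows "(\<Sum>n\<in>carrier G. cscale V (cinner V a (\<theta> n b)) (\<theta> n c))
         = cscale V (of_nat (card (carrier G)) / of_nat (cdim V) * cinner V c b) a"
proof -
  interpret group G by fact
  have u0: "unitary_rep G V \<theta>" using assms(3) by (rule irreducible_repD)
  interpret fd_space V using unitary_repD(1)[OF u0] by unfold_locales
  note u = unitary_repD[OF u0]
  let ?T = "\<lambda>a. \<Sum>n\<in>carrier G. cscale V (cinner V a (\<theta> n b)) (\<theta> n c)"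
  obtain z where z: "\<And>x. x \<in> vecs V \<Longrightarrow> ?T x = cscale V z x"
    using schur_scalar[OF assms(3) schur_average_intertwiner[OF assms(1) u0 u0 abc(2,3)]] by blast
  obtain E where E: "finite E" "E \<subseteq> vecs V" "orthonormal E" "vs.span E = vecs V" "card E = cdim V"
    using ex_orthonormal_basis by blast
  have eV: "e \<in> vecs V" if "e \<in> E" for e using that E(2) by blast
  have "of_nat (cdim V) * z = (\<Sum>e\<in>E. z * cinner V e e)"
    using E(3,5) by (simp add: orthonormal_def)
  also have "\<dots> = (\<Sum>e\<in>E. cinner V (?T e) e)"
    by (intro sum.cong) (auto simp: z eV inner_scale_left)
  also have "\<dots> = (\<Sum>e\<in>E. \<Sum>n\<in>carrier G. cinner V e (\<theta> n b) * cinner V (\<theta> n c) e)"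
  proof (intro sum.cong refl)
    fix e assume e: "e \<in> E"
    show "cinner V (?T e) e = (\<Sum>n\<in>carrier G. cinner V e (\<theta> n b) * cinner V (\<theta> n c) e)"
      using eV[OF e] abc by (subst inner_sum_left) (auto simp: u vecs_scale inner_scale_left)
  qed
  also have "\<dots> = (\<Sum>n\<in>carrier G. \<Sum>e\<in>E. cinner V (\<theta> n c) e * cinner V e (\<theta> n b))"
    by (subst sum.swap) (simp add: mult.commute)
  also have "\<dots> = (\<Sum>n\<in>carrier G. cinner V (\<theta> n c) (\<theta> n b))"
    using abc by (intro sum.cong parseval[OF E(1-4), symmetric]) (auto simp: u)
  also have "\<dots> = of_nat (card (carrier G)) * cinner V c b"
    using abc by (simp add: u)
  finally have "z = of_nat (card (carrier G)) / of_nat (cdim V) * cinner V c b"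
    using cdim_pos[OF fd irreducible_repD(2)[OF assms(3)]] by (simp add: field_simps)
  then show ?thesis using z[OF abc(1)] by simp
qed

section \<open>Induced representations\<close>

lemma ind_space_simps [simp]:
  "cscale (ind_space G K V \<theta>) c f = (\<lambda>g. cscale V c (f g))"
  "cinner (ind_space G K V \<theta>) f f' = (\<Sum>g\<in>carrier G. cinner V (f g) (f' g)) / of_nat (card K)"
  by (simp_all add: ind_space_def)

lemma cscale_ind_space: "cscale (ind_space G K V \<theta>) = (\<lambda>c f g. cscale V c (f g))"
  by (simp add: ind_space_def)

lemma ind_spaceI:
  assumes "\<And>g. g \<in> carrier G \<Longrightarrow> f g \<in> vecs V" "\<And>g. g \<notin> carrier G \<Longrightarrow> f g = 0"
    "\<And>g k. \<lbrakk>g \<in> carrier G; k \<in> K\<rbrakk> \<Longrightarrow> f (g \<otimes>\<^bsub>G\<^esub> k) = \<theta> (inv\<^bsub>G\<^esub> k) (f g)"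
  shows "f \<in> vecs (ind_space G K V \<theta>)"
  using assms by (simp add: ind_space_def)

lemma ind_spaceD:
  assumes "f \<in> vecs (ind_space G K V \<theta>)"
  shows "g \<in> carrier G \<Longrightarrow> f g \<in> vecs V" "g \<notin> carrier G \<Longrightarrow> f g = 0"
    "\<lbrakk>g \<in> carrier G; k \<in> K\<rbrakk> \<Longrightarrow> f (g \<otimes>\<^bsub>G\<^esub> k) = \<theta> (inv\<^bsub>G\<^esub> k) (f g)"
  using assms by (simp_all add: ind_space_def)

lemma vector_space_fun:
  assumes "vector_space s"
  shows "vector_space (\<lambda>c f g. s c (f g))"
proof -
  interpret vector_space s by fact
  show ?thesis
    by unfold_locales (auto simp: fun_eq_iff scale_right_distrib scale_left_distrib)
qed

text \<open>Point masses with values in a spanning set of \<open>V\<close> suffice. The covariance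
  condition of induced spaces is left out here, because point masses do not satisfy it; finite
  dimension passes to the covariant functions afterwards.\<close>

lemma functions_finite_spanning:
  assumes "fd_inner_space V" "finite A"
  shows "\<exists>D. finite D \<and> (\<forall>f. (\<forall>g\<in>A. f g \<in> vecs V) \<longrightarrow> (\<forall>g. g \<notin> A \<longrightarrow> f g = 0) \<longrightarrow>
           f \<in> module.span (\<lambda>c f g. cscale V c (f g)) D)"
proof -
  interpret fd_space V using assms(1) by unfold_locales
  interpret F: vector_space "\<lambda>c f g. cscale V c (f g)" by (rule vector_space_fun) unfold_locales
  obtain B where B: "finite B" "vecs V = vs.span B" using ex_finite_spanning by blast
  define single where "single g b x = (if x = g then b else 0)" for g x :: 'b and b :: 'a
  define D where "D = (\<lambda>(g, b). single g b) ` (A \<times> B)"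
  have single: "single g b \<in> F.span D" if "g \<in> A" "b \<in> vs.span B" for g b
    using that(2)
  proof (induction rule: vs.span_induct_alt)
    case base
    have "single g 0 = 0" by (simp add: single_def fun_eq_iff zero_fun_def)
    show ?case unfolding \<open>single g 0 = 0\<close> by (rule F.span_zero)
  next
    case (step c x y)
    have "single g x \<in> D" using step(1) that(1) by (auto simp: D_def)
    then have "(\<lambda>z. cscale V c (single g x z)) + single g y \<in> F.span D"
      using step(2) F.span_add[OF F.span_scale[OF F.span_base]] by blast
    also have "(\<lambda>z. cscale V c (single g x z)) + single g y = single g (cscale V c x + y)"
      by (auto simp: single_def fun_eq_iff)
    finally show ?case .
  qed
  have "f \<in> F.span D" if f: "\<forall>g\<in>A. f g \<in> vecs V" "\<forall>g. g \<notin> A \<longrightarrow> f g = 0" for f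
  proof -
    have "(\<Sum>g\<in>A. single g (f g)) x = f x" for x
    proof -
      have "(\<Sum>g\<in>A. single g (f g)) x = (\<Sum>g\<in>A. if g = x then f x else 0)"
        by (induction A rule: infinite_finite_induct) (auto simp: single_def)
      then show ?thesis using assms(2) f(2) by simp
    qed
    then have "f = (\<Sum>g\<in>A. single g (f g))" by (simp add: fun_eq_iff)
    moreover have "(\<Sum>g\<in>A. single g (f g)) \<in> F.span D"
      using f(1) B(2) single by (intro F.span_sum) auto
    ultimately show ?thesis by metis
  qed
  moreover have "finite D" using B(1) assms(2) by (simp add: D_def)
  ultimately show ?thesis by blast
qed

lemma fd_inner_space_ind:
  assumes G: "group G" and fin: "finite (carrier G)" and K: "subgroup K G"
    and u: "unitary_rep (G\<lparr>carrier := K\<rparr>) V \<theta>"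
  shows "fd_inner_space (ind_space G K V \<theta>)"
proof -
  interpret group G by fact
  interpret K: subgroup K G by fact
  interpret fd_space V using unitary_repD(1)[OF u] by unfold_locales
  interpret F: vector_space "\<lambda>c f g. cscale V c (f g)" by (rule vector_space_fun) unfold_locales
  let ?M = "ind_space G K V \<theta>"
  have \<theta>0: "\<theta> k 0 = 0" if "k \<in> K" for k
    using linear_map_zero[OF fd fd unitary_repD(2)[OF u]] that by simp
  have sub: "F.subspace (vecs ?M)"
    by (rule F.subspaceI; rule ind_spaceI)
      (auto simp: ind_spaceD \<theta>0 unitary_repD(4,5)[OF u] intro!: vecs_add vecs_scale)
  obtain D where D: "finite D" "vecs ?M \<subseteq> F.span D"
    using functions_finite_spanning[OF fd fin] ind_spaceD(1,2)[of _ G K V \<theta>]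
    by (metis (no_types, lifting) subsetI)
  \<comment> \<open>A maximal independent set of covariant functions is finite because it lies in
    the span of the finite set \<open>D\<close>.\<close>
  obtain C where C: "C \<subseteq> vecs ?M" "F.independent C" "vecs ?M \<subseteq> F.span C"
    using F.maximal_independent_subset by blast
  have "finite C" using F.independent_span_bound[OF D(1) C(2)] C(1) D(2) by blast
  moreover have "vecs ?M = F.span C" using F.span_minimal[OF C(1) sub] C(3) by blast
  ultimately have span: "\<exists>B. finite B \<and> vecs ?M = F.span B" by blast
  \<comment> \<open>The inner product is divided by \<open>card K\<close>. With
    \<open>card K = 0\<close> the quotient would be 0 and positivity would fail.\<close>
  have cK: "card K > 0" using K.one_closed K.subset fin finite_subset by (metis card_gt_0_iff empty_iff)
  have pos: "0 < Re (cinner ?M f f)" if f: "f \<in> vecs ?M" "f \<noteq> 0" for f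
  proof -
    obtain g where g: "f g \<noteq> 0" using f(2) by (auto simp: fun_eq_iff)
    then have "g \<in> carrier G" using ind_spaceD(2)[OF f(1)] by blast
    moreover have "0 \<le> Re (cinner V x x)" if "x \<in> vecs V" for x
      using inner_pos[OF that] inner_zero_left[of 0] by (cases "x = 0") auto
    ultimately have "0 < (\<Sum>g\<in>carrier G. Re (cinner V (f g) (f g)))"
      using fin g inner_pos ind_spaceD(1)[OF f(1)] by (intro sum_pos2[of _ g]) auto
    then show ?thesis using cK by (simp add: Re_divide_of_nat)
  qed
  have comm: "cinner ?M f' f = cnj (cinner ?M f f')" if "f \<in> vecs ?M" "f' \<in> vecs ?M" for f f'
  proof -
    have "(\<Sum>g\<in>carrier G. cinner V (f' g) (f g)) = (\<Sum>g\<in>carrier G. cnj (cinner V (f g) (f' g)))"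
      by (intro sum.cong refl inner_commute ind_spaceD(1)[OF that(1)] ind_spaceD(1)[OF that(2)])
    then show ?thesis by simp
  qed
  show ?thesis
    unfolding fd_inner_space_def cscale_ind_space
  proof (intro conjI ballI allI impI)
    show "vector_space (\<lambda>c f g. cscale V c (f g))" by unfold_locales
    show "\<exists>B. finite B \<and> vecs ?M = F.span B" by (rule span)
  next
    fix x y z assume "x \<in> vecs ?M" "y \<in> vecs ?M" "z \<in> vecs ?M"
    then show "cinner ?M (x + y) z = cinner ?M x z + cinner ?M y z"
      by (simp add: inner_add_left ind_spaceD(1) sum.distrib add_divide_distrib)
  next
    fix c x y assume "x \<in> vecs ?M" "y \<in> vecs ?M"
    then show "cinner ?M (\<lambda>g. cscale V c (x g)) y = c * cinner ?M x y"
      by (simp add: inner_scale_left ind_spaceD(1) sum_distrib_left)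
  qed (fact comm pos)+
qed

lemma unitary_rep_ind:
  assumes G: "group G" and fin: "finite (carrier G)" and K: "subgroup K G"
    and u: "unitary_rep (G\<lparr>carrier := K\<rparr>) V \<theta>"
  shows "unitary_rep G (ind_space G K V \<theta>) (ind_act G)"
proof -
  interpret group G by fact
  interpret K: subgroup K G by fact
  have closed: "ind_act G g f \<in> vecs (ind_space G K V \<theta>)"
    if "g \<in> carrier G" "f \<in> vecs (ind_space G K V \<theta>)" for g f
    by (rule ind_spaceI)
      (use that in \<open>auto simp: ind_act_def ind_spaceD m_assoc[symmetric]\<close>)
  have iso: "cinner (ind_space G K V \<theta>) (ind_act G g f) (ind_act G g f')
      = cinner (ind_space G K V \<theta>) f f'" if "g \<in> carrier G" for g f f'
    using sum_translate(1)[OF inv_closed[OF that], of "\<lambda>x. cinner V (f x) (f' x)"]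
    by (simp add: ind_act_def)
  interpret fd_space V using unitary_repD(1)[OF u] by unfold_locales
  show ?thesis
    unfolding unitary_rep_def linear_map_def isometric_on_def
    using fd_inner_space_ind[OF assms] closed iso
    by (auto simp: ind_act_def fun_eq_iff ind_spaceD(2) inv_mult_group m_assoc)
qed

section \<open>The inertia group and an extension of \<open>\<theta>\<close>\<close>

text \<open>Since \<open>\<xi>\<close> acts on the space of \<open>\<theta>\<close> itself and
  restricts to it exactly, each operator \<open>\<xi> h\<close> is an explicit intertwiner between
  the conjugate of \<open>\<theta>\<close> by \<open>h\<close> and \<open>\<theta>\<close>.
  Membership in the inertia group alone would only give one up to a scalar.\<close>

locale inertia_extension = normal N G for N and G :: "('g, 'm) monoid_scheme" (structure) +
  fixes V :: "'v::ab_group_add cips" and \<theta> \<xi> :: "'g \<Rightarrow> 'v \<Rightarrow> 'v"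
  assumes finite_G: "finite (carrier G)"
    and irreducible_\<theta>: "irreducible_rep (G\<lparr>carrier := N\<rparr>) V \<theta>"
    and unitary_\<xi>: "unitary_rep (inertia_group G N V \<theta>) V \<xi>"
    and \<xi>_extends: "\<lbrakk>n \<in> N; x \<in> vecs V\<rbrakk> \<Longrightarrow> \<xi> n x = \<theta> n x"
begin

abbreviation "I \<equiv> inertia G N V \<theta>"
abbreviation "GI \<equiv> inertia_group G N V \<theta>"
abbreviation "Q \<equiv> inertia_quotient G N V \<theta>"
abbreviation "GN \<equiv> G\<lparr>carrier := N\<rparr>"
abbreviation q :: "'g \<Rightarrow> 'g set" where "q h \<equiv> h <# N"

lemmas unitary_\<theta> = irreducible_repD(1)[OF irreducible_\<theta>]
lemmas \<theta>D = unitary_repD[OF unitary_\<theta>, simplified]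
lemmas \<xi>D = unitary_repD[OF unitary_\<xi>, simplified inertia_group_def, simplified]

sublocale fd_space V
  using \<theta>D(1) by unfold_locales

lemma one_N: "\<one> \<in> N"
  by (rule subgroup.one_closed[OF subgroup_axioms])

lemma group_GN: "group GN"
  by (rule subgroup_is_group[OF group_axioms])

lemma finite_N: "finite N"
  by (rule finite_subset[OF subset finite_G])

lemma inv_GN: "n \<in> N \<Longrightarrow> inv\<^bsub>GN\<^esub> n = inv n"
  using m_inv_consistent[OF subgroup_axioms] by simp

lemma conj_in_N: "\<lbrakk>g \<in> carrier G; n \<in> N\<rbrakk> \<Longrightarrow> inv g \<otimes> n \<otimes> g \<in> N"
  using inv_op_closed1 by blast

lemma conj_inv_in_N: "\<lbrakk>g \<in> carrier G; n \<in> N\<rbrakk> \<Longrightarrow> g \<otimes> n \<otimes> inv g \<in> N"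
  using inv_op_closed2 by blast

lemma I_sub: "h \<in> I \<Longrightarrow> h \<in> carrier G"
  by (simp add: inertia_def)

lemma N_sub: "n \<in> N \<Longrightarrow> n \<in> carrier G"
  using subset by blast

lemma conj_conj: "\<lbrakk>g \<in> carrier G; n \<in> carrier G\<rbrakk> \<Longrightarrow> inv g \<otimes> (g \<otimes> n \<otimes> inv g) \<otimes> g = n"
  by (simp add: m_assoc inv_solve_left')

lemma conj_mult:
  assumes "g \<in> carrier G" "m \<in> carrier G" "n \<in> carrier G"
  shows "inv g \<otimes> (m \<otimes> n) \<otimes> g = (inv g \<otimes> m \<otimes> g) \<otimes> (inv g \<otimes> n \<otimes> g)"
proof -
  have "g \<otimes> (inv g \<otimes> (n \<otimes> g)) = n \<otimes> g" using assms by (simp add: m_assoc[symmetric])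
  then show ?thesis using assms by (simp add: m_assoc)
qed

section \<open>Conjugate representations and the inertia group\<close>

lemma unitary_conj_rep:
  assumes g: "g \<in> carrier G"
  shows "unitary_rep GN V (conj_rep G g \<theta>)"
  unfolding unitary_rep_def linear_map_def isometric_on_def
  using g conj_in_N[OF g] \<theta>D fd
  by (auto simp: conj_rep_def conj_mult N_sub)

lemma irreducible_conj_rep:
  assumes g: "g \<in> carrier G"
  shows "irreducible_rep GN V (conj_rep G g \<theta>)"
proof -
  have "invariant_subspace GN V \<theta> U" if U: "invariant_subspace GN V (conj_rep G g \<theta>) U" for U
  proof -
    have "\<theta> n x \<in> U" if "n \<in> N" "x \<in> U" for n x
      using invariant_subspaceD(3)[OF U, of "g \<otimes> n \<otimes> inv g" x] conj_inv_in_N[OF g] that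
      by (simp add: conj_rep_def conj_conj g N_sub)
    then show ?thesis using U unfolding invariant_subspace_def by simp
  qed
  then show ?thesis
    using unitary_conj_rep[OF g] irreducible_\<theta> unfolding irreducible_rep_def by blast
qed

text \<open>For \<open>h\<close> in \<open>N\<close> the operator \<open>\<theta> h\<close>
  intertwines the conjugate by \<open>h\<close> with \<open>\<theta>\<close>.\<close>

lemma N_subset_I: "N \<subseteq> I"
proof
  fix h assume h: "h \<in> N"
  have "h \<otimes> (inv h \<otimes> n \<otimes> h) = n \<otimes> h" if "n \<in> N" for n
    using h that N_sub by (simp add: m_assoc[symmetric])
  then have "\<theta> h (\<theta> (inv h \<otimes> n \<otimes> h) x) = \<theta> n (\<theta> h x)" if "n \<in> N" "x \<in> vecs V" for n x
    using \<theta>D(8)[OF h conj_in_N[OF N_sub[OF h]], of n x] \<theta>D(8)[of n h x] h that by simp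
  then have "intertwiner GN V (conj_rep G h \<theta>) V \<theta> (\<theta> h)"
    unfolding intertwiner_def using \<theta>D(2)[OF h] by (simp add: conj_rep_def)
  moreover have "bij_betw (\<theta> h) (vecs V) (vecs V)"
    by (rule bij_betw_byWitness[of _ "\<theta> (inv h)"])
      (use unitary_rep_inv_cancel[OF group_GN unitary_\<theta>, of h] h \<theta>D(3) in \<open>auto simp: inv_GN\<close>)
  ultimately show "h \<in> I" using h N_sub unfolding inertia_def equiv_rep_def by blast
qed

text \<open>Witnessing intertwiners compose, since conjugating twice is conjugating by the product.
  For an inverse the witness is inverted and \<open>n\<close> is replaced by \<open>h\<close>
  \<open>n\<close> \<open>inv h\<close>, which stays in \<open>N\<close> by normality.\<close>

lemma subgroup_I: "subgroup I G"
proof (rule subgroupI)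
  show "I \<subseteq> carrier G" using I_sub by blast
  show "I \<noteq> {}" using N_subset_I one_N by blast
next
  fix h assume h: "h \<in> I"
  then have hG: "h \<in> carrier G" by (rule I_sub)
  then obtain S where S: "intertwiner GN V \<theta> V (conj_rep G h \<theta>) S" "bij_betw S (vecs V) (vecs V)"
    using equiv_rep_sym[OF unitary_conj_rep[OF hG]] h unfolding inertia_def equiv_rep_def by blast
  have "S (\<theta> (h \<otimes> n \<otimes> inv h) x) = \<theta> n (S x)" if "n \<in> N" "x \<in> vecs V" for n x
    using intertwinerD(5)[OF S(1), of "h \<otimes> n \<otimes> inv h" x] conj_inv_in_N[OF hG] that
    by (simp add: conj_rep_def conj_conj hG N_sub)
  then have "intertwiner GN V (conj_rep G (inv h) \<theta>) V \<theta> S"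
    using intertwinerD(1)[OF S(1)] hG by (simp add: intertwiner_def conj_rep_def)
  then show "inv h \<in> I" using S(2) hG unfolding inertia_def equiv_rep_def by blast
next
  fix h k assume h: "h \<in> I" and k: "k \<in> I"
  then have hG: "h \<in> carrier G" and kG: "k \<in> carrier G" by (auto dest: I_sub)
  obtain S T where S: "intertwiner GN V (conj_rep G h \<theta>) V \<theta> S" "bij_betw S (vecs V) (vecs V)"
    and T: "intertwiner GN V (conj_rep G k \<theta>) V \<theta> T" "bij_betw T (vecs V) (vecs V)"
    using h k unfolding inertia_def equiv_rep_def by blast
  have eq: "inv (h \<otimes> k) \<otimes> n \<otimes> (h \<otimes> k) = inv k \<otimes> (inv h \<otimes> n \<otimes> h) \<otimes> k" if "n \<in> N" for n
    using hG kG N_sub[OF that] by (simp add: inv_mult_group m_assoc)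
  have "S (T (\<theta> (inv (h \<otimes> k) \<otimes> n \<otimes> (h \<otimes> k)) x)) = \<theta> n (S (T x))" if "n \<in> N" "x \<in> vecs V" for n x
    using intertwinerD(5)[OF T(1), of "inv h \<otimes> n \<otimes> h" x] conj_in_N[OF hG that(1)] that
      intertwinerD(5)[OF S(1), of n "T x"] intertwinerD(2)[OF T(1)]
    by (simp add: conj_rep_def eq)
  then have "intertwiner GN V (conj_rep G (h \<otimes> k) \<theta>) V \<theta> (\<lambda>x. S (T x))"
    using linear_map_compose[OF intertwinerD(1)[OF T(1)] intertwinerD(1)[OF S(1)]]
    by (simp add: intertwiner_def conj_rep_def)
  moreover have "bij_betw (\<lambda>x. S (T x)) (vecs V) (vecs V)"
    using bij_betw_trans[OF T(2) S(2)] by (simp add: comp_def)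
  ultimately show "h \<otimes> k \<in> I" using hG kG unfolding inertia_def equiv_rep_def by blast
qed

lemmas I_mult = subgroup.m_closed[OF subgroup_I]
lemmas I_inv = subgroup.m_inv_closed[OF subgroup_I]
lemmas I_one = subgroup.one_closed[OF subgroup_I]

lemma N_I: "n \<in> N \<Longrightarrow> n \<in> I"
  using N_subset_I by blast

lemma finite_I: "finite I"
  by (rule finite_subset[OF _ finite_G]) (use I_sub in blast)

lemma card_I_pos: "card I > 0"
  using finite_I I_one by (auto simp: card_gt_0_iff)

lemma card_N_pos: "card N > 0"
  using finite_N one_N by (metis card_gt_0_iff empty_iff)

section \<open>The quotient of the inertia group by N, and sums over cosets\<close>

lemma carrier_GI [simp]: "carrier GI = I"
  by (simp add: inertia_group_def)

lemma mult_GI [simp]: "x \<otimes>\<^bsub>GI\<^esub> y = x \<otimes> y"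
  by (simp add: inertia_group_def)

lemma one_GI [simp]: "\<one>\<^bsub>GI\<^esub> = \<one>"
  by (simp add: inertia_group_def)

lemma group_GI: "group GI"
  unfolding inertia_group_def by (rule subgroup.subgroup_is_group[OF subgroup_I group_axioms])

lemma inv_GI: "h \<in> I \<Longrightarrow> inv\<^bsub>GI\<^esub> h = inv h"
  unfolding inertia_group_def using m_inv_consistent[OF subgroup_I] by simp

lemma \<xi>_inv_cancel:
  assumes "h \<in> I" "x \<in> vecs V"
  shows "\<xi> h (\<xi> (inv h) x) = x" "\<xi> (inv h) (\<xi> h x) = x"
  using unitary_rep_inv_cancel[OF group_GI unitary_\<xi>, of h x] assms by (simp_all add: inv_GI)

lemma \<xi>_adjoint:
  assumes "h \<in> I" "x \<in> vecs V" "y \<in> vecs V"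
  shows "cinner V (\<xi> h x) y = cinner V x (\<xi> (inv h) y)"
    and "cinner V x (\<xi> h y) = cinner V (\<xi> (inv h) x) y"
  using unitary_rep_adjoint[OF group_GI unitary_\<xi>, of h x y] assms by (simp_all add: inv_GI)

lemma normal_N_GI: "normal N GI"
  unfolding inertia_group_def
  by (rule normal_restrict_supergroup[OF subgroup_I normal_axioms N_subset_I])

text \<open>Inflation is defined with left cosets, the factor group with right cosets; normality of
  \<open>N\<close> identifies them.\<close>

lemma q_eq: "h \<in> I \<Longrightarrow> q h = N #>\<^bsub>GI\<^esub> h"
  using coset_eq I_sub by (simp add: r_coset_def)

lemma group_Q: "group Q"
  unfolding inertia_quotient_def by (rule normal.factorgroup_is_group[OF normal_N_GI])

lemma carrier_Q: "carrier Q = q ` I"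
  unfolding inertia_quotient_def FactGroup_def RCOSETS_def using q_eq by auto

lemma q_closed [simp]: "h \<in> I \<Longrightarrow> q h \<in> carrier Q"
  by (simp add: carrier_Q)

lemma finite_Q: "finite (carrier Q)"
  by (simp add: carrier_Q finite_I)

lemma one_Q: "\<one>\<^bsub>Q\<^esub> = N"
  by (simp add: inertia_quotient_def FactGroup_def)

lemma q_mult: "\<lbrakk>h \<in> I; k \<in> I\<rbrakk> \<Longrightarrow> q (h \<otimes> k) = q h \<otimes>\<^bsub>Q\<^esub> q k"
  using normal.rcos_sum[OF normal_N_GI, of h k]
  by (simp add: q_eq I_mult inertia_quotient_def FactGroup_def)

lemma q_eq_one_iff: "h \<in> I \<Longrightarrow> q h = N \<longleftrightarrow> h \<in> N"
proof
  assume h: "h \<in> I" "q h = N"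
  have "h \<otimes> \<one> \<in> q h" unfolding l_coset_def using one_N by blast
  then show "h \<in> N" using h I_sub by simp
next
  assume "h \<in> N"
  then have "N #> h = N" by (rule rcos_const[OF is_group])
  then show "q h = N" using coset_eq N_sub \<open>h \<in> N\<close> by simp
qed

lemma q_N: "n \<in> N \<Longrightarrow> q n = \<one>\<^bsub>Q\<^esub>"
  using q_eq_one_iff N_I one_Q by simp

lemma q_one: "q \<one> = \<one>\<^bsub>Q\<^esub>"
  by (rule q_N[OF one_N])

lemma q_inv: "h \<in> I \<Longrightarrow> q (inv h) = inv\<^bsub>Q\<^esub> (q h)"
  using q_mult[of "inv h" h] q_one I_inv I_sub by (intro group.inv_equality[OF group_Q, symmetric]) auto

lemma q_mult_N: "\<lbrakk>h \<in> I; n \<in> N\<rbrakk> \<Longrightarrow> q (h \<otimes> n) = q h"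
  using q_mult[of h n] q_N N_I group.is_monoid[OF group_Q] by (simp add: monoid.r_one)

lemma q_eq_iff:
  assumes "h \<in> I" "k \<in> I"
  shows "q h = q k \<longleftrightarrow> k \<in> q h"
proof
  assume "q h = q k"
  moreover have "k \<otimes> \<one> \<in> q k" unfolding l_coset_def using one_N by blast
  ultimately show "k \<in> q h" using assms I_sub by simp
next
  assume "k \<in> q h"
  then obtain n where "n \<in> N" "k = h \<otimes> n" unfolding l_coset_def by blast
  then show "q h = q k" using q_mult_N[OF assms(1)] by metis
qed

lemma q_subset_I: "h \<in> I \<Longrightarrow> q h \<subseteq> I"
  using N_I I_mult unfolding l_coset_def by blast

lemma inj_on_translate: "h \<in> carrier G \<Longrightarrow> inj_on (\<lambda>n. h \<otimes> n) N"
  using N_sub by (intro inj_onI) simp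

lemma sum_q: "h \<in> carrier G \<Longrightarrow> (\<Sum>y\<in>q h. f y) = (\<Sum>n\<in>N. f (h \<otimes> n))"
proof -
  assume h: "h \<in> carrier G"
  have "q h = (\<lambda>n. h \<otimes> n) ` N" unfolding l_coset_def by blast
  then show ?thesis using sum.reindex[OF inj_on_translate[OF h], of f] by (simp add: comp_def)
qed

lemma card_q: "h \<in> carrier G \<Longrightarrow> card (q h) = card N"
  using sum_q[of h "\<lambda>_. 1 :: nat"] by simp

lemma sum_over_cosets:
  fixes f :: "'g set \<Rightarrow> complex"
  shows "(\<Sum>h\<in>I. f (q h)) = of_nat (card N) * (\<Sum>C\<in>carrier Q. f C)"
proof -
  have "(\<Sum>h\<in>I. f (q h)) = (\<Sum>C\<in>q ` I. \<Sum>h\<in>{h \<in> I. q h = C}. f (q h))"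
    by (rule sum.image_gen[OF finite_I])
  also have "\<dots> = (\<Sum>C\<in>q ` I. of_nat (card N) * f C)"
  proof (rule sum.cong[OF refl])
    fix C assume "C \<in> q ` I"
    then obtain k where k: "k \<in> I" "C = q k" by blast
    then have "{h \<in> I. q h = C} = q k" using q_eq_iff q_subset_I by blast
    then have "card {h \<in> I. q h = C} = card N" using card_q k I_sub by simp
    moreover have "(\<Sum>h\<in>{h \<in> I. q h = C}. f (q h)) = (\<Sum>h\<in>{h \<in> I. q h = C}. f C)"
      by (intro sum.cong) auto
    ultimately show "(\<Sum>h\<in>{h \<in> I. q h = C}. f (q h)) = of_nat (card N) * f C" by simp
  qed
  finally show ?thesis by (simp add: carrier_Q sum_distrib_left)
qed

lemma card_I: "of_nat (card I) = (of_nat (card N) * of_nat (card (carrier Q)) :: complex)"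
  using sum_over_cosets[of "\<lambda>_. 1"] by simp

text \<open>Right translation by an element of \<open>N\<close> permutes \<open>I\<close>. Hence a
  sum over \<open>I\<close> may be replaced by an average over \<open>N\<close> inside it, which
  makes Schur orthogonality over \<open>N\<close> applicable to sums over \<open>I\<close>.\<close>

lemma sum_I_average:
  fixes f :: "'g \<Rightarrow> complex"
  shows "(\<Sum>h\<in>I. \<Sum>n\<in>N. f (h \<otimes> n)) = of_nat (card N) * (\<Sum>h\<in>I. f h)"
proof -
  have "(\<Sum>h\<in>I. \<Sum>n\<in>N. f (h \<otimes> n)) = (\<Sum>n\<in>N. \<Sum>h\<in>I. f (h \<otimes> n))" by (rule sum.swap)
  also have "\<dots> = (\<Sum>n\<in>N. \<Sum>h\<in>I. f h)"
    by (rule sum.cong[OF refl]) (use group.sum_translate(2)[OF group_GI, of _ f] N_I in simp)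
  finally show ?thesis by simp
qed

subsection \<open>Averages over \<open>N\<close>\<close>

text \<open>The constant of Schur orthogonality for \<open>\<theta>\<close>; its inverse is the
  factor in \<open>hecke_idem\<close>.\<close>

abbreviation "dN \<equiv> (of_nat (card N) / of_nat (cdim V) :: complex)"

lemma dN_nonzero: "dN \<noteq> 0"
  using card_N_pos cdim_pos[OF fd irreducible_repD(2)[OF irreducible_\<theta>]] by simp

lemma average_\<theta>:
  assumes "a \<in> vecs V" "b \<in> vecs V" "c \<in> vecs V"
  shows "(\<Sum>n\<in>N. cscale V (cinner V a (\<theta> n b)) (\<theta> n c)) = cscale V (dN * cinner V c b) a"
  using schur_orthogonality[OF group_GN _ irreducible_\<theta> assms] finite_N by simp

lemma inner_average_\<theta>:
  assumes "a \<in> vecs V" "b \<in> vecs V" "c \<in> vecs V" "e \<in> vecs V"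
  shows "(\<Sum>n\<in>N. cinner V a (\<theta> n b) * cinner V (\<theta> n c) e) = dN * cinner V c b * cinner V a e"
proof -
  have "(\<Sum>n\<in>N. cinner V a (\<theta> n b) * cinner V (\<theta> n c) e)
      = cinner V (\<Sum>n\<in>N. cscale V (cinner V a (\<theta> n b)) (\<theta> n c)) e"
    using assms by (subst inner_sum_left) (auto simp: \<theta>D(3) vecs_scale inner_scale_left)
  then show ?thesis using average_\<theta>[OF assms(1-3)] assms by (simp add: inner_scale_left)
qed

lemma conj_rep_not_equiv:
  assumes "g \<in> carrier G" "g \<notin> I"
  shows "\<not> equiv_rep GN V \<theta> V (conj_rep G g \<theta>)"
  using equiv_rep_sym[OF unitary_\<theta>, of V "conj_rep G g \<theta>"] assms unfolding inertia_def by blast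

text \<open>Outside the inertia group the conjugate of \<open>\<theta>\<close> is an irreducible
  representation inequivalent to \<open>\<theta>\<close>, so the two have orthogonal matrix
  coefficients.\<close>

lemma average_conj_outside:
  assumes "g \<in> carrier G" "g \<notin> I" "a \<in> vecs V" "b \<in> vecs V" "c \<in> vecs V"
  shows "(\<Sum>n\<in>N. cscale V (cinner V a (\<theta> n b)) (conj_rep G g \<theta> n c)) = 0"
  using schur_orthogonality_inequivalent[OF group_GN irreducible_\<theta> irreducible_conj_rep[OF assms(1)]
      conj_rep_not_equiv[OF assms(1,2)] assms(3-5)] by simp

text \<open>Conjugation by \<open>g\<close> is implemented by \<open>\<xi> g\<close>, because
  \<open>\<xi>\<close> is multiplicative on \<open>I\<close> and agrees with \<open>\<theta>\<close>
  on \<open>N\<close>. This reduces averages against conjugates to averages against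
  \<open>\<theta>\<close>.\<close>

lemma conj_rep_inside:
  assumes "g \<in> I" "n \<in> N" "c \<in> vecs V"
  shows "conj_rep G g \<theta> n c = \<xi> (inv g) (\<theta> n (\<xi> g c))"
proof -
  have "conj_rep G g \<theta> n c = \<xi> (inv g \<otimes> n \<otimes> g) c"
    using assms conj_in_N I_sub \<xi>_extends by (simp add: conj_rep_def)
  also have "\<dots> = \<xi> (inv g) (\<xi> n (\<xi> g c))"
    using assms I_inv I_mult N_I \<xi>D(3) by (simp add: \<xi>D(8))
  finally show ?thesis using assms \<xi>_extends \<xi>D(3) by simp
qed

lemma average_conj_inside:
  assumes g: "g \<in> I" and abc: "a \<in> vecs V" "b \<in> vecs V" "c \<in> vecs V"
  shows "(\<Sum>n\<in>N. cscale V (cinner V a (\<theta> n b)) (conj_rep G g \<theta> n c))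
         = cscale V (dN * cinner V (\<xi> g c) b) (\<xi> (inv g) a)"
proof -
  have gi: "inv g \<in> I" using g by (rule I_inv)
  have \<xi>c: "\<xi> g c \<in> vecs V" using g abc \<xi>D(3) by blast
  have "(\<Sum>n\<in>N. cscale V (cinner V a (\<theta> n b)) (conj_rep G g \<theta> n c))
      = (\<Sum>n\<in>N. \<xi> (inv g) (cscale V (cinner V a (\<theta> n b)) (\<theta> n (\<xi> g c))))"
    using conj_rep_inside[OF g _ abc(3)] \<xi>D(5)[OF gi] \<theta>D(3) \<xi>c by (intro sum.cong) auto
  also have "\<dots> = \<xi> (inv g) (\<Sum>n\<in>N. cscale V (cinner V a (\<theta> n b)) (\<theta> n (\<xi> g c)))"
    using \<theta>D(3) \<xi>c by (intro linear_map_sum[OF fd fd \<xi>D(2)[OF gi], symmetric]) (auto intro: vecs_scale)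
  also have "\<dots> = \<xi> (inv g) (cscale V (dN * cinner V (\<xi> g c) b) a)"
    using average_\<theta>[OF abc(1,2) \<xi>c] by simp
  finally show ?thesis using \<xi>D(5)[OF gi abc(1)] by simp
qed

end

section \<open>Group algebras\<close>

lemma cring_complex_ring: "cring complex_ring"
proof (rule cringI)
  show "abelian_group complex_ring"
  proof (rule abelian_groupI)
    fix x assume "x \<in> carrier complex_ring"
    show "\<exists>y\<in>carrier complex_ring. y \<oplus>\<^bsub>complex_ring\<^esub> x = \<zero>\<^bsub>complex_ring\<^esub>"
      by (rule bexI[of _ "- x"]) (auto simp: complex_ring_def)
  qed (auto simp: complex_ring_def)
  show "comm_monoid complex_ring"
    by (rule comm_monoidI) (auto simp: complex_ring_def)
qed (auto simp: complex_ring_def algebra_simps)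

lemma group_algebra_simps:
  "carrier (group_algebra H) = {f. \<forall>x. x \<notin> carrier H \<longrightarrow> f x = 0}"
  "f \<otimes>\<^bsub>group_algebra H\<^esub> f' = convolution H f f'"
  "\<one>\<^bsub>group_algebra H\<^esub> = (\<lambda>x. if x = \<one>\<^bsub>H\<^esub> then 1 else 0)"
  "\<zero>\<^bsub>group_algebra H\<^esub> = (\<lambda>x. 0)"
  "f \<oplus>\<^bsub>group_algebra H\<^esub> f' = (\<lambda>x. f x + f' x)"
  "c \<odot>\<^bsub>group_algebra H\<^esub> f = (\<lambda>x. c * f x)"
  by (simp_all add: group_algebra_def)

section \<open>Convolution on a group, and transport of algebra structures\<close>

context group
begin

lemma convolution_one_left:
  assumes "finite (carrier G)" "x \<in> carrier G"
  shows "convolution G (\<lambda>x. if x = \<one> then 1 else 0) f x = f x"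
proof -
  have "convolution G (\<lambda>x. if x = \<one> then 1 else 0) f x
      = (\<Sum>h\<in>carrier G. if h = inv x then f x else 0)"
    unfolding convolution_def using assms(2) inv_equality[of _ x] inv_solve_right[of \<one> x]
    by (auto intro!: sum.cong simp: r_inv) (metis inv_equality inv_inv r_inv inv_closed)
  then show ?thesis using assms by simp
qed

lemma convolution_commute:
  assumes "comm_group G"
  shows "convolution G f f' = convolution G f' f"
proof
  fix x
  interpret comm_group G by fact
  have "(\<Sum>h\<in>carrier G. f (x \<otimes> h) * f' (inv h)) = (\<Sum>h\<in>carrier G. f' (x \<otimes> h) * f (inv h))"
    if x: "x \<in> carrier G"
  \<comment> \<open>In a commutative group \<open>h\<close> -> \<open>inv (x \<otimes> h)\<close> is
    an involution that exchanges the arguments \<open>x \<otimes> h\<close> and \<open>inv h\<close>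
    of the two functions.\<close>
  proof (rule sum.reindex_bij_witness[of _ "\<lambda>h. inv (x \<otimes> h)" "\<lambda>h. inv (x \<otimes> h)"])
    fix h assume h: "h \<in> carrier G"
    have "x \<otimes> (inv x \<otimes> inv h) = inv h" using x h by (simp add: m_assoc[symmetric])
    then have e: "x \<otimes> inv (x \<otimes> h) = inv h" using x h by (simp add: inv_mult)
    show "inv (x \<otimes> inv (x \<otimes> h)) = h" "inv (x \<otimes> inv (x \<otimes> h)) = h" using e h by auto
    show "inv (x \<otimes> h) \<in> carrier G" "inv (x \<otimes> h) \<in> carrier G" using x h by auto
    show "f' (x \<otimes> inv (x \<otimes> h)) * f (inv (inv (x \<otimes> h))) = f (x \<otimes> h) * f' (inv h)"
      using x h e by simp
  qed
  then show "convolution G f f' x = convolution G f' f x" by (simp add: convolution_def)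
qed

lemma convolution_assoc:
  "convolution G (convolution G f f') f'' = convolution G f (convolution G f' f'')"
proof
  fix x
  show "convolution G (convolution G f f') f'' x = convolution G f (convolution G f' f'') x"
  proof (cases "x \<in> carrier G")
    case x: True
    \<comment> \<open>Replacing \<open>l\<close> by \<open>k \<otimes> l\<close> moves
      \<open>k\<close> from the argument of \<open>f\<close> to that of \<open>f'\<close>, after
      which the two summations can be exchanged.\<close>
    have inner: "(\<Sum>l\<in>carrier G. f (x \<otimes> k \<otimes> l) * f' (inv l)) = (\<Sum>l\<in>carrier G. f (x \<otimes> l) * f' (inv l \<otimes> k))"
      if k: "k \<in> carrier G" for k
    proof -
      have "(\<Sum>l\<in>carrier G. f (x \<otimes> l) * f' (inv l \<otimes> k))
          = (\<Sum>l\<in>carrier G. f (x \<otimes> (k \<otimes> l)) * f' (inv (k \<otimes> l) \<otimes> k))"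
        by (rule sum_translate(1)[OF k, symmetric])
      also have "\<dots> = (\<Sum>l\<in>carrier G. f (x \<otimes> k \<otimes> l) * f' (inv l))"
        using x k by (intro sum.cong refl) (simp add: inv_mult_group m_assoc)
      finally show ?thesis ..
    qed
    have "convolution G (convolution G f f') f'' x
        = (\<Sum>k\<in>carrier G. \<Sum>l\<in>carrier G. f (x \<otimes> l) * f' (inv l \<otimes> k) * f'' (inv k))"
      using x by (simp add: convolution_def inner sum_distrib_right)
    also have "\<dots> = (\<Sum>l\<in>carrier G. \<Sum>k\<in>carrier G. f (x \<otimes> l) * f' (inv l \<otimes> k) * f'' (inv k))"
      by (rule sum.swap)
    also have "\<dots> = convolution G f (convolution G f' f'') x"
      using x by (simp add: convolution_def sum_distrib_left mult.assoc)
    finally show ?thesis .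
  qed (simp add: convolution_def)
qed

end

lemma cring_group_algebra:
  assumes "comm_group H" "finite (carrier H)"
  shows "cring (group_algebra H)"
proof (rule cringI)
  interpret comm_group H by fact
  show "abelian_group (group_algebra H)"
  proof (rule abelian_groupI)
    fix x assume "x \<in> carrier (group_algebra H)"
    then show "\<exists>y\<in>carrier (group_algebra H). y \<oplus>\<^bsub>group_algebra H\<^esub> x = \<zero>\<^bsub>group_algebra H\<^esub>"
      by (intro bexI[of _ "\<lambda>z. - x z"]) (auto simp: group_algebra_simps)
  qed (auto simp: group_algebra_simps)
  show "comm_monoid (group_algebra H)"
  proof (rule comm_monoidI)
    fix x assume x: "x \<in> carrier (group_algebra H)"
    show "\<one>\<^bsub>group_algebra H\<^esub> \<otimes>\<^bsub>group_algebra H\<^esub> x = x"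
    proof
      fix z
      show "(\<one>\<^bsub>group_algebra H\<^esub> \<otimes>\<^bsub>group_algebra H\<^esub> x) z = x z"
        using x convolution_one_left[OF assms(2), of z x]
        by (cases "z \<in> carrier H") (auto simp: group_algebra_simps convolution_def)
    qed
  next
    fix x y
    show "x \<otimes>\<^bsub>group_algebra H\<^esub> y = y \<otimes>\<^bsub>group_algebra H\<^esub> x"
      unfolding group_algebra_simps by (rule convolution_commute[OF assms(1)])
  qed (auto simp: group_algebra_simps convolution_assoc, simp add: convolution_def)
qed (auto simp: group_algebra_simps convolution_def fun_eq_iff sum.distrib algebra_simps)

lemma algebra_group_algebra:
  assumes "comm_group H" "finite (carrier H)"
  shows "algebra complex_ring (group_algebra H)"
proof -
  interpret A: cring "group_algebra H" by (rule cring_group_algebra[OF assms])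
  show ?thesis
    by (rule algebraI[OF cring_complex_ring A.cring_axioms])
      (auto simp: group_algebra_simps complex_ring_def convolution_def fun_eq_iff algebra_simps sum_distrib_left)
qed

text \<open>The target is only assumed to carry the operations: its ring axioms are transported along the map.\<close>

lemma algebra_transport:
  assumes A: "algebra R A"
    and hom: "T \<in> ring_hom A B" and bij: "bij_betw T (carrier A) (carrier B)"
    and zero: "T \<zero>\<^bsub>A\<^esub> = \<zero>\<^bsub>B\<^esub>"
    and smult: "\<And>c x. \<lbrakk>c \<in> carrier R; x \<in> carrier A\<rbrakk> \<Longrightarrow> T (c \<odot>\<^bsub>A\<^esub> x) = c \<odot>\<^bsub>B\<^esub> T x"
  shows "algebra R B"
proof -
  interpret A: algebra R A by fact
  have iso: "T \<in> ring_iso A B" using hom bij by (simp add: ring_iso_def)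
  \<comment> \<open>A ring homomorphism is only required to respect sums, products and the unit, so
    the ring structure is first obtained with the image of zero as zero; the hypothesis
    \<open>zero\<close> identifies it with that of \<open>B\<close>.\<close>
  have "cring (B\<lparr>zero := T \<zero>\<^bsub>A\<^esub>\<rparr>)" by (rule A.ring_iso_imp_img_cring[OF iso])
  then have B: "cring B" using zero by simp
  note h = ring_hom_add[OF hom] ring_hom_mult[OF hom] ring_hom_closed[OF hom]
  have surj: "\<exists>x'\<in>carrier A. x = T x'" if "x \<in> carrier B" for x
    using bij that by (auto simp: bij_betw_def)
  show ?thesis
  proof (rule algebraI[OF A.R.cring_axioms B])
    fix a x assume "a \<in> carrier R" "x \<in> carrier B"
    moreover obtain x' where "x' \<in> carrier A" "x = T x'" using surj calculation by blast
    ultimately show "a \<odot>\<^bsub>B\<^esub> x \<in> carrier B"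
      using smult[of a x'] h(3)[OF A.smult_closed] by metis
  next
    fix a b x assume *: "a \<in> carrier R" "b \<in> carrier R" "x \<in> carrier B"
    then obtain x' where x: "x' \<in> carrier A" "x = T x'" using surj by blast
    show "(a \<oplus>\<^bsub>R\<^esub> b) \<odot>\<^bsub>B\<^esub> x = a \<odot>\<^bsub>B\<^esub> x \<oplus>\<^bsub>B\<^esub> b \<odot>\<^bsub>B\<^esub> x"
      using * x smult[of "a \<oplus>\<^bsub>R\<^esub> b" x'] smult[of a x'] smult[of b x'] A.smult_l_distr[of a b x']
        h(1)[OF A.smult_closed A.smult_closed, of a x' b x'] by simp
    show "(a \<otimes>\<^bsub>R\<^esub> b) \<odot>\<^bsub>B\<^esub> x = a \<odot>\<^bsub>B\<^esub> (b \<odot>\<^bsub>B\<^esub> x)"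
      using * x smult[of "a \<otimes>\<^bsub>R\<^esub> b" x'] smult[of a "b \<odot>\<^bsub>A\<^esub> x'"] smult[of b x']
        A.smult_assoc1[of a b x'] by simp
  next
    fix a x y assume *: "a \<in> carrier R" "x \<in> carrier B" "y \<in> carrier B"
    then obtain x' y' where x: "x' \<in> carrier A" "x = T x'" "y' \<in> carrier A" "y = T y'"
      using surj by blast
    show "a \<odot>\<^bsub>B\<^esub> (x \<oplus>\<^bsub>B\<^esub> y) = a \<odot>\<^bsub>B\<^esub> x \<oplus>\<^bsub>B\<^esub> a \<odot>\<^bsub>B\<^esub> y"
      using * x smult[of a "x' \<oplus>\<^bsub>A\<^esub> y'"] smult[of a x'] smult[of a y'] A.smult_r_distr[of a x' y']
        h(1)[OF A.smult_closed A.smult_closed, of a x' a y'] h(1)[of x' y'] by simp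
    show "(a \<odot>\<^bsub>B\<^esub> x) \<otimes>\<^bsub>B\<^esub> y = a \<odot>\<^bsub>B\<^esub> (x \<otimes>\<^bsub>B\<^esub> y)"
      using * x smult[of a "x' \<otimes>\<^bsub>A\<^esub> y'"] smult[of a x'] A.smult_assoc2[of a x' y']
        h(2)[OF A.smult_closed, of a x' y'] h(2)[of x' y'] by simp
  next
    fix x assume *: "x \<in> carrier B"
    then obtain x' where x: "x' \<in> carrier A" "x = T x'" using surj by blast
    then show "\<one>\<^bsub>R\<^esub> \<odot>\<^bsub>B\<^esub> x = x"
      using smult[of "\<one>\<^bsub>R\<^esub>" x'] A.smult_one[of x'] by simp
  qed
qed

section \<open>The Hecke algebra\<close>

locale hecke_extension = inertia_extension N G V \<theta> \<xi>
  for N and G :: "('g, 'm) monoid_scheme" (structure)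
    and V :: "'v::ab_group_add cips" and \<theta> \<xi> :: "'g \<Rightarrow> 'v \<Rightarrow> 'v" +
  fixes v :: 'v
  assumes v_vecs: "v \<in> vecs V" and v_unit: "cinner V v v = 1"
begin

abbreviation "\<Psi> \<equiv> coefficient I V \<xi> v"
abbreviation "\<psi> \<equiv> hecke_idem N V \<theta> v"

lemma \<Psi>_eq: "h \<in> I \<Longrightarrow> \<Psi> h = cinner V v (\<xi> h v)"
  by (simp add: coefficient_def)

lemma \<Psi>_outside: "h \<notin> I \<Longrightarrow> \<Psi> h = 0"
  by (simp add: coefficient_def)

lemma \<psi>_eq: "n \<in> N \<Longrightarrow> \<psi> n = cinner V v (\<theta> n v) / dN"
  by (simp add: hecke_idem_def coefficient_def)

lemma \<psi>_outside: "n \<notin> N \<Longrightarrow> \<psi> n = 0"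
  by (simp add: hecke_idem_def coefficient_def)

lemma \<xi>v: "h \<in> I \<Longrightarrow> \<xi> h v \<in> vecs V"
  using \<xi>D(3) v_vecs by blast

text \<open>Moving \<open>\<xi> h\<close> and \<open>\<xi> (inv n)\<close> across the inner product
  turns both factors into matrix coefficients of \<open>\<theta>\<close> at \<open>n\<close>. Schur
  orthogonality then contributes \<open>dN\<close>, the norm of \<open>v\<close> being 1. This is
  the reproducing property of \<open>\<Psi>\<close> on which the Hecke algebra computations
  rest.\<close>

lemma average_\<Psi>:
  assumes h: "h \<in> I" and k: "k \<in> I"
  shows "(\<Sum>n\<in>N. \<Psi> (h \<otimes> n) * \<Psi> (inv n \<otimes> k)) = dN * \<Psi> (h \<otimes> k)"
proof -
  have hi: "inv h \<in> I" using h by (rule I_inv)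
  have 1: "\<Psi> (h \<otimes> n) = cinner V (\<xi> (inv h) v) (\<theta> n v)" if n: "n \<in> N" for n
    using \<xi>_adjoint(2)[OF h v_vecs, of "\<xi> n v"] h n N_I \<xi>v v_vecs
    by (simp add: \<Psi>_eq I_mult \<xi>D(8) \<xi>_extends \<theta>D(3))
  have 2: "\<Psi> (inv n \<otimes> k) = cinner V (\<theta> n v) (\<xi> k v)" if n: "n \<in> N" for n
    using \<xi>_adjoint(1)[OF N_I[OF n] v_vecs \<xi>v[OF k]] k n N_I v_vecs
    by (simp add: \<Psi>_eq I_mult I_inv \<xi>D(8) \<xi>_extends)
  have "(\<Sum>n\<in>N. \<Psi> (h \<otimes> n) * \<Psi> (inv n \<otimes> k))
      = (\<Sum>n\<in>N. cinner V (\<xi> (inv h) v) (\<theta> n v) * cinner V (\<theta> n v) (\<xi> k v))"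
    by (intro sum.cong) (simp_all add: 1 2)
  also have "\<dots> = dN * cinner V (\<xi> (inv h) v) (\<xi> k v)"
    using inner_average_\<theta>[OF \<xi>v[OF hi] v_vecs v_vecs \<xi>v[OF k]] v_unit by simp
  also have "cinner V (\<xi> (inv h) v) (\<xi> k v) = \<Psi> (h \<otimes> k)"
    using \<xi>_adjoint(2)[OF h v_vecs \<xi>v[OF k]] h k v_vecs by (simp add: \<Psi>_eq I_mult \<xi>D(8))
  finally show ?thesis .
qed

text \<open>If two of \<open>g\<close>, \<open>h\<close>, \<open>g \<otimes> h\<close> lie in the
  subgroup \<open>I\<close>, so does the third; hence no term from outside \<open>I\<close>
  survives.\<close>

lemma convolution_supported_on_I:
  assumes "\<And>g. g \<notin> I \<Longrightarrow> F g = 0" "\<And>g. g \<notin> I \<Longrightarrow> F' g = 0"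
  shows "convolution G F F' g = (if g \<in> I then \<Sum>h\<in>I. F (g \<otimes> h) * F' (inv h) else 0)"
proof (cases "g \<in> carrier G")
  case g: True
  have zero: "F (g \<otimes> h) * F' (inv h) = 0" if h: "h \<in> carrier G" "h \<notin> I \<or> g \<notin> I" for h
  proof (cases "inv h \<in> I")
    case True
    then have "h \<in> I" using I_inv[OF True] h by simp
    then have "g \<otimes> h \<notin> I" using h(2) I_mult[of "g \<otimes> h" "inv h"] True g h(1)
      by (auto simp: m_assoc)
    then show ?thesis using assms(1) by simp
  qed (use assms(2) in simp)
  have "convolution G F F' g = (\<Sum>h\<in>carrier G. F (g \<otimes> h) * F' (inv h))"
    using g by (simp add: convolution_def)
  also have "\<dots> = (if g \<in> I then \<Sum>h\<in>I. F (g \<otimes> h) * F' (inv h) else 0)"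
    using zero finite_G I_sub by (auto intro!: sum.neutral sum.mono_neutral_right)
  finally show ?thesis .
qed (use I_sub in \<open>auto simp: convolution_def\<close>)

text \<open>Inflated functions are constant on cosets of \<open>N\<close>, so averaging over
  \<open>N\<close> only affects the two copies of \<open>\<Psi>\<close>, and
  \<open>average_\<Psi>\<close> merges them into \<open>dN\<close> times one. For
  \<open>a = b\<close> the constant reproduces itself exactly when it is 0 or 1 /
  \<open>dN\<close>.\<close>

lemma infl_map_convolution:
  "convolution G (infl_map G N \<Psi> a f) (infl_map G N \<Psi> b f')
   = infl_map G N \<Psi> (a * b * dN) (convolution Q f f')"
proof
  fix g
  let ?S = "\<lambda>h. f (q (g \<otimes> h)) * f' (q (inv h))"
  show "convolution G (infl_map G N \<Psi> a f) (infl_map G N \<Psi> b f') g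
      = infl_map G N \<Psi> (a * b * dN) (convolution Q f f') g"
  proof (cases "g \<in> I")
    case g: True
    have step: "(\<Sum>n\<in>N. ?S (h \<otimes> n) * (\<Psi> (g \<otimes> (h \<otimes> n)) * \<Psi> (inv (h \<otimes> n)))) = ?S h * dN * \<Psi> g"
      if h: "h \<in> I" for h
    proof -
      have "(\<Sum>n\<in>N. ?S (h \<otimes> n) * (\<Psi> (g \<otimes> (h \<otimes> n)) * \<Psi> (inv (h \<otimes> n))))
          = (\<Sum>n\<in>N. ?S h * (\<Psi> (g \<otimes> h \<otimes> n) * \<Psi> (inv n \<otimes> inv h)))"
      proof (rule sum.cong[OF refl])
        fix n assume n: "n \<in> N"
        have "q (inv (h \<otimes> n)) = q (inv h)" "q (g \<otimes> (h \<otimes> n)) = q (g \<otimes> h)"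
          using g h n N_I q_mult_N q_inv q_mult by (auto simp: I_mult)
        moreover have "g \<otimes> (h \<otimes> n) = g \<otimes> h \<otimes> n" "inv (h \<otimes> n) = inv n \<otimes> inv h"
          using g h n I_sub N_I by (auto simp: m_assoc inv_mult_group)
        ultimately show "?S (h \<otimes> n) * (\<Psi> (g \<otimes> (h \<otimes> n)) * \<Psi> (inv (h \<otimes> n)))
            = ?S h * (\<Psi> (g \<otimes> h \<otimes> n) * \<Psi> (inv n \<otimes> inv h))" by metis
      qed
      also have "\<dots> = ?S h * (dN * \<Psi> (g \<otimes> h \<otimes> inv h))"
        using average_\<Psi>[of "g \<otimes> h" "inv h"] g h by (simp only: sum_distrib_left[symmetric] I_mult I_inv)
      also have "g \<otimes> h \<otimes> inv h = g" using g h I_sub by (simp add: m_assoc)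
      finally show ?thesis by simp
    qed
    have "convolution G (infl_map G N \<Psi> a f) (infl_map G N \<Psi> b f') g
        = a * b * (\<Sum>h\<in>I. ?S h * (\<Psi> (g \<otimes> h) * \<Psi> (inv h)))"
      using g by (subst convolution_supported_on_I)
        (auto simp: infl_map_def infl_def \<Psi>_outside sum_distrib_left mult_ac)
    \<comment> \<open>An average over \<open>N\<close> is inserted so that \<open>step\<close>
      applies. Its denominator \<open>card N\<close> cancels against the \<open>card N\<close>
      elements of \<open>I\<close> above each point of the quotient.\<close>
    also have "(\<Sum>h\<in>I. ?S h * (\<Psi> (g \<otimes> h) * \<Psi> (inv h)))
        = (\<Sum>h\<in>I. \<Sum>n\<in>N. ?S (h \<otimes> n) * (\<Psi> (g \<otimes> (h \<otimes> n)) * \<Psi> (inv (h \<otimes> n)))) / of_nat (card N)"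
      using card_N_pos by (subst sum_I_average) simp
    also have "\<dots> = (\<Sum>h\<in>I. ?S h) * dN * \<Psi> g / of_nat (card N)"
      by (simp only: step sum_distrib_right cong: sum.cong)
    also have "(\<Sum>h\<in>I. ?S h) = (\<Sum>h\<in>I. f (q g \<otimes>\<^bsub>Q\<^esub> q h) * f' (inv\<^bsub>Q\<^esub> q h))"
      using g by (intro sum.cong) (auto simp: q_mult q_inv)
    also have "\<dots> = of_nat (card N) * convolution Q f f' (q g)"
      using g by (simp add: sum_over_cosets[of "\<lambda>C. f (q g \<otimes>\<^bsub>Q\<^esub> C) * f' (inv\<^bsub>Q\<^esub> C)"] convolution_def)
    finally have *: "convolution G (infl_map G N \<Psi> a f) (infl_map G N \<Psi> b f') g
        = a * b * (of_nat (card N) * convolution Q f f' (q g) * dN * \<Psi> g / of_nat (card N))" .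
    show ?thesis unfolding * using card_N_pos by (simp add: infl_map_def infl_def)
  next
    case False
    then show ?thesis
      by (subst convolution_supported_on_I) (auto simp: infl_map_def \<Psi>_outside)
  qed
qed

lemma infl_map_one:
  "infl_map G N \<Psi> (1 / dN) (\<lambda>x. if x = \<one>\<^bsub>Q\<^esub> then 1 else 0) = \<psi>"
proof
  fix g
  show "infl_map G N \<Psi> (1 / dN) (\<lambda>x. if x = \<one>\<^bsub>Q\<^esub> then 1 else 0) g = \<psi> g"
    using q_eq_one_iff[of g] N_I[of g] \<xi>_extends[OF _ v_vecs, of g]
    by (cases "g \<in> I"; cases "g \<in> N")
      (auto simp: infl_map_def infl_def one_Q \<psi>_outside \<Psi>_outside \<psi>_eq \<Psi>_eq)
qed

text \<open>If \<open>\<Psi>\<close> vanished on the whole coset, \<open>average_\<Psi>\<close> with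
  \<open>k = inv h\<close> would give \<open>\<Psi> \<one> = 0\<close>, whereas this value is <v, v>
  = 1. Thus a function on the quotient can be recovered from its product with
  \<open>\<Psi>\<close>.\<close>

lemma \<Psi>_coset_nonzero:
  assumes h: "h \<in> I"
  shows "\<exists>n\<in>N. \<Psi> (h \<otimes> n) \<noteq> 0"
proof (rule ccontr)
  assume "\<not> ?thesis"
  then have "(\<Sum>n\<in>N. \<Psi> (h \<otimes> n) * \<Psi> (inv n \<otimes> inv h)) = 0" by simp
  moreover have "\<Psi> (h \<otimes> inv h) = 1"
    using h I_sub I_one \<xi>D(7) v_vecs v_unit by (simp add: \<Psi>_eq)
  ultimately show False using average_\<Psi>[OF h I_inv[OF h]] dN_nonzero by simp
qed

lemma inj_infl_map:
  assumes "c \<noteq> 0"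
  shows "inj_on (infl_map G N \<Psi> c) (carrier (group_algebra Q))"
proof (rule inj_onI)
  fix f f' assume f: "f \<in> carrier (group_algebra Q)" "f' \<in> carrier (group_algebra Q)"
    and eq: "infl_map G N \<Psi> c f = infl_map G N \<Psi> c f'"
  show "f = f'"
  proof
    fix C
    show "f C = f' C"
    proof (cases "C \<in> carrier Q")
      case True
      then obtain h where h: "h \<in> I" "C = q h" by (auto simp: carrier_Q)
      obtain n where n: "n \<in> N" "\<Psi> (h \<otimes> n) \<noteq> 0" using \<Psi>_coset_nonzero[OF h(1)] by blast
      show ?thesis using fun_cong[OF eq, of "h \<otimes> n"] n h assms
        by (simp add: infl_map_def infl_def q_mult_N)
    qed (use f in \<open>auto simp: group_algebra_simps\<close>)
  qed
qed

section \<open>Two-sided convolution with the idempotent and the carrier of the Hecke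
  algebra\<close>

lemma convolution_\<psi>_left:
  assumes "x \<in> carrier G"
  shows "convolution G \<psi> F x = (\<Sum>n\<in>N. \<psi> n * F (inv n \<otimes> x))"
proof -
  have "convolution G \<psi> F x = (\<Sum>h\<in>carrier G. \<psi> (x \<otimes> h) * F (inv h))"
    using assms by (simp add: convolution_def)
  also have "\<dots> = (\<Sum>h\<in>carrier G. \<psi> h * F (inv h \<otimes> x))"
    using assms sum_translate(1)[OF assms, of "\<lambda>h. \<psi> h * F (inv h \<otimes> x)"]
    by (simp add: inv_mult_group m_assoc cong: sum.cong)
  also have "\<dots> = (\<Sum>n\<in>N. \<psi> n * F (inv n \<otimes> x))"
    using finite_G subset \<psi>_outside by (intro sum.mono_neutral_right) auto
  finally show ?thesis .
qed

lemma convolution_\<psi>_right: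
  assumes "x \<in> carrier G"
  shows "convolution G F \<psi> x = (\<Sum>n\<in>N. F (x \<otimes> n) * \<psi> (inv n))"
proof -
  have "\<psi> (inv h) = 0" if "h \<in> carrier G" "h \<notin> N" for h
    using \<psi>_outside[of "inv h"] that subgroup.m_inv_closed[OF subgroup_axioms, of "inv h"] by auto
  then show ?thesis
    using assms finite_G subset unfolding convolution_def
    by (auto intro!: sum.mono_neutral_right)
qed

text \<open>On a coset of \<open>N\<close> inside \<open>I\<close> the operation is the orthogonal
  projection onto the multiples of \<open>\<Psi>\<close>; on all other cosets it is zero. The sum on
  the right depends only on the coset of \<open>x\<close>, so fixed functions are
  \<open>\<Psi>\<close> times something inflated from the quotient.\<close>

lemma hecke_projection:
  assumes x: "x \<in> carrier G"
  shows "convolution G (convolution G \<psi> F) \<psi> x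
         = (if x \<in> I then \<Psi> x * (\<Sum>p\<in>N. F (x \<otimes> p) * cnj (\<Psi> (x \<otimes> p))) / dN else 0)"
proof -
  have "convolution G (convolution G \<psi> F) \<psi> x
      = (\<Sum>m\<in>N. (\<Sum>n\<in>N. \<psi> n * F (inv n \<otimes> (x \<otimes> m))) * \<psi> (inv m))"
    using x N_sub by (simp add: convolution_\<psi>_right convolution_\<psi>_left)
  also have "\<dots> = (\<Sum>n\<in>N. \<Sum>m\<in>N. \<psi> n * F (inv n \<otimes> (x \<otimes> m)) * \<psi> (inv m))"
    by (subst sum.swap) (simp add: sum_distrib_right)
  also have "\<dots> = (\<Sum>n\<in>N. \<Sum>p\<in>N. \<psi> n * F (x \<otimes> p) * \<psi> (inv p \<otimes> (inv x \<otimes> inv n \<otimes> x)))"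
  proof (rule sum.cong[OF refl])
    fix n assume n: "n \<in> N"
    \<comment> \<open>Substituting \<open>m = ?c \<otimes> p\<close> turns the argument of
      \<open>F\<close> into \<open>x \<otimes> p\<close>, free of \<open>n\<close>; all dependence
      on \<open>n\<close> is then in the two values of \<open>\<psi>\<close>.\<close>
    let ?c = "inv x \<otimes> n \<otimes> x"
    have c: "?c \<in> carrier GN" using conj_in_N[OF x n] by simp
    have e: "inv n \<otimes> (x \<otimes> (?c \<otimes> p)) = x \<otimes> p" "inv (?c \<otimes> p) = inv p \<otimes> (inv x \<otimes> inv n \<otimes> x)"
      if p: "p \<in> N" for p
    proof -
      have "x \<otimes> (inv x \<otimes> (n \<otimes> (x \<otimes> p))) = n \<otimes> (x \<otimes> p)"
        "inv n \<otimes> (n \<otimes> (x \<otimes> p)) = x \<otimes> p"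
        using x N_sub[OF n] N_sub[OF p] by (simp_all add: m_assoc[symmetric])
      then show "inv n \<otimes> (x \<otimes> (?c \<otimes> p)) = x \<otimes> p"
        using x N_sub[OF n] N_sub[OF p] by (simp add: m_assoc)
      show "inv (?c \<otimes> p) = inv p \<otimes> (inv x \<otimes> inv n \<otimes> x)"
        using x N_sub[OF n] N_sub[OF p] by (simp add: m_assoc inv_mult_group)
    qed
    show "(\<Sum>m\<in>N. \<psi> n * F (inv n \<otimes> (x \<otimes> m)) * \<psi> (inv m))
        = (\<Sum>p\<in>N. \<psi> n * F (x \<otimes> p) * \<psi> (inv p \<otimes> (inv x \<otimes> inv n \<otimes> x)))"
      using group.sum_translate(1)[OF group_GN c, of "\<lambda>m. \<psi> n * F (inv n \<otimes> (x \<otimes> m)) * \<psi> (inv m)"]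
      by (simp add: e cong: sum.cong)
  qed
  also have "\<dots> = (\<Sum>p\<in>N. \<Sum>n\<in>N. \<psi> n * F (x \<otimes> p) * \<psi> (inv p \<otimes> (inv x \<otimes> inv n \<otimes> x)))"
    by (rule sum.swap)
  also have "\<dots> = (\<Sum>p\<in>N. F (x \<otimes> p) / dN / dN *
      cinner V (\<Sum>n\<in>N. cscale V (cinner V v (\<theta> n v)) (conj_rep G x \<theta> n (\<theta> p v))) v)"
  proof (rule sum.cong[OF refl])
    fix p assume p: "p \<in> N"
    note cr = unitary_repD[OF unitary_conj_rep[OF x], simplified]
    have pv: "\<theta> p v \<in> vecs V" using p v_vecs by (rule \<theta>D(3))
    \<comment> \<open>Up to the factor 1 / \<open>dN\<close>, the second value of
      \<open>\<psi>\<close> is a matrix coefficient of the conjugate of \<open>\<theta>\<close> by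
      \<open>x\<close>. The sum over \<open>n\<close> thus pairs coefficients of
      \<open>\<theta>\<close> with coefficients of its conjugate.\<close>
    have \<psi>_term: "\<psi> (inv p \<otimes> (inv x \<otimes> inv n \<otimes> x)) = cinner V (conj_rep G x \<theta> n (\<theta> p v)) v / dN"
      if n: "n \<in> N" for n
    proof -
      have ni: "inv n \<in> N" and pi: "inv p \<in> N" using n p by auto
      have ci: "inv x \<otimes> inv n \<otimes> x \<in> N" using conj_in_N[OF x ni] .
      have cv: "conj_rep G x \<theta> (inv n) v \<in> vecs V" using cr(3)[OF ni v_vecs] .
      have "\<theta> (inv p \<otimes> (inv x \<otimes> inv n \<otimes> x)) v = \<theta> (inv p) (conj_rep G x \<theta> (inv n) v)"
        using \<theta>D(8)[OF pi ci v_vecs] by (simp add: conj_rep_def)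
      then have "\<psi> (inv p \<otimes> (inv x \<otimes> inv n \<otimes> x)) = cinner V v (\<theta> (inv p) (conj_rep G x \<theta> (inv n) v)) / dN"
        using pi ci by (simp add: \<psi>_eq subgroup.m_closed[OF subgroup_axioms])
      also have "cinner V v (\<theta> (inv p) (conj_rep G x \<theta> (inv n) v)) = cinner V (\<theta> p v) (conj_rep G x \<theta> (inv n) v)"
        using unitary_rep_adjoint(1)[OF group_GN unitary_\<theta>, of p v "conj_rep G x \<theta> (inv n) v"] p v_vecs cv
        by (simp add: inv_GN)
      also have "\<dots> = cinner V (conj_rep G x \<theta> n (\<theta> p v)) v"
        using unitary_rep_adjoint(1)[OF group_GN unitary_conj_rep[OF x], of n "\<theta> p v" v] n pv v_vecs
        by (simp add: inv_GN)
      finally show ?thesis .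
    qed
    have "cinner V (\<Sum>n\<in>N. cscale V (cinner V v (\<theta> n v)) (conj_rep G x \<theta> n (\<theta> p v))) v
        = (\<Sum>n\<in>N. cinner V v (\<theta> n v) * cinner V (conj_rep G x \<theta> n (\<theta> p v)) v)"
      using cr(3) pv v_vecs by (subst inner_sum_left) (auto simp: inner_scale_left vecs_scale)
    then show "(\<Sum>n\<in>N. \<psi> n * F (x \<otimes> p) * \<psi> (inv p \<otimes> (inv x \<otimes> inv n \<otimes> x)))
        = F (x \<otimes> p) / dN / dN *
          cinner V (\<Sum>n\<in>N. cscale V (cinner V v (\<theta> n v)) (conj_rep G x \<theta> n (\<theta> p v))) v"
      by (simp add: \<psi>_term \<psi>_eq sum_distrib_left sum_divide_distrib mult_ac cong: sum.cong)
  qed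
  also have "\<dots> = (if x \<in> I then \<Psi> x * (\<Sum>p\<in>N. F (x \<otimes> p) * cnj (\<Psi> (x \<otimes> p))) / dN else 0)"
  proof (cases "x \<in> I")
    case xI: True
    have xi: "inv x \<in> I" using xI by (rule I_inv)
    have "cinner V (\<Sum>n\<in>N. cscale V (cinner V v (\<theta> n v)) (conj_rep G x \<theta> n (\<theta> p v))) v
        = dN * cnj (\<Psi> (x \<otimes> p)) * \<Psi> x" if p: "p \<in> N" for p
    proof -
      have pv: "\<theta> p v \<in> vecs V" using p v_vecs by (rule \<theta>D(3))
      have xp: "\<xi> x (\<theta> p v) = \<xi> (x \<otimes> p) v" "x \<otimes> p \<in> I"
        using \<xi>D(8)[OF xI N_I[OF p] v_vecs] \<xi>_extends[OF p v_vecs] I_mult[OF xI N_I[OF p]] by auto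
      have "cinner V (\<xi> (x \<otimes> p) v) v = cnj (\<Psi> (x \<otimes> p))"
        using inner_commute[OF v_vecs \<xi>v[OF xp(2)]] xp(2) by (simp add: \<Psi>_eq)
      moreover have "cinner V (\<xi> (inv x) v) v = \<Psi> x"
        using \<xi>_adjoint(2)[OF xI v_vecs v_vecs] xI by (simp add: \<Psi>_eq)
      ultimately show ?thesis
        using average_conj_inside[OF xI v_vecs v_vecs pv] v_vecs \<xi>v[OF xi] xp(1)
        by (simp add: inner_scale_left)
    qed
    then show ?thesis using xI dN_nonzero
      by (simp add: sum_distrib_left sum_divide_distrib mult_ac cong: sum.cong)
  next
    case False
    then show ?thesis using average_conj_outside[OF x False v_vecs v_vecs] \<theta>D(3) v_vecs
      by (simp cong: sum.cong)
  qed
  finally show ?thesis .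
qed

text \<open>The explicit projection formula exhibits every fixed function as an image. Conversely
  \<open>\<psi>\<close> is the image of the unit of the group algebra, so images are fixed by
  multiplicativity.\<close>

lemma carrier_hecke:
  "carrier (hecke_algebra G N \<psi>) = infl_map G N \<Psi> (1 / dN) ` carrier (group_algebra Q)"
proof
  show "carrier (hecke_algebra G N \<psi>) \<subseteq> infl_map G N \<Psi> (1 / dN) ` carrier (group_algebra Q)"
  proof
    fix F assume "F \<in> carrier (hecke_algebra G N \<psi>)"
    then have F: "\<And>x. x \<notin> carrier G \<Longrightarrow> F x = 0" "F = convolution G (convolution G \<psi> F) \<psi>"
      by (auto simp: hecke_algebra_def group_algebra_def)
    \<comment> \<open>The coefficient of the projection, summed over the coset itself so that no
      representative has to be chosen; it is 0 off the quotient, as \<open>group_algebra\<close>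
      demands.\<close>
    define f where "f C = (if C \<in> carrier Q then \<Sum>y\<in>C. F y * cnj (\<Psi> y) else 0)" for C
    have "F x = infl_map G N \<Psi> (1 / dN) f x" for x
    proof (cases "x \<in> carrier G")
      case x: True
      have "F x = (if x \<in> I then \<Psi> x * (\<Sum>p\<in>N. F (x \<otimes> p) * cnj (\<Psi> (x \<otimes> p))) / dN else 0)"
        using fun_cong[OF F(2), of x] hecke_projection[OF x, of F] by metis
      then show ?thesis
        using sum_q[OF x, of "\<lambda>y. F y * cnj (\<Psi> y)"]
        by (simp add: infl_map_def infl_def f_def \<Psi>_outside)
    next
      case False
      then have "x \<notin> I" using I_sub by blast
      then show ?thesis using F(1) False by (simp add: infl_map_def \<Psi>_outside)
    qed
    then have "F = infl_map G N \<Psi> (1 / dN) f" by blast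
    moreover have "f \<in> carrier (group_algebra Q)" by (simp add: group_algebra_simps f_def)
    ultimately show "F \<in> infl_map G N \<Psi> (1 / dN) ` carrier (group_algebra Q)" by blast
  qed
next
  show "infl_map G N \<Psi> (1 / dN) ` carrier (group_algebra Q) \<subseteq> carrier (hecke_algebra G N \<psi>)"
  proof (rule image_subsetI)
    fix f assume f: "f \<in> carrier (group_algebra Q)"
    let ?\<delta> = "\<lambda>x. if x = \<one>\<^bsub>Q\<^esub> then 1 else 0 :: complex"
    have l: "convolution Q ?\<delta> f = f"
    proof
      fix C
      show "convolution Q ?\<delta> f C = f C"
        using f group.convolution_one_left[OF group_Q finite_Q, of C f]
        by (cases "C \<in> carrier Q") (auto simp: convolution_def group_algebra_simps)
    qed
    \<comment> \<open>The quotient is not known to be commutative at this point, so the right unit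
      law does not follow from the left one.\<close>
    have r: "convolution Q f ?\<delta> = f"
    proof
      fix C
      interpret Q: group Q by (rule group_Q)
      have "(\<Sum>h\<in>carrier Q. f (C \<otimes>\<^bsub>Q\<^esub> h) * ?\<delta> (inv\<^bsub>Q\<^esub> h)) = f C" if C: "C \<in> carrier Q"
      proof -
        have "(\<Sum>h\<in>carrier Q. f (C \<otimes>\<^bsub>Q\<^esub> h) * ?\<delta> (inv\<^bsub>Q\<^esub> h))
            = (\<Sum>h\<in>carrier Q. if h = \<one>\<^bsub>Q\<^esub> then f C else 0)"
          using C by (intro sum.cong) (auto simp: Q.inv_eq_1_iff)
        then show ?thesis using finite_Q by simp
      qed
      then show "convolution Q f ?\<delta> C = f C" using f
        by (cases "C \<in> carrier Q") (auto simp: convolution_def group_algebra_simps)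
    qed
    have c: "1 / dN * (1 / dN) * dN = 1 / dN" using dN_nonzero by simp
    have "convolution G (convolution G \<psi> (infl_map G N \<Psi> (1 / dN) f)) \<psi> = infl_map G N \<Psi> (1 / dN) f"
      unfolding infl_map_one[symmetric] infl_map_convolution c l r ..
    then show "infl_map G N \<Psi> (1 / dN) f \<in> carrier (hecke_algebra G N \<psi>)"
      using I_sub by (auto simp: hecke_algebra_def group_algebra_def infl_map_def coefficient_def)
  qed
qed

section \<open>The algebra isomorphisms for both normalizations of convolution\<close>

lemma hecke_algebra_simps:
  "f \<otimes>\<^bsub>hecke_algebra G N \<psi>\<^esub> f' = convolution G f f'"
  "\<one>\<^bsub>hecke_algebra G N \<psi>\<^esub> = \<psi>"
  "\<zero>\<^bsub>hecke_algebra G N \<psi>\<^esub> = (\<lambda>x. 0)"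
  "f \<oplus>\<^bsub>hecke_algebra G N \<psi>\<^esub> f' = (\<lambda>x. f x + f' x)"
  "c \<odot>\<^bsub>hecke_algebra G N \<psi>\<^esub> f = (\<lambda>x. c * f x)"
  by (simp_all add: hecke_algebra_def group_algebra_def)

lemma infl_map_scale: "infl_map G N \<Psi> (a * b) f = infl_map G N \<Psi> a (\<lambda>x. b * f x)"
  by (simp add: infl_map_def infl_def fun_eq_iff)

lemma infl_map_algebra_iso:
  "infl_map G N \<Psi> (1 / dN) \<in> algebra_iso (group_algebra Q) (hecke_algebra G N \<psi>)"
proof -
  have c: "1 / dN * (1 / dN) * dN = 1 / dN" using dN_nonzero by simp
  have "infl_map G N \<Psi> (1 / dN) \<in> ring_hom (group_algebra Q) (hecke_algebra G N \<psi>)"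
  proof (rule ring_hom_memI)
    show "infl_map G N \<Psi> (1 / dN) f \<in> carrier (hecke_algebra G N \<psi>)"
      if "f \<in> carrier (group_algebra Q)" for f
      using that carrier_hecke by blast
  qed (auto simp: group_algebra_simps hecke_algebra_simps infl_map_one[simplified] infl_map_convolution c[simplified],
      auto simp: infl_map_def infl_def fun_eq_iff algebra_simps add_divide_distrib)
  moreover have "bij_betw (infl_map G N \<Psi> (1 / dN)) (carrier (group_algebra Q)) (carrier (hecke_algebra G N \<psi>))"
    unfolding bij_betw_def carrier_hecke by (intro conjI inj_infl_map refl) (use dN_nonzero in simp)
  ultimately show ?thesis
    unfolding algebra_iso_def ring_iso_def
    by (auto simp: group_algebra_simps hecke_algebra_simps, auto simp: infl_map_def infl_def fun_eq_iff)
qed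

text \<open>Multiplication by the inverse order of the quotient carries the normalized convolution
  to the ordinary one. Composing it with the previous isomorphism gives the factor, because the
  order of \<open>I\<close> is the order of \<open>N\<close> times that of the quotient.\<close>

lemma infl_map_normalized_algebra_iso:
  "infl_map G N \<Psi> (of_nat (cdim V) / of_nat (card I))
     \<in> algebra_iso (normalized_group_algebra Q) (hecke_algebra G N \<psi>)"
proof -
  let ?o = "of_nat (Coset.order Q) :: complex"
  let ?A = "group_algebra Q" and ?B = "normalized_group_algebra Q" and ?H = "hecke_algebra G N \<psi>"
  let ?T = "infl_map G N \<Psi> (1 / dN)" and ?S = "infl_map G N \<Psi> (of_nat (cdim V) / of_nat (card I))"
  have o: "?o \<noteq> 0"
    using finite_Q group.is_monoid[OF group_Q] by (auto simp: Coset.order_def dest: monoid.one_closed)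
  have d: "of_nat (cdim V) / of_nat (card I) = 1 / dN * (1 / ?o)"
    by (simp add: card_I Coset.order_def)
  have S: "?S f = ?T (\<lambda>x. 1 / ?o * f x)" for f
    unfolding d by (rule infl_map_scale)
  have T: "?T \<in> ring_hom ?A ?H" "bij_betw ?T (carrier ?A) (carrier ?H)"
    "\<And>c f. f \<in> carrier ?A \<Longrightarrow> ?T (c \<odot>\<^bsub>?A\<^esub> f) = c \<odot>\<^bsub>?H\<^esub> ?T f"
    using infl_map_algebra_iso unfolding algebra_iso_def ring_iso_def by auto
  have B: "carrier ?B = carrier ?A" "f \<otimes>\<^bsub>?B\<^esub> f' = (\<lambda>x. convolution Q f f' x / ?o)"
    "\<one>\<^bsub>?B\<^esub> = (\<lambda>x. if x = \<one>\<^bsub>Q\<^esub> then ?o else 0)" "f \<oplus>\<^bsub>?B\<^esub> f' = f \<oplus>\<^bsub>?A\<^esub> f'"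
    "c \<odot>\<^bsub>?B\<^esub> f = c \<odot>\<^bsub>?A\<^esub> f" for f f' c
    by (simp_all add: normalized_group_algebra_def group_algebra_def)
  have cl: "(\<lambda>x. 1 / ?o * f x) \<in> carrier ?A" if "f \<in> carrier ?A" for f
    using that by (simp add: group_algebra_simps)
  have "?S \<in> ring_hom ?B ?H"
  proof (rule ring_hom_memI)
    fix f assume f: "f \<in> carrier ?B"
    then show "?S f \<in> carrier ?H" unfolding S using ring_hom_closed[OF T(1) cl] B(1) by simp
    fix f' assume f': "f' \<in> carrier ?B"
    have "?S (f \<otimes>\<^bsub>?B\<^esub> f') = ?T ((\<lambda>x. 1 / ?o * f x) \<otimes>\<^bsub>?A\<^esub> (\<lambda>x. 1 / ?o * f' x))"
      unfolding S B(2) group_algebra_simps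
      by (rule arg_cong[where f = ?T])
        (simp add: convolution_def fun_eq_iff sum_divide_distrib mult_ac)
    then show "?S (f \<otimes>\<^bsub>?B\<^esub> f') = ?S f \<otimes>\<^bsub>?H\<^esub> ?S f'"
      using ring_hom_mult[OF T(1) cl cl] f f' B(1) S by simp
    have "?S (f \<oplus>\<^bsub>?B\<^esub> f') = ?T ((\<lambda>x. 1 / ?o * f x) \<oplus>\<^bsub>?A\<^esub> (\<lambda>x. 1 / ?o * f' x))"
      unfolding S B(4) group_algebra_simps
      by (rule arg_cong[where f = ?T]) (simp add: fun_eq_iff add_divide_distrib)
    then show "?S (f \<oplus>\<^bsub>?B\<^esub> f') = ?S f \<oplus>\<^bsub>?H\<^esub> ?S f'"
      using ring_hom_add[OF T(1) cl cl] f f' B(1) S by simp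
  next
    have "(\<lambda>x. 1 / ?o * \<one>\<^bsub>?B\<^esub> x) = \<one>\<^bsub>?A\<^esub>"
      using o by (simp add: B(3) group_algebra_simps fun_eq_iff)
    then show "?S \<one>\<^bsub>?B\<^esub> = \<one>\<^bsub>?H\<^esub>" using ring_hom_one[OF T(1)] S by simp
  qed
  moreover have "bij_betw ?S (carrier ?B) (carrier ?H)"
  proof -
    have "bij_betw (\<lambda>f x. 1 / ?o * f x) (carrier ?A) (carrier ?A)"
      by (rule bij_betw_byWitness[of _ "\<lambda>f x. ?o * f x"]) (use o in \<open>auto simp: group_algebra_simps\<close>)
    then have "bij_betw (?T \<circ> (\<lambda>f x. 1 / ?o * f x)) (carrier ?A) (carrier ?H)"
      using T(2) by (rule bij_betw_trans)
    moreover have "?S = ?T \<circ> (\<lambda>f x. 1 / ?o * f x)"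
      by (rule ext) (simp only: S comp_def)
    ultimately show ?thesis by (simp only: B(1))
  qed
  moreover have "?S (c \<odot>\<^bsub>?B\<^esub> f) = c \<odot>\<^bsub>?H\<^esub> ?S f" if "f \<in> carrier ?B" for c f
  proof -
    have "(\<lambda>x. 1 / ?o * (c \<odot>\<^bsub>?A\<^esub> f) x) = c \<odot>\<^bsub>?A\<^esub> (\<lambda>x. 1 / ?o * f x)"
      by (simp add: group_algebra_simps fun_eq_iff)
    then show ?thesis using T(3)[OF cl] that B(1,5) S by simp
  qed
  ultimately show ?thesis unfolding algebra_iso_def ring_iso_def by simp
qed

lemma algebra_hecke:
  assumes "comm_group Q"
  shows "algebra complex_ring (hecke_algebra G N \<psi>)"
proof (rule algebra_transport[OF algebra_group_algebra[OF assms finite_Q]])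
  let ?T = "infl_map G N \<Psi> (1 / dN)"
  show "?T \<in> ring_hom (group_algebra Q) (hecke_algebra G N \<psi>)"
    and "bij_betw ?T (carrier (group_algebra Q)) (carrier (hecke_algebra G N \<psi>))"
    using infl_map_algebra_iso unfolding algebra_iso_def ring_iso_def by auto
  show "?T (c \<odot>\<^bsub>group_algebra Q\<^esub> f) = c \<odot>\<^bsub>hecke_algebra G N \<psi>\<^esub> ?T f"
    if "f \<in> carrier (group_algebra Q)" for c f
    using infl_map_algebra_iso that unfolding algebra_iso_def by auto
  show "infl_map G N \<Psi> (1 / dN) \<zero>\<^bsub>group_algebra Q\<^esub> = \<zero>\<^bsub>hecke_algebra G N \<psi>\<^esub>"
    by (simp add: group_algebra_simps hecke_algebra_simps infl_map_def infl_def fun_eq_iff)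
qed

end

section \<open>Decomposition of the induced representation\<close>

lemma sum_fun_apply: "(\<Sum>i\<in>A. f i) x = (\<Sum>i\<in>A. f i x)"
  by (induction A rule: infinite_finite_induct) auto

lemma intertwiner_sum:
  assumes "unitary_rep G V \<rho>" "unitary_rep G W \<sigma>" "\<And>i. i \<in> A \<Longrightarrow> intertwiner G V \<rho> W \<sigma> (T i)"
  shows "intertwiner G V \<rho> W \<sigma> (\<lambda>x. \<Sum>i\<in>A. cscale W (c i) (T i x))"
proof -
  interpret W: fd_space W using unitary_repD(1)[OF assms(2)] by unfold_locales
  note T = intertwinerD[OF assms(3)]
  have "(\<Sum>i\<in>A. cscale W (c i) (T i (\<rho> g x))) = \<sigma> g (\<Sum>i\<in>A. cscale W (c i) (T i x))"
    if "g \<in> carrier G" "x \<in> vecs V" for g x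
  proof -
    have "(\<Sum>i\<in>A. cscale W (c i) (T i (\<rho> g x))) = (\<Sum>i\<in>A. \<sigma> g (cscale W (c i) (T i x)))"
      using that by (intro sum.cong) (simp_all add: T unitary_repD(5)[OF assms(2)])
    also have "\<dots> = \<sigma> g (\<Sum>i\<in>A. cscale W (c i) (T i x))"
      using that T(2) by (intro linear_map_sum[OF W.fd W.fd unitary_repD(2)[OF assms(2)], symmetric])
        (auto intro: W.vecs_scale)
    finally show ?thesis .
  qed
  then show ?thesis
    unfolding intertwiner_def linear_map_def
    by (auto simp: T W.vs.scale_right_distrib sum.distrib W.vs.scale_sum_right mult.commute
        intro!: W.vecs_sum W.vecs_scale cong: sum.cong)
qed

text \<open>All values are roots of unity of order dividing the group order. The functions are
  extensional, so only finitely many remain.\<close>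

lemma unitary_chars_finite:
  assumes "group H" "finite (carrier H)"
  shows "finite (unitary_chars H)"
proof -
  interpret group H by fact
  let ?n = "Coset.order H"
  have n: "?n > 0" using assms(2) by (simp add: order_gt_0_iff_finite)
  have "finite {z :: complex. z ^ ?n = 1}" by (rule finite_roots_unity) (use n in simp)
  then have "finite (carrier H \<rightarrow>\<^sub>E {z :: complex. z ^ ?n = 1})" using assms(2) by (rule finite_PiE[rotated])
  moreover have "unitary_chars H \<subseteq> carrier H \<rightarrow>\<^sub>E {z. z ^ ?n = 1}"
  proof
    fix \<chi> assume \<chi>: "\<chi> \<in> unitary_chars H"
    have mult: "\<chi> (x \<otimes>\<^bsub>H\<^esub> y) = \<chi> x * \<chi> y" if "x \<in> carrier H" "y \<in> carrier H" for x y
      using \<chi> that unfolding unitary_chars_def by blast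
    have nz: "\<chi> x \<noteq> 0" if "x \<in> carrier H" for x
    proof -
      have "\<chi> \<in> carrier H \<rightarrow>\<^sub>E {z. cmod z = 1}" using \<chi> unfolding unitary_chars_def by blast
      from PiE_mem[OF this that] show ?thesis by auto
    qed
    have one: "\<chi> \<one>\<^bsub>H\<^esub> = 1" using mult[of "\<one>\<^bsub>H\<^esub>" "\<one>\<^bsub>H\<^esub>"] nz[of "\<one>\<^bsub>H\<^esub>"] by simp
    have "\<chi> (x [^]\<^bsub>H\<^esub> k) = \<chi> x ^ k" if "x \<in> carrier H" for x and k :: nat
      by (induction k) (use that one mult in \<open>auto simp: mult.commute\<close>)
    then have "\<chi> x ^ ?n = 1" if "x \<in> carrier H" for x
      using that one pow_order_eq_1 by metis
    then show "\<chi> \<in> carrier H \<rightarrow>\<^sub>E {z. z ^ ?n = 1}"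
      using \<chi> unfolding unitary_chars_def by (auto simp: PiE_iff)
  qed
  ultimately show ?thesis by (rule finite_subset[rotated])
qed

context inertia_extension
begin

abbreviation "M \<equiv> ind_space G N V \<theta>"
abbreviation "X \<equiv> unitary_chars Q"
abbreviation "tw \<chi> \<equiv> twist V \<xi> (infl G N \<chi>)"
abbreviation "MX \<chi> \<equiv> ind_space G I V (tw \<chi>)"
abbreviation "act \<equiv> ind_act G"

lemma tw_eq: "tw \<chi> h x = cscale V (\<chi> (q h)) (\<xi> h x)"
  by (simp add: twist_def infl_def)

section \<open>Characters of the quotient, viewed on the inertia group\<close>

lemma finite_X: "finite X"
  by (rule unitary_chars_finite[OF group_Q finite_Q])

lemma chi_mult: "\<lbrakk>\<chi> \<in> X; h \<in> I; k \<in> I\<rbrakk> \<Longrightarrow> \<chi> (q (h \<otimes> k)) = \<chi> (q h) * \<chi> (q k)"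
  unfolding unitary_chars_def by (simp add: q_mult)

lemma chi_norm: "\<lbrakk>\<chi> \<in> X; h \<in> I\<rbrakk> \<Longrightarrow> cmod (\<chi> (q h)) = 1"
  unfolding unitary_chars_def by (auto dest!: PiE_mem[OF _ q_closed])

lemma chi_cnj: "\<lbrakk>\<chi> \<in> X; h \<in> I\<rbrakk> \<Longrightarrow> \<chi> (q h) * cnj (\<chi> (q h)) = 1"
  by (simp add: complex_mult_cnj cmod_power2[symmetric] chi_norm flip: complex_norm_square)

lemma chi_nonzero: "\<lbrakk>\<chi> \<in> X; h \<in> I\<rbrakk> \<Longrightarrow> \<chi> (q h) \<noteq> 0"
  using chi_norm by fastforce

lemma chi_one: "\<chi> \<in> X \<Longrightarrow> \<chi> (q \<one>) = 1"
  using chi_mult[of \<chi> \<one> \<one>] chi_nonzero[of \<chi> \<one>] I_one by simp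

lemma chi_N: "\<lbrakk>\<chi> \<in> X; n \<in> N\<rbrakk> \<Longrightarrow> \<chi> (q n) = 1"
  using chi_one q_N q_one by simp

lemma chi_inv_mult: "\<lbrakk>\<chi> \<in> X; h \<in> I\<rbrakk> \<Longrightarrow> \<chi> (q h) * \<chi> (q (inv h)) = 1"
  using chi_mult[of \<chi> h "inv h"] chi_one[of \<chi>] I_inv I_sub r_inv by metis

lemma chi_inv: "\<lbrakk>\<chi> \<in> X; h \<in> I\<rbrakk> \<Longrightarrow> \<chi> (q (inv h)) = cnj (\<chi> (q h))"
  using chi_inv_mult[of \<chi> h] chi_cnj[of \<chi> h] chi_nonzero[of \<chi> h] by (metis mult_left_cancel)

lemma chi_ext:
  assumes "\<chi> \<in> X" "\<chi>' \<in> X" "\<And>h. h \<in> I \<Longrightarrow> \<chi> (q h) = \<chi>' (q h)"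
  shows "\<chi> = \<chi>'"
proof (rule PiE_ext)
  show "\<chi> \<in> carrier Q \<rightarrow>\<^sub>E {z. cmod z = 1}" "\<chi>' \<in> carrier Q \<rightarrow>\<^sub>E {z. cmod z = 1}"
    using assms by (auto simp: unitary_chars_def)
  show "\<chi> C = \<chi>' C" if "C \<in> carrier Q" for C
    using that assms(3) by (auto simp: carrier_Q)
qed

text \<open>For distinct characters, translation by an element \<open>k\<close> at which they differ
  multiplies the sum by a number other than 1, so the sum is zero. Summing over \<open>I\<close>
  instead of the quotient makes the diagonal value \<open>card I\<close>.\<close>

lemma chi_orthogonality:
  assumes "\<chi> \<in> X" "\<chi>' \<in> X"
  shows "(\<Sum>h\<in>I. \<chi> (q h) * \<chi>' (q (inv h))) = (if \<chi> = \<chi>' then of_nat (card I) else 0)"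
proof (cases "\<chi> = \<chi>'")
  case True
  then show ?thesis using chi_inv_mult[OF assms(1)] by simp
next
  case False
  then obtain k where k: "k \<in> I" "\<chi> (q k) \<noteq> \<chi>' (q k)" using chi_ext[OF assms] by blast
  let ?S = "\<Sum>h\<in>I. \<chi> (q h) * \<chi>' (q (inv h))"
  have "?S = (\<Sum>h\<in>I. \<chi> (q (k \<otimes> h)) * \<chi>' (q (inv (k \<otimes> h))))"
    using group.sum_translate(1)[OF group_GI, of k "\<lambda>h. \<chi> (q h) * \<chi>' (q (inv h))"] k by simp
  also have "\<dots> = (\<Sum>h\<in>I. \<chi> (q k) * \<chi>' (q (inv k)) * (\<chi> (q h) * \<chi>' (q (inv h))))"
    using k I_sub assms
    by (intro sum.cong) (auto simp: chi_mult inv_mult_group I_inv)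
  also have "\<dots> = \<chi> (q k) * \<chi>' (q (inv k)) * ?S" by (rule sum_distrib_left[symmetric])
  finally have "?S * \<chi>' (q k) = \<chi> (q k) * \<chi>' (q (inv k)) * ?S * \<chi>' (q k)"
    by (rule arg_cong[of _ _ "\<lambda>z. z * \<chi>' (q k)"])
  also have "\<dots> = \<chi> (q k) * ?S * (\<chi>' (q k) * \<chi>' (q (inv k)))" by (simp only: mult_ac)
  finally have "?S * (\<chi>' (q k) - \<chi> (q k)) = 0"
    unfolding chi_inv_mult[OF assms(2) k(1)] by (simp only: algebra_simps) simp
  then show ?thesis using k False by simp
qed

lemma unitary_twist:
  assumes \<chi>: "\<chi> \<in> X"
  shows "unitary_rep GI V (tw \<chi>)"
proof -
  have "cscale V (\<chi> (q h)) (\<xi> h x) \<in> vecs V" if "h \<in> I" "x \<in> vecs V" for h x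
    using that \<xi>D(3) vecs_scale by blast
  moreover have "cinner V (cscale V (\<chi> (q h)) (\<xi> h x)) (cscale V (\<chi> (q h)) (\<xi> h y)) = cinner V x y"
    if "h \<in> I" "x \<in> vecs V" "y \<in> vecs V" for h x y
  proof -
    have "cinner V (cscale V (\<chi> (q h)) (\<xi> h x)) (cscale V (\<chi> (q h)) (\<xi> h y))
        = (\<chi> (q h) * cnj (\<chi> (q h))) * cinner V (\<xi> h x) (\<xi> h y)"
      using that by (simp add: inner_scale_left inner_scale_right \<xi>D(3) vecs_scale)
    then show ?thesis using chi_cnj[OF \<chi> that(1)] \<xi>D(6) that by simp
  qed
  ultimately show ?thesis
    unfolding unitary_rep_def linear_map_def isometric_on_def tw_eq
    using fd by (auto simp: \<xi>D chi_one[OF \<chi>] chi_mult[OF \<chi>] vs.scale_right_distrib mult.commute)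
qed

section \<open>Irreducibility of the representations induced from the inertia group\<close>

lemma unitary_M: "unitary_rep G M act"
  by (rule unitary_rep_ind[OF group_axioms finite_G subgroup_axioms unitary_\<theta>])

lemma unitary_MX: "\<chi> \<in> X \<Longrightarrow> unitary_rep G (MX \<chi>) act"
  using unitary_rep_ind[OF group_axioms finite_G subgroup_I, of V "tw \<chi>"] unitary_twist
  by (simp add: inertia_group_def)

lemma MX_D:
  assumes "f \<in> vecs (MX \<chi>)" "g \<in> carrier G" "h \<in> I"
  shows "f (g \<otimes> h) = cscale V (\<chi> (q (inv h))) (\<xi> (inv h) (f g))"
  using ind_spaceD(3)[OF assms] by (simp add: tw_eq)

text \<open>Characters of the quotient are trivial on \<open>N\<close>, so covariance under
  \<open>I\<close> by the twisted \<open>\<xi>\<close> restricts to covariance under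
  \<open>N\<close> by \<open>\<theta>\<close>.\<close>

lemma MX_subset_M:
  assumes "\<chi> \<in> X"
  shows "vecs (MX \<chi>) \<subseteq> vecs M"
proof
  fix f assume f: "f \<in> vecs (MX \<chi>)"
  show "f \<in> vecs M"
  proof (rule ind_spaceI)
    fix g n assume g: "g \<in> carrier G" "n \<in> N"
    then show "f (g \<otimes> n) = \<theta> (inv n) (f g)"
      using MX_D[OF f g(1) N_I[OF g(2)]] chi_N[OF assms] \<xi>_extends ind_spaceD(1)[OF f g(1)] by simp
  qed (use ind_spaceD[OF f] in auto)
qed

text \<open>The canonical embedding of the twisted representation into the representation induced
  from it: the covariant function supported on \<open>I\<close> with value \<open>a\<close> at the
  identity.\<close>

definition basic :: "('g set \<Rightarrow> complex) \<Rightarrow> 'v \<Rightarrow> 'g \<Rightarrow> 'v" where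
  "basic \<chi> a g = (if g \<in> I then tw \<chi> (inv g) a else 0)"

lemma basic_closed:
  assumes \<chi>: "\<chi> \<in> X" and a: "a \<in> vecs V"
  shows "basic \<chi> a \<in> vecs (MX \<chi>)"
proof (rule ind_spaceI)
  note t = unitary_repD[OF unitary_twist[OF \<chi>], simplified]
  show "basic \<chi> a g \<in> vecs V" for g using t(3) a I_inv by (simp add: basic_def)
  show "basic \<chi> a g = 0" if "g \<notin> carrier G" for g using that I_sub by (auto simp: basic_def)
  fix g k assume g: "g \<in> carrier G" and k: "k \<in> I"
  show "basic \<chi> a (g \<otimes> k) = tw \<chi> (inv k) (basic \<chi> a g)"
  proof (cases "g \<in> I")
    case True
    then show ?thesis using t(8)[of "inv k" "inv g" a] a k g I_sub
      by (simp add: basic_def I_mult I_inv inv_mult_group)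
  next
    case False
    have "g \<otimes> k \<notin> I"
    proof
      assume "g \<otimes> k \<in> I"
      then have "g \<otimes> k \<otimes> inv k \<in> I" using k I_mult I_inv by blast
      then show False using False g k I_sub by (simp add: m_assoc)
    qed
    then show ?thesis
      using False linear_map_zero[OF fd fd t(2)[OF I_inv[OF k]]] by (simp add: basic_def)
  qed
qed

lemma basic_at_one: "\<lbrakk>\<chi> \<in> X; a \<in> vecs V\<rbrakk> \<Longrightarrow> basic \<chi> a \<one> = a"
  using unitary_repD(7)[OF unitary_twist, of \<chi> a] I_one by (simp add: basic_def)

text \<open>At a point \<open>x\<close>, only the elements \<open>g\<close> of the coset of
  \<open>x\<close> modulo \<open>I\<close> contribute, and covariance makes each contribution equal
  to \<open>f x\<close>; there are \<open>card I\<close> of them. Hence translates of basic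
  functions span the induced space.\<close>

lemma basic_generates:
  assumes \<chi>: "\<chi> \<in> X" and f: "f \<in> vecs (MX \<chi>)"
  shows "(\<Sum>g\<in>carrier G. act g (basic \<chi> (f g))) = cscale M (of_nat (card I)) f"
proof
  fix x
  note t = unitary_repD[OF unitary_twist[OF \<chi>], simplified]
  show "(\<Sum>g\<in>carrier G. act g (basic \<chi> (f g))) x = cscale M (of_nat (card I)) f x"
  proof (cases "x \<in> carrier G")
    case x: True
    have "(\<Sum>g\<in>carrier G. act g (basic \<chi> (f g))) x = (\<Sum>g\<in>carrier G. basic \<chi> (f g) (inv g \<otimes> x))"
      using x by (simp add: sum_fun_apply ind_act_def)
    also have "\<dots> = (\<Sum>k\<in>carrier G. basic \<chi> (f (x \<otimes> k)) (inv (x \<otimes> k) \<otimes> x))"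
      by (rule sum_translate(1)[OF x, symmetric])
    also have "\<dots> = (\<Sum>k\<in>carrier G. if k \<in> I then f x else 0)"
    proof (rule sum.cong[OF refl])
      fix k assume k: "k \<in> carrier G"
      have "inv (x \<otimes> k) \<otimes> x = inv k" using x k by (simp add: inv_mult_group m_assoc)
      moreover have "inv k \<in> I \<longleftrightarrow> k \<in> I" using I_inv[of k] I_inv[of "inv k"] k by auto
      moreover have "tw \<chi> k (f (x \<otimes> k)) = f x" if kI: "k \<in> I"
      proof -
        have "f (x \<otimes> k) = tw \<chi> (inv\<^bsub>GI\<^esub> k) (f x)" using ind_spaceD(3)[OF f x kI] kI by (simp add: inv_GI)
        then show ?thesis
          using unitary_rep_inv_cancel(1)[OF group_GI unitary_twist[OF \<chi>], of k "f x"] kI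
            ind_spaceD(1)[OF f x] by simp
      qed
      ultimately show "basic \<chi> (f (x \<otimes> k)) (inv (x \<otimes> k) \<otimes> x) = (if k \<in> I then f x else 0)"
        using k by (simp add: basic_def)
    qed
    also have "\<dots> = (\<Sum>k\<in>I. f x)"
      using finite_G I_sub by (intro sum.mono_neutral_cong_right) auto
    also have "\<dots> = cscale V (of_nat (card I)) (f x)" by (rule vs.sum_constant_scale)
    finally show ?thesis by simp
  next
    case False
    then show ?thesis using ind_spaceD(2)[OF f] by (simp add: sum_fun_apply ind_act_def)
  qed
qed

text \<open>Normality lets the left factor pass \<open>x\<close> and become a right factor in
  \<open>N\<close>, where covariance applies. So evaluation at \<open>x\<close> turns translation by
  \<open>N\<close> into the conjugate of \<open>\<theta>\<close> by \<open>x\<close>.\<close>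

lemma translate_eq_conj:
  assumes f: "f \<in> vecs M" and n: "n \<in> N" and x: "x \<in> carrier G"
  shows "f (inv n \<otimes> x) = conj_rep G x \<theta> n (f x)"
proof -
  have ni: "inv n \<in> N" using n by auto
  have "x \<otimes> (inv x \<otimes> (inv n \<otimes> x)) = inv n \<otimes> x"
    using x N_sub[OF n] by (simp add: m_assoc[symmetric])
  then have "inv n \<otimes> x = x \<otimes> (inv x \<otimes> inv n \<otimes> x)" using x N_sub[OF n] by (simp add: m_assoc)
  then have "f (inv n \<otimes> x) = \<theta> (inv (inv x \<otimes> inv n \<otimes> x)) (f x)"
    using ind_spaceD(3)[OF f x conj_in_N[OF x ni]] by simp
  also have "inv (inv x \<otimes> inv n \<otimes> x) = inv x \<otimes> n \<otimes> x"
    using x N_sub[OF n] by (simp add: inv_mult_group m_assoc)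
  finally show ?thesis by (simp add: conj_rep_def)
qed

text \<open>By Schur orthogonality, averaging a function against matrix coefficients of \<open>\<theta>\<close> kills its values
  outside the inertia group, because there the translates carry conjugates of \<open>\<theta>\<close> inequivalent to \<open>\<theta>\<close>.\<close>

lemma average_eq_basic:
  assumes \<chi>: "\<chi> \<in> X" and f: "f \<in> vecs (MX \<chi>)" and a: "a \<in> vecs V"
  shows "(\<Sum>n\<in>N. cscale M (cinner V a (\<theta> n (f \<one>))) (act n f))
         = cscale M (dN * cinner V (f \<one>) (f \<one>)) (basic \<chi> a)"
proof
  fix x
  let ?c = "f \<one>"
  have c: "?c \<in> vecs V" using ind_spaceD(1)[OF f] by simp
  have fM: "f \<in> vecs M" using f MX_subset_M[OF \<chi>] by blast
  show "(\<Sum>n\<in>N. cscale M (cinner V a (\<theta> n ?c)) (act n f)) x = cscale M (dN * cinner V ?c ?c) (basic \<chi> a) x"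
  proof (cases "x \<in> carrier G")
    case x: True
    have fx: "f x \<in> vecs V" using ind_spaceD(1)[OF f x] .
    have "(\<Sum>n\<in>N. cscale M (cinner V a (\<theta> n ?c)) (act n f)) x
        = (\<Sum>n\<in>N. cscale V (cinner V a (\<theta> n ?c)) (conj_rep G x \<theta> n (f x)))"
      using x translate_eq_conj[OF fM _ x] by (simp add: sum_fun_apply ind_act_def cong: sum.cong)
    also have "\<dots> = cscale V (dN * cinner V ?c ?c) (basic \<chi> a x)"
    proof (cases "x \<in> I")
      case xI: True
      have xi: "inv x \<in> I" using xI by (rule I_inv)
      \<comment> \<open>Inside \<open>I\<close> covariance expresses \<open>f x\<close> through
        \<open>f \<one>\<close>; the character value left over is the one that \<open>basic\<close>
        carries at \<open>x\<close>.\<close>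
      have "\<xi> x (f x) = cscale V (\<chi> (q (inv x))) ?c"
        using MX_D[OF f one_closed xI] x c \<xi>D(5)[OF xI] \<xi>D(3)[OF xi] \<xi>_inv_cancel(1)[OF xI c] by simp
      then show ?thesis
        using average_conj_inside[OF xI a c fx] xI c by (simp add: basic_def tw_eq inner_scale_left mult_ac)
    next
      case False
      then show ?thesis using average_conj_outside[OF x False a c fx] by (simp add: basic_def)
    qed
    finally show ?thesis by simp
  next
    case False
    then show ?thesis using I_sub by (auto simp: sum_fun_apply ind_act_def basic_def)
  qed
qed

text \<open>Scaling depends only on \<open>V\<close>, so all these spaces sit in one vector space of
  functions and subspaces can be compared directly, although the inner products have different
  denominators.\<close>

lemma cscale_M_eq: "cscale (MX \<chi>) = cscale M"
  by (simp add: cscale_ind_space)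

sublocale M: fd_space M
  using unitary_repD(1)[OF unitary_M] by unfold_locales

text \<open>A nonzero element of an invariant subspace can be translated so that it does not vanish
  at the identity. Its averages over \<open>N\<close> then yield every basic function, and these
  generate the whole space.\<close>

lemma irreducible_MX:
  assumes \<chi>: "\<chi> \<in> X"
  shows "irreducible_rep G (MX \<chi>) act"
proof -
  have u: "unitary_rep G (MX \<chi>) act" by (rule unitary_MX[OF \<chi>])
  have "U = vecs (MX \<chi>)" if U: "invariant_subspace G (MX \<chi>) act U" and "U \<noteq> {0}" for U
  proof -
    note UU = invariant_subspaceD[OF U]
    have sub: "M.vs.subspace U" using UU(1) by (simp add: cscale_M_eq)
    obtain f where f: "f \<in> U" "f \<noteq> 0" using \<open>U \<noteq> {0}\<close> M.vs.subspace_0[OF sub] by blast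
    then obtain g where g: "f g \<noteq> 0" by (auto simp: fun_eq_iff)
    have "f \<in> vecs (MX \<chi>)" using f(1) UU(2) by blast
    from ind_spaceD(2)[OF this, of g] g have gG: "g \<in> carrier G" by blast
    define f' where "f' = act (inv g) f"
    have f': "f' \<in> U" "f' \<in> vecs (MX \<chi>)" using UU(2,3) f gG by (auto simp: f'_def)
    have c: "f' \<one> \<in> vecs V" "f' \<one> \<noteq> 0"
      using ind_spaceD(1)[OF f'(2) one_closed] g gG by (auto simp: f'_def ind_act_def)
    let ?z = "dN * cinner V (f' \<one>) (f' \<one>)"
    have z: "?z \<noteq> 0" using dN_nonzero inner_eq_0_iff[OF c(1)] c(2) by simp
    have basic: "basic \<chi> a \<in> U" if "a \<in> vecs V" for a
    proof -
      have "cscale M ?z (basic \<chi> a) \<in> U"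
        unfolding average_eq_basic[OF \<chi> f'(2) that, symmetric]
        using f'(1) UU(3) N_sub by (intro M.vs.subspace_sum[OF sub] M.vs.subspace_scale[OF sub]) auto
      then have "cscale M (1 / ?z) (cscale M ?z (basic \<chi> a)) \<in> U" by (rule M.vs.subspace_scale[OF sub])
      then show ?thesis using z by (simp only: M.vs.scale_scale) simp
    qed
    have "h \<in> U" if h: "h \<in> vecs (MX \<chi>)" for h
    proof -
      have "cscale M (of_nat (card I)) h \<in> U"
        unfolding basic_generates[OF \<chi> h, symmetric]
        using basic ind_spaceD(1)[OF h] UU(3) by (intro M.vs.subspace_sum[OF sub]) auto
      then have "cscale M (1 / of_nat (card I)) (cscale M (of_nat (card I)) h) \<in> U"
        by (rule M.vs.subspace_scale[OF sub])
      then show ?thesis using card_I_pos by (simp only: M.vs.scale_scale) simp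
    qed
    then show ?thesis using UU(2) by blast
  qed
  moreover have "vecs (MX \<chi>) \<noteq> {0}"
  proof -
    obtain a where a: "a \<in> vecs V" "a \<noteq> 0"
      using irreducible_repD(2)[OF irreducible_\<theta>] vecs_zero by blast
    have "basic \<chi> a \<noteq> 0" using basic_at_one[OF \<chi> a(1)] a(2) by auto
    then show ?thesis using basic_closed[OF \<chi> a(1)] by blast
  qed
  ultimately show ?thesis using u unfolding irreducible_rep_def by blast
qed

subsection \<open>The operators commuting with the induced representation\<close>

definition R :: "'g \<Rightarrow> ('g \<Rightarrow> 'v) \<Rightarrow> 'g \<Rightarrow> 'v" where
  "R h f g = (if g \<in> carrier G then \<xi> h (f (g \<otimes> h)) else 0)"

text \<open>Moving \<open>n\<close> past \<open>h\<close> in the argument conjugates it by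
  \<open>h\<close>; the operator \<open>\<xi> h\<close> undoes this conjugation, so the covariance
  under \<open>N\<close> is again by \<open>\<theta>\<close>.\<close>

lemma R_closed:
  assumes h: "h \<in> I" and f: "f \<in> vecs M"
  shows "R h f \<in> vecs M"
proof (rule ind_spaceI)
  have hG: "h \<in> carrier G" using h by (rule I_sub)
  show "R h f g \<in> vecs V" if "g \<in> carrier G" for g
    using that ind_spaceD(1)[OF f] \<xi>D(3)[OF h] hG by (simp add: R_def)
  show "R h f g = 0" if "g \<notin> carrier G" for g using that by (simp add: R_def)
  fix g n assume g: "g \<in> carrier G" and n: "n \<in> N"
  have ni: "inv n \<in> N" using n by auto
  have nG: "n \<in> carrier G" using N_sub[OF n] .
  have fgh: "f (g \<otimes> h) \<in> vecs V" using ind_spaceD(1)[OF f] g hG by simp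
  have "g \<otimes> h \<otimes> (inv h \<otimes> n \<otimes> h) = g \<otimes> (h \<otimes> (inv h \<otimes> (n \<otimes> h)))"
    using g hG nG by (simp add: m_assoc)
  also have "h \<otimes> (inv h \<otimes> (n \<otimes> h)) = n \<otimes> h" using hG nG by (simp add: m_assoc[symmetric])
  finally have e: "g \<otimes> n \<otimes> h = g \<otimes> h \<otimes> (inv h \<otimes> n \<otimes> h)" using g hG nG by (simp add: m_assoc)
  have i: "inv (inv h \<otimes> n \<otimes> h) = inv h \<otimes> inv n \<otimes> h" using hG nG by (simp add: inv_mult_group m_assoc)
  have "f (g \<otimes> n \<otimes> h) = \<theta> (inv h \<otimes> inv n \<otimes> h) (f (g \<otimes> h))"
    using ind_spaceD(3)[OF f _ conj_in_N[OF hG n], of "g \<otimes> h"] g hG by (simp add: e i)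
  then have "f (g \<otimes> n \<otimes> h) = conj_rep G h \<theta> (inv n) (f (g \<otimes> h))" by (simp add: conj_rep_def)
  also have "\<dots> = \<xi> (inv h) (\<theta> (inv n) (\<xi> h (f (g \<otimes> h))))"
    by (rule conj_rep_inside[OF h ni fgh])
  finally show "R h f (g \<otimes> n) = \<theta> (inv n) (R h f g)"
    using g nG \<xi>_inv_cancel(1)[OF h \<theta>D(3)[OF ni \<xi>D(3)[OF h fgh]]] by (simp add: R_def)
qed

lemma R_intertwiner:
  assumes h: "h \<in> I"
  shows "intertwiner G M act M act (R h)"
proof -
  have hG: "h \<in> carrier G" using h by (rule I_sub)
  have "\<xi> h 0 = 0" by (rule linear_map_zero[OF fd fd \<xi>D(2)[OF h]])
  then show ?thesis
    unfolding intertwiner_def linear_map_def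
    using R_closed[OF h] hG
    by (auto simp: R_def ind_act_def fun_eq_iff \<xi>D(4,5)[OF h] ind_spaceD(1) m_assoc)
qed

lemma R_mult:
  assumes "h \<in> I" "k \<in> I" "f \<in> vecs M"
  shows "R (h \<otimes> k) f = R h (R k f)"
  using assms I_sub by (auto simp: R_def fun_eq_iff \<xi>D(8) ind_spaceD(1) m_assoc)

lemma R_N:
  assumes "n \<in> N" "f \<in> vecs M"
  shows "R n f = f"
proof
  fix g
  show "R n f g = f g"
  proof (cases "g \<in> carrier G")
    case g: True
    have "R n f g = \<xi> n (\<theta> (inv n) (f g))" using ind_spaceD(3)[OF assms(2) g assms(1)] g by (simp add: R_def)
    also have "\<dots> = f g"
      using \<xi>_inv_cancel(1)[OF N_I[OF assms(1)] ind_spaceD(1)[OF assms(2) g]]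
        \<xi>_extends[of "inv n" "f g"] ind_spaceD(1)[OF assms(2) g] assms(1) by simp
    finally show ?thesis .
  qed (use ind_spaceD(2)[OF assms(2)] in \<open>simp add: R_def\<close>)
qed

lemma R_isometric:
  assumes h: "h \<in> I" and f: "f \<in> vecs M" "f' \<in> vecs M"
  shows "cinner M (R h f) (R h f') = cinner M f f'"
proof -
  have hG: "h \<in> carrier G" using h by (rule I_sub)
  have "(\<Sum>g\<in>carrier G. cinner V (R h f g) (R h f' g))
      = (\<Sum>g\<in>carrier G. cinner V (f (g \<otimes> h)) (f' (g \<otimes> h)))"
    using hG ind_spaceD(1)[OF f(1)] ind_spaceD(1)[OF f(2)]
    by (intro sum.cong) (auto simp: R_def \<xi>D(6)[OF h])
  also have "\<dots> = (\<Sum>g\<in>carrier G. cinner V (f g) (f' g))"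
    by (rule sum_translate(2)[OF hG])
  finally show ?thesis by simp
qed

text \<open>The character is evaluated at \<open>inv h\<close> because covariance reads f(gh) =
  (twisted action of the inverse of h) applied to f(g). The converse is \<open>MX_I\<close>.\<close>

lemma R_on_MX:
  assumes "\<chi> \<in> X" "f \<in> vecs (MX \<chi>)" "h \<in> I"
  shows "R h f = cscale M (\<chi> (q (inv h))) f"
proof
  fix g
  show "R h f g = cscale M (\<chi> (q (inv h))) f g"
  proof (cases "g \<in> carrier G")
    case g: True
    have fg: "f g \<in> vecs V" using ind_spaceD(1)[OF assms(2) g] .
    show ?thesis
      using g MX_D[OF assms(2) g assms(3)] \<xi>D(5)[OF assms(3) \<xi>D(3)[OF I_inv[OF assms(3)] fg]]
        \<xi>_inv_cancel(1)[OF assms(3) fg] by (simp add: R_def)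
  qed (use ind_spaceD(2)[OF assms(2)] in \<open>simp add: R_def\<close>)
qed

lemma MX_I:
  assumes f: "f \<in> vecs M" and R: "\<And>h. h \<in> I \<Longrightarrow> R h f = cscale M (\<chi> (q (inv h))) f"
  shows "f \<in> vecs (MX \<chi>)"
proof (rule ind_spaceI)
  fix g h assume g: "g \<in> carrier G" and h: "h \<in> I"
  have gh: "f (g \<otimes> h) \<in> vecs V" using ind_spaceD(1)[OF f] g h I_sub by simp
  have fg: "f g \<in> vecs V" using ind_spaceD(1)[OF f g] .
  have "\<xi> h (f (g \<otimes> h)) = cscale V (\<chi> (q (inv h))) (f g)"
    using fun_cong[OF R[OF h], of g] g by (simp add: R_def)
  then have "f (g \<otimes> h) = \<xi> (inv h) (cscale V (\<chi> (q (inv h))) (f g))"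
    using \<xi>_inv_cancel(2)[OF h gh] by simp
  then show "f (g \<otimes> h) = tw \<chi> (inv h) (f g)" using \<xi>D(5)[OF I_inv[OF h] fg] by (simp add: tw_eq)
qed (use ind_spaceD[OF f] in auto)

text \<open>The isotypic projection for the action of \<open>I\<close> through the operators
  \<open>R h\<close>. The weight is the conjugate of the eigenvalue
  \<open>\<chi> (q (inv h))\<close> that \<open>R h\<close> has on the component of
  \<open>\<chi>\<close>.\<close>

definition P :: "('g set \<Rightarrow> complex) \<Rightarrow> ('g \<Rightarrow> 'v) \<Rightarrow> 'g \<Rightarrow> 'v" where
  "P \<chi> f = (\<Sum>h\<in>I. cscale M (\<chi> (q h) / of_nat (card I)) (R h f))"

lemma P_intertwiner: "intertwiner G M act M act (P \<chi>)"
proof -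
  have "intertwiner G M act M act (\<lambda>f. \<Sum>h\<in>I. cscale M (\<chi> (q h) / of_nat (card I)) (R h f))"
    by (rule intertwiner_sum[OF unitary_M unitary_M R_intertwiner])
  moreover have "(\<lambda>f. \<Sum>h\<in>I. cscale M (\<chi> (q h) / of_nat (card I)) (R h f)) = P \<chi>"
    by (rule ext) (simp only: P_def)
  ultimately show ?thesis by (simp only:)
qed

text \<open>Applying \<open>R k\<close> shifts the summation index by \<open>k\<close>, and
  adjusting the weight to the shifted index leaves the factor \<open>\<chi> (q (inv k))\<close>. The
  result is thus a joint eigenvector with the eigenvalues demanded by \<open>MX_I\<close>.\<close>

lemma P_closed:
  assumes \<chi>: "\<chi> \<in> X" and f: "f \<in> vecs M"
  shows "P \<chi> f \<in> vecs (MX \<chi>)"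
proof (rule MX_I)
  show "P \<chi> f \<in> vecs M" by (rule intertwinerD(2)[OF P_intertwiner f])
  fix k assume k: "k \<in> I"
  have ki: "inv k \<in> I" using k by (rule I_inv)
  let ?c = "\<lambda>h. \<chi> (q h) / of_nat (card I)"
  have "R k (P \<chi> f) = (\<Sum>h\<in>I. R k (cscale M (?c h) (R h f)))"
    unfolding P_def by (intro linear_map_sum[OF M.fd M.fd intertwinerD(1)[OF R_intertwiner[OF k]]] M.vecs_scale R_closed f)
  also have "\<dots> = (\<Sum>h\<in>I. cscale M (\<chi> (q (inv k)) * ?c (k \<otimes> h)) (R (k \<otimes> h) f))"
  proof (rule sum.cong[OF refl])
    fix h assume h: "h \<in> I"
    have "\<chi> (q (inv k)) * ?c (k \<otimes> h) = ?c h * (\<chi> (q k) * \<chi> (q (inv k)))"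
      using chi_mult[OF \<chi> k h] by simp
    then have c: "\<chi> (q (inv k)) * ?c (k \<otimes> h) = ?c h" using chi_inv_mult[OF \<chi> k] by simp
    have "R k (cscale M (?c h) (R h f)) = cscale M (?c h) (R k (R h f))"
      by (rule intertwinerD(4)[OF R_intertwiner[OF k] R_closed[OF h f]])
    then show "R k (cscale M (?c h) (R h f)) = cscale M (\<chi> (q (inv k)) * ?c (k \<otimes> h)) (R (k \<otimes> h) f)"
      unfolding c R_mult[OF k h f] .
  qed
  also have "\<dots> = (\<Sum>h\<in>I. cscale M (\<chi> (q (inv k)) * ?c h) (R h f))"
    using group.sum_translate(1)[OF group_GI, of k "\<lambda>h. cscale M (\<chi> (q (inv k)) * ?c h) (R h f)"] k
    by (simp only: carrier_GI mult_GI)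
  also have "\<dots> = cscale M (\<chi> (q (inv k))) (P \<chi> f)"
    unfolding P_def M.vs.scale_sum_right M.vs.scale_scale ..
  finally show "R k (P \<chi> f) = cscale M (\<chi> (q (inv k))) (P \<chi> f)" .
qed

lemma P_on_MX:
  assumes "\<chi> \<in> X" "\<chi>' \<in> X" "f \<in> vecs (MX \<chi>')"
  shows "P \<chi> f = (if \<chi> = \<chi>' then f else 0)"
proof -
  have "P \<chi> f = (\<Sum>h\<in>I. cscale M (\<chi> (q h) * \<chi>' (q (inv h)) / of_nat (card I)) f)"
    unfolding P_def
    by (rule sum.cong[OF refl]) (simp only: R_on_MX[OF assms(2,3)] M.vs.scale_scale times_divide_eq_left)
  also have "\<dots> = cscale M ((\<Sum>h\<in>I. \<chi> (q h) * \<chi>' (q (inv h))) / of_nat (card I)) f"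
    by (simp only: M.vs.scale_sum_left sum_divide_distrib)
  also have "\<dots> = (if \<chi> = \<chi>' then f else 0)"
    unfolding chi_orthogonality[OF assms(1,2)] using card_I_pos M.vs.scale_one[of f] M.vs.scale_zero_left[of f]
    by (simp del: ind_space_simps)
  finally show ?thesis .
qed

lemma MX_invariant: "\<chi> \<in> X \<Longrightarrow> invariant_subspace G M act (vecs (MX \<chi>))"
proof -
  assume \<chi>: "\<chi> \<in> X"
  interpret MX: fd_space "MX \<chi>" using unitary_repD(1)[OF unitary_MX[OF \<chi>]] by unfold_locales
  show ?thesis
    unfolding invariant_subspace_def
    using MX.subspace_vecs MX_subset_M[OF \<chi>] unitary_repD(3)[OF unitary_MX[OF \<chi>]]
    by (simp add: cscale_M_eq)
qed

text \<open>The identity map. It rescales the inner product by the ratio of the orders of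
  \<open>I\<close> and \<open>N\<close>, which \<open>equiv_rep\<close> permits.\<close>

lemma MX_equiv_sub: "equiv_rep G (MX \<chi>) act (M\<lparr>vecs := vecs (MX \<chi>)\<rparr>) act"
  unfolding equiv_rep_def intertwiner_def linear_map_def
  by (intro exI[of _ "\<lambda>x. x"]) (auto simp: cscale_M_eq bij_betw_def)

lemma irreducible_MX_sub: "\<chi> \<in> X \<Longrightarrow> irreducible_rep G (M\<lparr>vecs := vecs (MX \<chi>)\<rparr>) act"
  by (rule irreducible_rep_equiv[OF irreducible_MX unitary_rep_subspace[OF unitary_M MX_invariant] MX_equiv_sub])

lemma spherical_MX: "\<chi> \<in> X \<Longrightarrow> spherical_rep G N V \<theta> (MX \<chi>) act"
  unfolding spherical_rep_def contained_rep_def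
  using irreducible_MX MX_invariant MX_equiv_sub by blast

lemma irreducible_sub_in_MX:
  assumes mf: "multiplicity_free G M act"
    and U: "invariant_subspace G M act U" "irreducible_rep G (M\<lparr>vecs := U\<rparr>) act"
  shows "\<exists>\<chi>\<in>X. U \<subseteq> vecs (MX \<chi>)"
proof -
  note UU = invariant_subspaceD[OF U(1)]
  have "U \<noteq> {0}" using irreducible_repD(2)[OF U(2)] by simp
  then obtain u where u: "u \<in> U" "u \<noteq> 0" using M.vs.subspace_0[OF UU(1)] by blast
  have uM: "u \<in> vecs M" using u UU(2) by blast
  have ex: "\<exists>c. \<forall>x\<in>U. R h x = cscale M c x" if h: "h \<in> I" for h
  proof -
    have RU: "intertwiner G (M\<lparr>vecs := U\<rparr>) act M act (R h)"
      by (rule intertwiner_restrict_domain[OF R_intertwiner[OF h] UU(2)])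
    have inv: "invariant_subspace G M act (R h ` U)"
      using image_invariant[OF irreducible_repD(1)[OF U(2)] unitary_M RU] by simp
    \<comment> \<open>Being isometric, \<open>R h\<close> does not kill \<open>u\<close>, so by
      irreducibility it is injective on \<open>U\<close> and its image is an equivalent copy of
      \<open>U\<close>.\<close>
    have "cinner M (R h u) (R h u) \<noteq> 0"
      unfolding R_isometric[OF h uM uM] using M.inner_eq_0_iff[OF uM] u(2) by blast
    then have "R h u \<noteq> 0" using M.inner_zero_left[OF M.vecs_zero] by metis
    then have "inj_on (R h) U"
      using irreducible_inj_on[OF U(2) unitary_M RU, of u] u(1) by simp
    moreover have "intertwiner G (M\<lparr>vecs := U\<rparr>) act (M\<lparr>vecs := R h ` U\<rparr>) act (R h)"
      by (rule intertwiner_restrict[OF R_intertwiner[OF h] UU(2)]) simp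
    ultimately have eqv: "equiv_rep G (M\<lparr>vecs := U\<rparr>) act (M\<lparr>vecs := R h ` U\<rparr>) act"
      unfolding equiv_rep_def by (auto simp: bij_betw_def)
    have "irreducible_rep G (M\<lparr>vecs := R h ` U\<rparr>) act"
      by (rule irreducible_rep_equiv[OF U(2) unitary_rep_subspace[OF unitary_M inv] eqv])
    then have "U = R h ` U"
      by (rule multiplicity_free_unique[OF group_axioms unitary_M mf U inv _ eqv])
    then have "intertwiner G (M\<lparr>vecs := U\<rparr>) act (M\<lparr>vecs := U\<rparr>) act (R h)"
      by (intro intertwiner_restrict[OF R_intertwiner[OF h] UU(2)]) blast
    then show ?thesis using schur_scalar[OF U(2)] by fastforce
  qed
  define l where "l h = (SOME c. \<forall>x\<in>U. R h x = cscale M c x)" for h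
  have l: "R h x = cscale M (l h) x" if "h \<in> I" "x \<in> U" for h x
    using someI_ex[OF ex[OF that(1)]] that(2) unfolding l_def by blast
  have l_eqI: "l h = c" if "h \<in> I" "R h u = cscale M c u" for h c
    using l[OF that(1) u(1)] that(2) u(2) M.vs.scale_cancel_right by metis
  have lm: "l (h \<otimes> k) = l h * l k" if h: "h \<in> I" and k: "k \<in> I" for h k
  proof (rule l_eqI[OF I_mult[OF h k]])
    have "R (h \<otimes> k) u = R h (cscale M (l k) u)" unfolding R_mult[OF h k uM] l[OF k u(1)] ..
    also have "\<dots> = cscale M (l k) (cscale M (l h) u)"
      unfolding intertwinerD(4)[OF R_intertwiner[OF h] uM] l[OF h u(1)] ..
    finally show "R (h \<otimes> k) u = cscale M (l h * l k) u"
      unfolding M.vs.scale_scale by (simp only: mult.commute)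
  qed
  have lN: "l n = 1" if n: "n \<in> N" for n
    by (rule l_eqI[OF N_I[OF n]]) (simp only: R_N[OF n uM] M.vs.scale_one)
  \<comment> \<open>The eigenvalue of an isometric operator is unimodular; this is what makes the
    resulting character unitary.\<close>
  have ln: "cmod (l h) = 1" if h: "h \<in> I" for h
  proof -
    have "cinner M u u = cinner M (cscale M (l h) u) (cscale M (l h) u)"
      using R_isometric[OF h uM uM] unfolding l[OF h u(1)] ..
    also have "\<dots> = l h * (cnj (l h) * cinner M u u)"
      unfolding M.inner_scale_left[OF uM M.vecs_scale[OF uM]] M.inner_scale_right[OF uM uM] ..
    finally have "l h * cnj (l h) = 1"
      using M.inner_eq_0_iff[OF uM] u(2) by (simp only: mult.assoc[symmetric]) simp
    then have "(cmod (l h))\<^sup>2 = 1" by (simp flip: complex_norm_square of_real_power)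
    then show ?thesis using norm_ge_zero[of "l h"] by (auto simp: power2_eq_1_iff)
  qed
  have lq: "l h = l k" if h: "h \<in> I" and k: "k \<in> I" and e: "q h = q k" for h k
  proof -
    have "k \<in> q h" using q_eq_iff[OF h k] e by blast
    then obtain n where n: "n \<in> N" "k = h \<otimes> n" unfolding l_coset_def by blast
    then show ?thesis using lm[OF h N_I[OF n(1)]] lN[OF n(1)] by simp
  qed
  \<comment> \<open>The conjugate appears because \<open>R h\<close> acts on the component of a
    character by its value at the inverse of \<open>h\<close>. The value does not depend on the
    chosen representative of the coset, by \<open>lq\<close>.\<close>
  define \<chi> where "\<chi> = restrict (\<lambda>C. cnj (l (SOME h. h \<in> I \<and> q h = C))) (carrier Q)"
  have \<chi>q: "\<chi> (q h) = cnj (l h)" if h: "h \<in> I" for h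
  proof -
    have "\<exists>k. k \<in> I \<and> q k = q h" using h by blast
    then have "(SOME k. k \<in> I \<and> q k = q h) \<in> I \<and> q (SOME k. k \<in> I \<and> q k = q h) = q h"
      by (rule someI_ex)
    then have "l (SOME k. k \<in> I \<and> q k = q h) = l h" using lq h by blast
    then show ?thesis using h by (simp add: \<chi>_def)
  qed
  have \<chi>X: "\<chi> \<in> X"
    unfolding unitary_chars_def
  proof (intro CollectI conjI ballI)
    show "\<chi> \<in> carrier Q \<rightarrow>\<^sub>E {z. cmod z = 1}"
    proof (rule PiE_I)
      fix C assume "C \<in> carrier Q"
      then obtain h where "h \<in> I" "C = q h" unfolding carrier_Q by blast
      then show "\<chi> C \<in> {z. cmod z = 1}" using \<chi>q ln by simp
    qed (simp add: \<chi>_def)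
    fix C D assume "C \<in> carrier Q" "D \<in> carrier Q"
    then obtain h k where "h \<in> I" "C = q h" "k \<in> I" "D = q k" unfolding carrier_Q by blast
    then show "\<chi> (C \<otimes>\<^bsub>Q\<^esub> D) = \<chi> C * \<chi> D"
      using \<chi>q lm I_mult by (simp flip: q_mult)
  qed
  have "x \<in> vecs (MX \<chi>)" if x: "x \<in> U" for x
  proof (rule MX_I)
    show "x \<in> vecs M" using x UU(2) by blast
    fix h assume h: "h \<in> I"
    have "\<chi> (q (inv h)) = l h" using \<chi>q[OF h] chi_inv[OF \<chi>X h] by simp
    then show "R h x = cscale M (\<chi> (q (inv h))) x" using l[OF h x] by (simp only:)
  qed
  then show ?thesis using \<chi>X by blast
qed

text \<open>The set where the identity holds is invariant. If it were proper, its orthogonal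
  complement would contain an irreducible subrepresentation, which lies in the component of some
  character; there the identity holds, so a nonzero vector would be orthogonal to itself.\<close>

lemma sum_P:
  assumes mf: "multiplicity_free G M act" and f: "f \<in> vecs M"
  shows "(\<Sum>\<chi>\<in>X. P \<chi> f) = f"
proof -
  define T where "T f = (\<Sum>\<chi>\<in>X. P \<chi> f) - f" for f
  have sum_int: "intertwiner G M act M act (\<lambda>f. \<Sum>\<chi>\<in>X. P \<chi> f)"
    using intertwiner_sum[OF unitary_M unitary_M P_intertwiner, where A = X and c = "\<lambda>_. 1"]
    by (simp only: M.vs.scale_one)
  note s = intertwinerD[OF sum_int]
  have T: "intertwiner G M act M act T"
    unfolding intertwiner_def linear_map_def
  proof (intro conjI ballI allI)
    show "T \<in> vecs M \<rightarrow> vecs M" unfolding T_def using s(2) M.vecs_diff by blast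
    fix x assume x: "x \<in> vecs M"
    show "T (x + y) = T x + T y" if "y \<in> vecs M" for y
      unfolding T_def s(3)[OF x that] by simp
    show "T (cscale M c x) = cscale M c (T x)" for c
      unfolding T_def s(4)[OF x] M.vs.scale_right_diff_distrib ..
    show "T (act g x) = act g (T x)" if "g \<in> carrier G" for g
      unfolding T_def s(5)[OF that x] linear_map_diff[OF M.fd unitary_repD(2)[OF unitary_M that] s(2)[OF x] x] ..
  qed
  let ?S = "{x \<in> vecs M. T x = 0}"
  have S: "invariant_subspace G M act ?S" by (rule kernel_invariant[OF unitary_M unitary_M T])
  have "?S = vecs M"
  proof (rule ccontr)
    assume ne: "?S \<noteq> vecs M"
    let ?C = "{x \<in> vecs M. \<forall>y\<in>?S. cinner M x y = 0}"
    have C: "invariant_subspace G M act ?C"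
      by (rule orthogonal_complement_invariant[OF group_axioms unitary_M S])
    have "?C \<noteq> {0}"
      by (rule orthogonal_complement_nontrivial[OF M.fd invariant_subspaceD(1,2)[OF S] ne])
    then obtain U where U: "U \<subseteq> ?C" "invariant_subspace G M act U" "irreducible_rep G (M\<lparr>vecs := U\<rparr>) act"
      using irreducible_subrep_exists[OF unitary_M C] by blast
    obtain \<chi> where \<chi>: "\<chi> \<in> X" "U \<subseteq> vecs (MX \<chi>)" using irreducible_sub_in_MX[OF mf U(2,3)] by blast
    have "U \<noteq> {0}" using irreducible_repD(2)[OF U(3)] by simp
    then obtain u where u: "u \<in> U" "u \<noteq> 0"
      using M.vs.subspace_0[OF invariant_subspaceD(1)[OF U(2)]] by blast
    have uM: "u \<in> vecs M" using u U(1) by blast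
    have "(\<Sum>\<chi>'\<in>X. P \<chi>' u) = (\<Sum>\<chi>'\<in>X. if \<chi>' = \<chi> then u else 0)"
      using P_on_MX[OF _ \<chi>(1)] \<chi>(2) u(1) by (intro sum.cong) auto
    also have "\<dots> = u" using finite_X \<chi>(1) by simp
    finally have "u \<in> ?S" using uM by (simp add: T_def)
    then have "cinner M u u = 0" using U(1) u(1) by blast
    then show False using M.inner_eq_0_iff[OF uM] u(2) by blast
  qed
  then have "T f = 0" using f by blast
  then show ?thesis by (simp add: T_def)
qed

text \<open>On each component the operators are scalar, hence they commute on the sum of the
  components, which is everything. Commutativity then descends to the quotient by testing on a
  single function supported on \<open>N\<close>.\<close>

lemma comm_group_Q:
  assumes mf: "multiplicity_free G M act"
  shows "comm_group Q"
proof (rule group.group_comm_groupI[OF group_Q])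
  fix C D assume "C \<in> carrier Q" "D \<in> carrier Q"
  then obtain h k where h: "h \<in> I" "C = q h" and k: "k \<in> I" "D = q k" unfolding carrier_Q by blast
  have hk: "h \<otimes> k \<in> I" "k \<otimes> h \<in> I" using h k I_mult by auto
  have hkG: "h \<in> carrier G" "k \<in> carrier G" using h k I_sub by auto
  obtain a where a: "a \<in> vecs V" "a \<noteq> 0"
    using irreducible_repD(2)[OF irreducible_\<theta>] vecs_zero by blast
  \<comment> \<open>Supported on \<open>N\<close> with value \<open>a\<close> at the identity.
    Evaluating the operator for \<open>k \<otimes> h\<close> on it at
    \<open>inv (k \<otimes> h)\<close> gives \<open>\<xi> (k \<otimes> h) a\<close>, which is
    nonzero. The operator for \<open>h \<otimes> k\<close> can agree there only if
    \<open>inv (k \<otimes> h) \<otimes> (h \<otimes> k)\<close> lies in the support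
    \<open>N\<close>.\<close>
  define f where "f g = (if g \<in> N then \<theta> (inv g) a else 0)" for g
  have fM: "f \<in> vecs M"
  proof (rule ind_spaceI)
    show "f g \<in> vecs V" for g using a \<theta>D(3)[of "inv g"] by (simp add: f_def)
    show "f g = 0" if "g \<notin> carrier G" for g using that N_sub by (auto simp: f_def)
    fix g n assume g: "g \<in> carrier G" and n: "n \<in> N"
    show "f (g \<otimes> n) = \<theta> (inv n) (f g)"
    proof (cases "g \<in> N")
      case True
      then show ?thesis using n \<theta>D(8)[of "inv n" "inv g" a] a N_sub
        by (simp add: f_def subgroup.m_closed[OF subgroup_axioms] inv_mult_group)
    next
      case False
      have "g \<otimes> n \<notin> N"
      proof
        assume "g \<otimes> n \<in> N"
        then have "g \<otimes> n \<otimes> inv n \<in> N" using n by (simp add: subgroup.m_closed[OF subgroup_axioms])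
        then show False using False g N_sub[OF n] by (simp add: m_assoc)
      qed
      then show ?thesis
        using False linear_map_zero[OF fd fd \<theta>D(2)[of "inv n"]] n by (simp add: f_def)
    qed
  qed
  have RR: "R k (R h x) = R h (R k x)" if x: "x \<in> vecs (MX \<chi>)" and \<chi>: "\<chi> \<in> X" for x \<chi>
  proof -
    have xM: "x \<in> vecs M" using x MX_subset_M[OF \<chi>] by blast
    show ?thesis
      unfolding R_on_MX[OF \<chi> x h(1)] R_on_MX[OF \<chi> x k(1)]
        intertwinerD(4)[OF R_intertwiner[OF h(1)] xM] intertwinerD(4)[OF R_intertwiner[OF k(1)] xM]
        M.vs.scale_scale by (simp only: mult.commute)
  qed
  have PM: "P \<chi> f \<in> vecs M" for \<chi> by (rule intertwinerD(2)[OF P_intertwiner fM])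
  have lin: "R j (\<Sum>\<chi>\<in>X. F \<chi>) = (\<Sum>\<chi>\<in>X. R j (F \<chi>))" if "j \<in> I" "\<And>\<chi>. F \<chi> \<in> vecs M" for j F
    by (rule linear_map_sum[OF M.fd M.fd intertwinerD(1)[OF R_intertwiner[OF that(1)]] that(2)])
  have "R (k \<otimes> h) f = R k (R h (\<Sum>\<chi>\<in>X. P \<chi> f))"
    unfolding sum_P[OF mf fM] by (rule R_mult[OF k(1) h(1) fM])
  also have "\<dots> = (\<Sum>\<chi>\<in>X. R k (R h (P \<chi> f)))"
    unfolding lin[OF h(1) PM] by (rule lin[OF k(1) R_closed[OF h(1) PM]])
  also have "\<dots> = (\<Sum>\<chi>\<in>X. R h (R k (P \<chi> f)))"
    by (rule sum.cong[OF refl]) (rule RR[OF P_closed[OF _ fM]])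
  also have "\<dots> = R h (R k (\<Sum>\<chi>\<in>X. P \<chi> f))"
    unfolding lin[OF k(1) PM] by (rule lin[OF h(1) R_closed[OF k(1) PM], symmetric])
  also have "\<dots> = R (h \<otimes> k) f"
    unfolding sum_P[OF mf fM] by (rule R_mult[OF h(1) k(1) fM, symmetric])
  finally have eq: "R (k \<otimes> h) f (inv (k \<otimes> h)) = R (h \<otimes> k) f (inv (k \<otimes> h))" by (simp only:)
  let ?c = "inv (k \<otimes> h) \<otimes> (h \<otimes> k)"
  have "f \<one> = a" using a \<theta>D(7) one_N by (simp add: f_def)
  then have "R (k \<otimes> h) f (inv (k \<otimes> h)) = \<xi> (k \<otimes> h) a" using hkG by (simp add: R_def)
  moreover have "\<xi> (k \<otimes> h) a \<noteq> 0"
    using \<xi>_inv_cancel(2)[OF hk(2) a(1)] linear_map_zero[OF fd fd \<xi>D(2)[OF I_inv[OF hk(2)]]] a(2) by auto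
  ultimately have nz: "\<xi> (h \<otimes> k) (f ?c) \<noteq> 0" using eq hkG by (simp add: R_def)
  have cN: "?c \<in> N"
  proof (rule ccontr)
    assume "?c \<notin> N"
    then have "f ?c = 0" by (simp add: f_def)
    then show False using nz linear_map_zero[OF fd fd \<xi>D(2)[OF hk(1)]] by simp
  qed
  have "k \<otimes> h \<otimes> ?c = h \<otimes> k" using hkG by (simp add: m_assoc[symmetric])
  then have "q (h \<otimes> k) = q (k \<otimes> h)" using q_mult_N[OF hk(2) cN] by simp
  then show "C \<otimes>\<^bsub>Q\<^esub> D = D \<otimes>\<^bsub>Q\<^esub> C" using h k by (simp add: q_mult)
qed

section \<open>The decomposition into pairwise inequivalent spherical representations\<close>

lemma M_equiv_dsum:
  assumes mf: "multiplicity_free G M act"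
  shows "equiv_rep G M act (dsum_space X MX) (dsum_act X (\<lambda>_. act))"
proof -
  define T where "T f \<chi> = (if \<chi> \<in> X then P \<chi> f else 0)" for f \<chi>
  note p = intertwinerD[OF P_intertwiner]
  have D: "x \<in> vecs (dsum_space X MX) \<longleftrightarrow> (\<forall>\<chi>\<in>X. x \<chi> \<in> vecs (MX \<chi>)) \<and> (\<forall>\<chi>. \<chi> \<notin> X \<longrightarrow> x \<chi> = 0)" for x
    by (simp add: dsum_space_def)
  have Dc: "cscale (dsum_space X MX) c x = (\<lambda>\<chi>. cscale M c (x \<chi>))" for c x
    by (simp add: dsum_space_def)
  have TD: "T f \<in> vecs (dsum_space X MX)" if "f \<in> vecs M" for f
    unfolding D using P_closed that by (simp add: T_def)
  have "linear_map M (dsum_space X MX) T"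
    unfolding linear_map_def
  proof (intro conjI ballI allI)
    show "T \<in> vecs M \<rightarrow> vecs (dsum_space X MX)" using TD by blast
    fix f assume f: "f \<in> vecs M"
    show "T (f + f') = T f + T f'" if "f' \<in> vecs M" for f'
      using p(3)[OF f that] by (simp add: T_def fun_eq_iff)
    show "T (cscale M c f) = cscale (dsum_space X MX) c (T f)" for c
    proof
      fix \<chi>
      show "T (cscale M c f) \<chi> = cscale (dsum_space X MX) c (T f) \<chi>"
        unfolding Dc T_def using p(4)[OF f] M.vs.scale_zero_right[of c] by (cases "\<chi> \<in> X") (simp_all only: if_True if_False)
    qed
  qed
  moreover have "T (act g f) = dsum_act X (\<lambda>_. act) g (T f)" if "g \<in> carrier G" "f \<in> vecs M" for g f
    by (rule ext) (simp add: T_def dsum_act_def p(5)[OF that])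
  moreover have "bij_betw T (vecs M) (vecs (dsum_space X MX))"
  \<comment> \<open>Adding the components inverts the map: \<open>sum_P\<close> gives one
    composition, and the mutual annihilation of the projections in \<open>P_on_MX\<close> the
    other.\<close>
  proof (rule bij_betw_byWitness[of _ "\<lambda>x. \<Sum>\<chi>\<in>X. x \<chi>"])
    have DM: "x \<chi> \<in> vecs M" if "x \<in> vecs (dsum_space X MX)" "\<chi> \<in> X" for x \<chi>
      using that MX_subset_M unfolding D by blast
    show "\<forall>f\<in>vecs M. (\<Sum>\<chi>\<in>X. T f \<chi>) = f"
      using sum_P[OF mf] by (simp add: T_def)
    show "\<forall>x\<in>vecs (dsum_space X MX). T (\<Sum>\<chi>\<in>X. x \<chi>) = x"
    proof (rule ballI, rule ext)
      fix x \<chi> assume x: "x \<in> vecs (dsum_space X MX)"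
      show "T (\<Sum>\<chi>\<in>X. x \<chi>) \<chi> = x \<chi>"
      proof (cases "\<chi> \<in> X")
        case True
        have "T (\<Sum>\<chi>\<in>X. x \<chi>) \<chi> = (\<Sum>\<chi>'\<in>X. P \<chi> (x \<chi>'))"
          using True linear_map_sum[OF M.fd M.fd p(1), of X x \<chi>] DM[OF x] by (simp add: T_def)
        also have "\<dots> = (\<Sum>\<chi>'\<in>X. if \<chi>' = \<chi> then x \<chi> else 0)"
          using P_on_MX[OF True] x unfolding D by (intro sum.cong) auto
        finally show ?thesis using True finite_X by simp
      next
        case False
        then show ?thesis using x unfolding D by (simp add: T_def)
      qed
    qed
    show "T ` vecs M \<subseteq> vecs (dsum_space X MX)" using TD by blast
    show "(\<lambda>x. \<Sum>\<chi>\<in>X. x \<chi>) ` vecs (dsum_space X MX) \<subseteq> vecs M"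
      by (rule image_subsetI) (rule M.vecs_sum[OF DM])
  qed
  ultimately show ?thesis unfolding equiv_rep_def intertwiner_def by blast
qed

text \<open>Equivalent components would coincide as subspaces. But the projection for the first
  character fixes the first component and annihilates the second, so the common subspace would be
  zero.\<close>

lemma MX_not_equiv:
  assumes mf: "multiplicity_free G M act" and \<chi>: "\<chi>\<^sub>1 \<in> X" "\<chi>\<^sub>2 \<in> X" "\<chi>\<^sub>1 \<noteq> \<chi>\<^sub>2"
  shows "\<not> equiv_rep G (MX \<chi>\<^sub>1) act (MX \<chi>\<^sub>2) act"
proof
  assume "equiv_rep G (MX \<chi>\<^sub>1) act (MX \<chi>\<^sub>2) act"
  then have "equiv_rep G (M\<lparr>vecs := vecs (MX \<chi>\<^sub>1)\<rparr>) act (M\<lparr>vecs := vecs (MX \<chi>\<^sub>2)\<rparr>) act"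
    using equiv_rep_sym[OF unitary_MX[OF \<chi>(1)] MX_equiv_sub] MX_equiv_sub equiv_rep_trans by blast
  then have eq: "vecs (MX \<chi>\<^sub>1) = vecs (MX \<chi>\<^sub>2)"
    by (rule multiplicity_free_unique[OF group_axioms unitary_M mf MX_invariant[OF \<chi>(1)]
          irreducible_MX_sub[OF \<chi>(1)] MX_invariant[OF \<chi>(2)] irreducible_MX_sub[OF \<chi>(2)]])
  have "x = 0" if "x \<in> vecs (MX \<chi>\<^sub>1)" for x
    using P_on_MX[OF \<chi>(1) \<chi>(1) that] P_on_MX[OF \<chi>(1) \<chi>(2)] that \<chi>(3) eq by simp
  then have "vecs (MX \<chi>\<^sub>1) \<subseteq> {0}" by blast
  then show False
    using irreducible_repD(2)[OF irreducible_MX[OF \<chi>(1)]]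
      M.vs.subspace_0[OF invariant_subspaceD(1)[OF MX_invariant[OF \<chi>(1)]]] by blast
qed

text \<open>The copy inside the induced representation lies in one component, and irreducibility of
  that component leaves no room for a proper nonzero subrepresentation.\<close>

lemma spherical_imp_MX:
  assumes mf: "multiplicity_free G M act" and W: "spherical_rep G N V \<theta> W \<sigma>"
  shows "\<exists>\<chi>\<in>X. equiv_rep G W \<sigma> (MX \<chi>) act"
proof -
  obtain U where U: "invariant_subspace G M act U" "equiv_rep G W \<sigma> (M\<lparr>vecs := U\<rparr>) act"
    and W: "irreducible_rep G W \<sigma>"
    using W unfolding spherical_rep_def contained_rep_def by blast
  have irr: "irreducible_rep G (M\<lparr>vecs := U\<rparr>) act"
    by (rule irreducible_rep_equiv[OF W unitary_rep_subspace[OF unitary_M U(1)] U(2)])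
  obtain \<chi> where \<chi>: "\<chi> \<in> X" "U \<subseteq> vecs (MX \<chi>)" using irreducible_sub_in_MX[OF mf U(1) irr] by blast
  have "invariant_subspace G (MX \<chi>) act U"
    using U(1) \<chi>(2) unfolding invariant_subspace_def by (simp add: cscale_M_eq)
  moreover have "U \<noteq> {0}" using irreducible_repD(2)[OF irr] by simp
  ultimately have "U = vecs (MX \<chi>)" using irreducible_repD(3)[OF irreducible_MX[OF \<chi>(1)]] by blast
  then have "equiv_rep G W \<sigma> (M\<lparr>vecs := vecs (MX \<chi>)\<rparr>) act" using U(2) by (simp only:)
  then have "equiv_rep G W \<sigma> (MX \<chi>) act"
    using equiv_rep_sym[OF unitary_MX[OF \<chi>(1)] MX_equiv_sub] equiv_rep_trans by blast
  then show ?thesis using \<chi>(1) by blast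
qed

subsection \<open>Spherical functions\<close>

text \<open>Both functions are supported on single cosets of \<open>I\<close>, which are disjoint
  unless \<open>g\<close> lies in \<open>I\<close>. If it does, unitarity makes all
  \<open>card I\<close> terms equal, and the denominator of the inner product cancels that
  number.\<close>

lemma basic_inner_translate:
  assumes \<chi>: "\<chi> \<in> X" and a: "a \<in> vecs V" and b: "b \<in> vecs V" and g: "g \<in> carrier G"
  shows "cinner (MX \<chi>) (basic \<chi> a) (act g (basic \<chi> b))
         = (if g \<in> I then cinner V a (tw \<chi> g b) else 0)"
proof -
  note t = unitary_repD[OF unitary_twist[OF \<chi>], simplified]
  have "(\<Sum>x\<in>carrier G. cinner V (basic \<chi> a x) (act g (basic \<chi> b) x))
      = (\<Sum>x\<in>I. cinner V (tw \<chi> (inv x) a) (basic \<chi> b (inv g \<otimes> x)))"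
  proof (rule sum.mono_neutral_cong_right[OF finite_G])
    show "I \<subseteq> carrier G" using I_sub by blast
    have "act g (basic \<chi> b) x \<in> vecs V" if "x \<in> carrier G" for x
      by (rule ind_spaceD(1)[OF unitary_repD(3)[OF unitary_MX[OF \<chi>] g basic_closed[OF \<chi> b]] that])
    then show "\<forall>x\<in>carrier G - I. cinner V (basic \<chi> a x) (act g (basic \<chi> b) x) = 0"
      by (simp add: basic_def)
    show "cinner V (basic \<chi> a x) (act g (basic \<chi> b) x) = cinner V (tw \<chi> (inv x) a) (basic \<chi> b (inv g \<otimes> x))"
      if "x \<in> I" for x using that I_sub by (simp add: basic_def ind_act_def)
  qed
  also have "\<dots> = (\<Sum>x\<in>I. if g \<in> I then cinner V a (tw \<chi> g b) else 0)"
  proof (rule sum.cong[OF refl])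
    fix x assume x: "x \<in> I"
    have xi: "inv x \<in> I" and xG: "x \<in> carrier G" using x I_inv I_sub by auto
    show "cinner V (tw \<chi> (inv x) a) (basic \<chi> b (inv g \<otimes> x)) = (if g \<in> I then cinner V a (tw \<chi> g b) else 0)"
    proof (cases "g \<in> I")
      case True
      have "basic \<chi> b (inv g \<otimes> x) = tw \<chi> (inv x) (tw \<chi> g b)"
        using True x xi g xG t(8)[OF xi True b] by (simp add: basic_def I_mult I_inv inv_mult_group)
      then show ?thesis using True t(6)[OF xi a t(3)[OF True b]] by simp
    next
      case False
      have "inv g \<otimes> x \<notin> I"
      proof
        assume "inv g \<otimes> x \<in> I"
        then have "inv (inv g \<otimes> x \<otimes> inv x) \<in> I" using xi I_mult I_inv by blast
        then show False using False g xG by (simp add: m_assoc)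
      qed
      then show ?thesis using False t(3)[OF xi a] by (simp add: basic_def)
    qed
  qed
  finally show ?thesis using card_I_pos by simp
qed

text \<open>Equivariance holds because characters of the quotient are trivial on \<open>N\<close>;
  isometry is the case of the identity element in \<open>basic_inner_translate\<close>.\<close>

lemma basic_isometric_intertwiner:
  assumes \<chi>: "\<chi> \<in> X"
  shows "isometric_intertwiner GN V \<theta> (MX \<chi>) act (basic \<chi>)"
proof -
  note t = unitary_repD[OF unitary_twist[OF \<chi>], simplified]
  have "basic \<chi> (\<theta> n a) = act n (basic \<chi> a)" if n: "n \<in> N" and a: "a \<in> vecs V" for n a
  proof
    fix x
    have nG: "n \<in> carrier G" using n by (rule N_sub)
    have tn: "tw \<chi> n a = \<theta> n a" using chi_N[OF \<chi> n] \<xi>_extends[OF n a] by (simp add: tw_eq)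
    show "basic \<chi> (\<theta> n a) x = act n (basic \<chi> a) x"
    proof (cases "x \<in> I")
      case True
      then show ?thesis
        using t(8)[OF I_inv[OF True] N_I[OF n] a] tn n nG I_sub[OF True]
        by (simp add: basic_def ind_act_def I_mult I_inv N_I inv_mult_group)
    next
      case False
      have "inv n \<otimes> x \<notin> I" if "x \<in> carrier G"
      proof
        assume "inv n \<otimes> x \<in> I"
        then have "n \<otimes> (inv n \<otimes> x) \<in> I" using I_mult N_I[OF n] by blast
        then show False using False nG that by (simp add: m_assoc[symmetric])
      qed
      then show ?thesis using False by (simp add: basic_def ind_act_def)
    qed
  qed
  moreover have "linear_map V (MX \<chi>) (basic \<chi>)"
    unfolding linear_map_def using basic_closed[OF \<chi>] t(4,5)[OF I_inv]
    by (auto simp: basic_def fun_eq_iff)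
  moreover have "isometric_on V (MX \<chi>) (basic \<chi>)"
    unfolding isometric_on_def
  proof (intro ballI)
    fix a b assume a: "a \<in> vecs V" and b: "b \<in> vecs V"
    have "act \<one> (basic \<chi> b) = basic \<chi> b"
      by (rule unitary_repD(7)[OF unitary_MX[OF \<chi>] basic_closed[OF \<chi> b]])
    then show "cinner (MX \<chi>) (basic \<chi> a) (basic \<chi> b) = cinner V a b"
      using basic_inner_translate[OF \<chi> a b one_closed] I_one t(7)[OF b] by simp
  qed
  ultimately show ?thesis unfolding isometric_intertwiner_def intertwiner_def by simp
qed

text \<open>Evaluating at \<open>g\<close> intertwines \<open>\<theta>\<close> with its conjugate by \<open>g\<close>, so an \<open>N\<close>-intertwiner into the
  induced space takes values supported on the inertia group and is determined by its value at the identity.\<close>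

lemma intertwiner_into_MX:
  assumes \<chi>: "\<chi> \<in> X" and L: "intertwiner GN V \<theta> (MX \<chi>) act L"
  shows "\<exists>c. \<forall>a\<in>vecs V. L a = cscale (MX \<chi>) c (basic \<chi> a)"
proof -
  note l = intertwinerD[OF L, simplified]
  have LM: "L a \<in> vecs M" if "a \<in> vecs V" for a using l(2)[OF that] MX_subset_M[OF \<chi>] by blast
  have ev: "intertwiner GN V \<theta> V (conj_rep G g \<theta>) (\<lambda>a. L a g)" if g: "g \<in> carrier G" for g
  proof -
    have "L (\<theta> n a) g = conj_rep G g \<theta> n (L a g)" if n: "n \<in> N" and a: "a \<in> vecs V" for n a
      using l(5)[OF n a] translate_eq_conj[OF LM[OF a] n g] g by (simp add: ind_act_def)
    then show ?thesis
      unfolding intertwiner_def linear_map_def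
      using ind_spaceD(1)[OF l(2) g] l(3,4) by auto
  qed
  have out: "L a g = 0" if "g \<notin> I" "a \<in> vecs V" for a g
  proof (cases "g \<in> carrier G")
    case True
    then show ?thesis
      using schur_equiv[OF irreducible_\<theta> irreducible_conj_rep[OF True] ev[OF True] that(2)]
        conj_rep_not_equiv[OF True that(1)] by blast
  qed (use ind_spaceD(2)[OF LM[OF that(2)]] in blast)
  have "conj_rep G \<one> \<theta> n = \<theta> n" if "n \<in> N" for n using N_sub[OF that] by (simp add: conj_rep_def)
  then have "intertwiner GN V \<theta> V \<theta> (\<lambda>a. L a \<one>)"
    using ev[OF one_closed] unfolding intertwiner_def by simp
  then obtain c where c: "\<And>a. a \<in> vecs V \<Longrightarrow> L a \<one> = cscale V c a"
    using schur_scalar[OF irreducible_\<theta>] by blast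
  have "L a = cscale (MX \<chi>) c (basic \<chi> a)" if a: "a \<in> vecs V" for a
  proof
    fix g
    show "L a g = cscale (MX \<chi>) c (basic \<chi> a) g"
    proof (cases "g \<in> I")
      case True
      have "L a (\<one> \<otimes> g) = tw \<chi> (inv g) (L a \<one>)"
        by (rule ind_spaceD(3)[OF l(2)[OF a] one_closed True])
      then show ?thesis
        using c[OF a] True I_sub unitary_repD(5)[OF unitary_twist[OF \<chi>], of "inv g" a] a I_inv
        by (simp add: basic_def)
    next
      case False
      then show ?thesis using out a by (simp add: basic_def)
    qed
  qed
  then show ?thesis by blast
qed

end

context hecke_extension
begin

text \<open>Any admissible \<open>L\<close> is a scalar multiple of the canonical embedding. Both
  are isometric, so the scalar is unimodular and cancels in the coefficient. The character is
  conjugated because it stands in the second, conjugate-linear argument of the inner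
  product.\<close>

lemma spherical_function:
  assumes \<chi>: "\<chi> \<in> X" and L: "isometric_intertwiner GN V \<theta> (MX \<chi>) act L"
  shows "coefficient (carrier G) (MX \<chi>) act (L v) = (\<lambda>g. infl G N (\<lambda>x. cnj (\<chi> x)) g * \<Psi> g)"
proof
  fix g
  note u = unitary_repD[OF unitary_MX[OF \<chi>]]
  interpret MX: fd_space "MX \<chi>" using u(1) by unfold_locales
  let ?w = "basic \<chi> v"
  have w: "?w \<in> vecs (MX \<chi>)" by (rule basic_closed[OF \<chi> v_vecs])
  obtain c where c: "L v = cscale (MX \<chi>) c ?w"
    using intertwiner_into_MX[OF \<chi>] L v_vecs unfolding isometric_intertwiner_def by blast
  have scaled: "cinner (MX \<chi>) (cscale (MX \<chi>) c x) (cscale (MX \<chi>) c y) = c * cnj c * cinner (MX \<chi>) x y"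
    if "x \<in> vecs (MX \<chi>)" "y \<in> vecs (MX \<chi>)" for x y
    unfolding MX.inner_scale_left[OF that(1) MX.vecs_scale[OF that(2)]] MX.inner_scale_right[OF that(2,1)]
    by (simp only: mult.assoc)
  have "cinner (MX \<chi>) (L v) (L v) = 1" "cinner (MX \<chi>) ?w ?w = 1"
    using L basic_isometric_intertwiner[OF \<chi>] v_vecs v_unit
    unfolding isometric_intertwiner_def isometric_on_def by metis+
  then have cc: "c * cnj c = 1" using scaled[OF w w] unfolding c by (simp only: mult_1_right)
  show "coefficient (carrier G) (MX \<chi>) act (L v) g = infl G N (\<lambda>x. cnj (\<chi> x)) g * \<Psi> g"
  proof (cases "g \<in> carrier G")
    case g: True
    have "coefficient (carrier G) (MX \<chi>) act (L v) g = cinner (MX \<chi>) (L v) (act g (L v))"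
      using g by (simp add: coefficient_def)
    also have "\<dots> = cinner (MX \<chi>) ?w (act g ?w)"
      unfolding c u(5)[OF g w] scaled[OF w u(3)[OF g w]] cc by (rule mult_1_left)
    also have "\<dots> = (if g \<in> I then cinner V v (tw \<chi> g v) else 0)"
      by (rule basic_inner_translate[OF \<chi> v_vecs v_vecs g])
    also have "\<dots> = infl G N (\<lambda>x. cnj (\<chi> x)) g * \<Psi> g"
      using \<xi>v v_vecs by (simp add: tw_eq \<Psi>_eq \<Psi>_outside infl_def inner_scale_right)
    finally show ?thesis .
  next
    case False
    then have "g \<notin> I" using I_sub by blast
    then show ?thesis using False by (simp add: coefficient_def)
  qed
qed

end

theorem theorem5p18:
  fixes G :: "('g, 'm) monoid_scheme" and N :: "'g set"
    and V :: "'v::ab_group_add cips" and \<theta> \<xi> :: "'g \<Rightarrow> 'v \<Rightarrow> 'v" and v :: 'v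
    and W :: "'w::ab_group_add cips" and \<sigma> :: "'g \<Rightarrow> 'w \<Rightarrow> 'w"
  defines "I \<equiv> inertia G N V \<theta>"
    and "GI \<equiv> inertia_group G N V \<theta>"
    and "Q \<equiv> inertia_quotient G N V \<theta>"
    and "d \<equiv> (of_nat (cdim V) :: complex)"
    and "\<Psi> \<equiv> coefficient (inertia G N V \<theta>) V \<xi> v"
    and "\<H> \<equiv> hecke_algebra G N (hecke_idem N V \<theta> v)"
    and "Ind\<chi> \<equiv> (\<lambda>\<chi>. ind_space G (inertia G N V \<theta>) V (twist V \<xi> (infl G N \<chi>)))"
  assumes "group G" and "finite (carrier G)" and "N \<lhd> G"
    and "irreducible_rep (G\<lparr>carrier := N\<rparr>) V \<theta>"
    and "multiplicity_free G (ind_space G N V \<theta>) (ind_act G)"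
    and "irreducible_rep GI V \<xi>"
    and "contained_rep GI V \<xi> (ind_space GI N V \<theta>) (ind_act GI)"
    and "\<forall>n\<in>N. \<forall>x\<in>vecs V. \<xi> n x = \<theta> n x"
    and "v \<in> vecs V" and "cinner V v v = 1"
  shows
    \<comment> \<open>(1)\<close>
    "(algebra complex_ring (group_algebra Q) \<and> algebra complex_ring \<H> \<and>
      infl_map G N \<Psi> (d / of_nat (card N)) \<in> algebra_iso (group_algebra Q) \<H> \<and>
      infl_map G N \<Psi> (d / of_nat (card I)) \<in> algebra_iso (normalized_group_algebra Q) \<H>) \<and>
    \<comment> \<open>(2)\<close>
     (equiv_rep G (ind_space G N V \<theta>) (ind_act G)
        (dsum_space (unitary_chars Q) Ind\<chi>) (dsum_act (unitary_chars Q) (\<lambda>_. ind_act G)) \<and>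
      (\<forall>\<chi>\<in>unitary_chars Q. spherical_rep G N V \<theta> (Ind\<chi> \<chi>) (ind_act G)) \<and>
      (\<forall>\<chi>\<^sub>1\<in>unitary_chars Q. \<forall>\<chi>\<^sub>2\<in>unitary_chars Q.
         \<chi>\<^sub>1 \<noteq> \<chi>\<^sub>2 \<longrightarrow> \<not> equiv_rep G (Ind\<chi> \<chi>\<^sub>1) (ind_act G) (Ind\<chi> \<chi>\<^sub>2) (ind_act G)) \<and>
      (spherical_rep G N V \<theta> W \<sigma> \<longrightarrow>
         (\<exists>\<chi>\<in>unitary_chars Q. equiv_rep G W \<sigma> (Ind\<chi> \<chi>) (ind_act G)))) \<and>
    \<comment> \<open>(3)\<close>
     (\<forall>\<chi>\<in>unitary_chars Q.
        (\<exists>L. isometric_intertwiner (G\<lparr>carrier := N\<rparr>) V \<theta> (Ind\<chi> \<chi>) (ind_act G) L) \<and>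
        (\<forall>L. isometric_intertwiner (G\<lparr>carrier := N\<rparr>) V \<theta> (Ind\<chi> \<chi>) (ind_act G) L \<longrightarrow>
           coefficient (carrier G) (Ind\<chi> \<chi>) (ind_act G) (L v)
             = (\<lambda>g. infl G N (\<lambda>x. cnj (\<chi> x)) g * \<Psi> g)))"
proof -
  interpret hecke_extension N G V \<theta> \<xi> v
    using assms(8-) by (intro hecke_extension.intro inertia_extension.intro inertia_extension_axioms.intro
        hecke_extension_axioms.intro) (auto simp: irreducible_rep_def GI_def)
  note mf = \<open>multiplicity_free G (ind_space G N V \<theta>) (ind_act G)\<close>
  have d: "d / of_nat (card N) = 1 / dN" by (simp add: d_def)
  show ?thesis
    unfolding d
    unfolding I_def Q_def d_def \<Psi>_def \<H>_def Ind\<chi>_def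
    using algebra_group_algebra[OF comm_group_Q[OF mf] finite_Q] algebra_hecke[OF comm_group_Q[OF mf]]
      infl_map_algebra_iso infl_map_normalized_algebra_iso M_equiv_dsum[OF mf] spherical_MX
      MX_not_equiv[OF mf] spherical_imp_MX[OF mf] basic_isometric_intertwiner spherical_function
    by (intro conjI ballI allI impI) blast+
qed

end
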